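(* Let $N\ge 1$ and let $\phi:\mathbb{B}_N\to\mathbb{B}_N$ be a holomorphic map. The following assertions are equivalent: (1) $C_\phi$ is compact on $H^\psi(\mathbb{B}_N)$ for every Orlicz function $\psi$; (2) there exists $\alpha>-1$ such that $C_\phi$ is compact on $A^\psi_\alpha(\mathbb{B}_N)$ for every Orlicz function $\psi$; (3) $C_\phi$ is compact on $H^\infty(\mathbb{B}_N)$; (4) $\|\phi\|_\infty:=\sup_{z\in\mathbb{B}_N}|\phi(z)|<1$.
   Context: $\mathbb{B}_N=\{z\in\mathbb{C}^N:|z|<1\}$ is the open unit ball of $\mathbb{C}^N$ with boundary sphere $\mathbb{S}_N$; $\sigma_N$ is the normalized rotation-invariant measure on $\mathbb{S}_N$, and for $\alpha>-1$, $dv_\alpha(z)=c_\alpha(1-|z|^2)^\alpha dv(z)$ is the weighted Lebesgue volume measure on $\mathbb{B}_N$ normalized to be a probability measure. For a holomorphic $\phi:\mathbb{B}_N\to\mathbb{B}_N$, the composition operator is $C_\phi f=f\circ\phi$. An Orlicz function is a strictly convex function $\psi:[0,\infty)\to[0,\infty)$ with $\psi(0)=0$, continuous at $0$, and $\psi(x)/x\to\infty$ as $x\to\infty$. For a probability space $(\Omega,\mathbb{P})$, $L^\psi(\Omega)$ is the space of measurable $f$ with $\int_\Omega\psi(|f|/C)\,d\mathbb{P}<\infty$ for some $C>0$, normed by the Luxemburg norm $\|f\|_\psi=\inf\{C>0:\int_\Omega\psi(|f|/C)\,d\mathbb{P}\le 1\}$. The Hardy–Orlicz space $H^\psi(\mathbb{B}_N)$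 is the Banach space of holomorphic $f$ on $\mathbb{B}_N$ with $\|f\|_{H^\psi}:=\sup_{0<r<1}\|f_r\|_{L^\psi(\mathbb{S}_N,\sigma_N)}<\infty$, where $f_r(\zeta)=f(r\zeta)$. The weighted Bergman–Orlicz space $A^\psi_\alpha(\mathbb{B}_N)$ is the space of holomorphic functions on $\mathbb{B}_N$ belonging to $L^\psi(\mathbb{B}_N,v_\alpha)$, with the Luxemburg norm. *)

theory Defs
  imports "HOL-Analysis.Analysis"
begin

text \<open>Points of C^N are vectors of type complex^'n ('n a finite index type, N = CARD('n) \<ge> 1);
  the norm of complex^'n is the Euclidean (Hermitian) norm, so ball 0 1 is the unit ball B_N.\<close>

definition unit_ball :: "(complex ^ 'n::finite) set" where
  "unit_ball = ball 0 1"

definition holo_on :: "(complex ^ 'n::finite \<Rightarrow> complex) \<Rightarrow> (complex ^ 'n) set \<Rightarrow> bool" where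
  "holo_on f S \<longleftrightarrow> (\<forall>z\<in>S. \<exists>L. (f has_derivative L) (at z) \<and> (\<forall>c v. L (c *s v) = c * L v))"

definition holo_self_map :: "(complex ^ 'n::finite \<Rightarrow> complex ^ 'n) \<Rightarrow> bool" where
  "holo_self_map \<phi> \<longleftrightarrow> (\<forall>i. holo_on (\<lambda>z. \<phi> z $ i) unit_ball) \<and> \<phi> ` unit_ball \<subseteq> unit_ball"

definition strict_convex_on :: "real set \<Rightarrow> (real \<Rightarrow> real) \<Rightarrow> bool" where
  "strict_convex_on S f \<longleftrightarrow> (\<forall>x\<in>S. \<forall>y\<in>S. x \<noteq> y \<longrightarrow> (\<forall>t. 0 < t \<and> t < 1 \<longrightarrow>
      f ((1 - t) * x + t * y) < (1 - t) * f x + t * f y))"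

definition orlicz_fun :: "(real \<Rightarrow> real) \<Rightarrow> bool" where
  "orlicz_fun \<psi> \<longleftrightarrow> strict_convex_on {0..} \<psi> \<and> (\<forall>x\<ge>0. \<psi> x \<ge> 0) \<and> \<psi> 0 = 0
     \<and> continuous (at 0 within {0..}) \<psi> \<and> filterlim (\<lambda>x. \<psi> x / x) at_top at_top"

text \<open>Normalized surface measure sigma_N on the sphere: the push-forward of normalized Lebesgue
  measure on the ball under z \<mapsto> z/|z| (the cone measure, which is the normalized
  rotation-invariant measure on S_N).\<close>
definition sphere_measure :: "(complex ^ 'n::finite) measure" where
  "sphere_measure = distr
     (density lborel (\<lambda>z. indicator (ball 0 1) z / emeasure lborel (ball (0::complex^'n) 1)))
     (restrict_space lborel (sphere 0 1)) sgn"

definition bweight :: "real \<Rightarrow> complex ^ 'n::finite \<Rightarrow> real" where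
  "bweight \<alpha> z = (1 - norm z ^ 2) powr \<alpha>"

definition bergman_measure :: "real \<Rightarrow> (complex ^ 'n::finite) measure" where
  "bergman_measure \<alpha> = density (restrict_space lborel (ball 0 1))
     (\<lambda>z. ennreal (bweight \<alpha> z) / (\<integral>\<^sup>+ w. ennreal (bweight \<alpha> w) \<partial>(restrict_space lborel (ball (0::complex^'n) 1))))"

definition orlicz_space :: "'a measure \<Rightarrow> (real \<Rightarrow> real) \<Rightarrow> ('a \<Rightarrow> complex) set" where
  "orlicz_space M \<psi> = {f. f \<in> borel_measurable M \<and>
     (\<exists>C>0. (\<integral>\<^sup>+ x. ennreal (\<psi> (norm (f x) / C)) \<partial>M) < \<infinity>)}"

definition lux_norm :: "'a measure \<Rightarrow> (real \<Rightarrow> real) \<Rightarrow> ('a \<Rightarrow> complex) \<Rightarrow> real" where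
  "lux_norm M \<psi> f = Inf {C. C > 0 \<and> (\<integral>\<^sup>+ x. ennreal (\<psi> (norm (f x) / C)) \<partial>M) \<le> 1}"

definition hardy_orlicz_norm :: "(real \<Rightarrow> real) \<Rightarrow> (complex ^ 'n::finite \<Rightarrow> complex) \<Rightarrow> real" where
  "hardy_orlicz_norm \<psi> f = (SUP r\<in>{0<..<1}. lux_norm sphere_measure \<psi> (\<lambda>\<zeta>. f (r *\<^sub>R \<zeta>)))"

definition hardy_orlicz :: "(real \<Rightarrow> real) \<Rightarrow> (complex ^ 'n::finite \<Rightarrow> complex) set" where
  "hardy_orlicz \<psi> = {f. holo_on f unit_ball \<and>
     (\<forall>r\<in>{0<..<1}. (\<lambda>\<zeta>. f (r *\<^sub>R \<zeta>)) \<in> orlicz_space sphere_measure \<psi>) \<and>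
     bdd_above ((\<lambda>r. lux_norm sphere_measure \<psi> (\<lambda>\<zeta>. f (r *\<^sub>R \<zeta>))) ` {0<..<1})}"

definition bergman_orlicz :: "(real \<Rightarrow> real) \<Rightarrow> real \<Rightarrow> (complex ^ 'n::finite \<Rightarrow> complex) set" where
  "bergman_orlicz \<psi> \<alpha> = {f. holo_on f unit_ball \<and> f \<in> orlicz_space (bergman_measure \<alpha>) \<psi>}"

definition bergman_orlicz_norm :: "(real \<Rightarrow> real) \<Rightarrow> real \<Rightarrow> (complex ^ 'n::finite \<Rightarrow> complex) \<Rightarrow> real" where
  "bergman_orlicz_norm \<psi> \<alpha> f = lux_norm (bergman_measure \<alpha>) \<psi> f"

definition hinf :: "(complex ^ 'n::finite \<Rightarrow> complex) set" where
  "hinf = {f. holo_on f unit_ball \<and> bounded (f ` unit_ball)}"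

definition hinf_norm :: "(complex ^ 'n::finite \<Rightarrow> complex) \<Rightarrow> real" where
  "hinf_norm f = (SUP z\<in>unit_ball. norm (f z))"

definition compact_comp ::
  "('a \<Rightarrow> complex) set \<Rightarrow> (('a \<Rightarrow> complex) \<Rightarrow> real) \<Rightarrow> ('a \<Rightarrow> 'a) \<Rightarrow> bool" where
  "compact_comp X nrm \<phi> \<longleftrightarrow> (\<forall>f\<in>X. f \<circ> \<phi> \<in> X) \<and>
     (\<forall>F::nat \<Rightarrow> 'a \<Rightarrow> complex. (\<forall>n. F n \<in> X \<and> nrm (F n) \<le> 1) \<longrightarrow>
        (\<exists>r g. strict_mono r \<and> g \<in> X \<and> (\<lambda>k. nrm (\<lambda>z. F (r k) (\<phi> z) - g z)) \<longlonglongrightarrow> 0))"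

end

theory Submission
  imports Defs "HOL-Complex_Analysis.Complex_Analysis"
begin

text \<open>If the image of \<open>\<phi>\<close> stays in \<open>cball 0 s\<close> with \<open>s < 1\<close>, Montel's theorem gives from every bounded
  sequence a subsequence that converges uniformly on \<open>cball 0 s\<close>, so that its composition with \<open>\<phi>\<close>
  converges uniformly on the ball, which dominates convergence in each of the norms. This only
  uses that the norm bounds point evaluations locally uniformly: by the mean value property they
  are bounded by an integral over the ball, hence by the \<open>L\<^sup>1\<close> norm for the respective measure, which
  the Luxemburg norm dominates.

  Conversely let \<open>\<phi> (z\<^sub>k)\<close> tend to a point \<open>u\<close> of the sphere and put \<open>h z = (1 + \<langle>z, u\<rangle>) / 2\<close>. The integrals
  \<open>I m\<close> of \<open>m\<close>-th powers of (a majorant of) \<open>|h|\<close> tend to 0, while the set where \<open>|h \<circ> \<phi>| ^ m > 1/2\<close> has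
  positive measure \<open>\<epsilon> m\<close>. For a sufficiently fast growing \<open>\<psi>\<close> and suitable \<open>m k\<close>, the functions
  \<open>(k + 1) * h ^ m k\<close> lie in the unit ball and tend to 0 pointwise, but their compositions with \<open>\<phi>\<close>
  have norm at least 1/4.\<close>

section \<open>Lebesgue measure in polar form\<close>

text \<open>The proof compares the sequences \<open>I\<close> and \<open>\<epsilon>\<close> in no
  way, so a \<open>\<psi>\<close> fixed in advance need not serve: \<open>\<psi>\<close> is built
  for the given \<phi> (and \<alpha>). For amplitude A, convexity bounds the modular of A times the
  m-th power by \<open>\<psi> A * I m\<close>, whereas a Chebyshev estimate keeps the norm of the
  composition above 1/4 once \<open>\<psi> (2 * A) * \<epsilon> m > 1\<close>. Convexity puts no
  upper limit on the growth of \<open>\<psi>\<close> between A and 2 * A, so both demands can be met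
  for A = k + 1 and every k. Thus \<open>\<epsilon> m\<close> need only be positive, which holds
  because the set in question is open and nonempty; no boundary values of \<phi> are used. The
  growing amplitudes do not spoil pointwise convergence, as \<open>m k \<ge> k\<close> and (k + 1) *
  t ^ k tends to 0 for t < 1.

  In the converse direction, the Hardy norm sees spheres only, but the mean value property yields a
  volume integral. \<open>polar_inequality\<close> connects them; a one-sided estimate with a crude
  constant is enough, since only boundedness of evaluations matters.\<close>

lemma emeasure_lborel_open_pos:
  fixes U :: "'a::euclidean_space set"
  assumes "open U" "U \<noteq> {}"
  shows "emeasure lborel U > 0"
proof -
  obtain x e where e: "e > 0" "ball x e \<subseteq> U"
    using assms by (meson ex_in_conv open_contains_ball)
  have "0 < emeasure lborel (ball x e)" using e(1) by (simp add: emeasure_ball)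
  also have "\<dots> \<le> emeasure lborel U" by (rule emeasure_mono) (use e assms in auto)
  finally show ?thesis .
qed

text \<open>Integrating \<open>1\<^sub>A (x + y) * 1\<^sub>B (y)\<close> in both orders, with \<open>B\<close> the unit ball, which is symmetric.\<close>

lemma translation_invariant_eq_lborel:
  fixes \<mu> :: "'a::euclidean_space measure"
  assumes sets: "sets \<mu> = sets borel"
    and sigma_fin: "sigma_finite_measure \<mu>"
    and inv: "\<And>A y. A \<in> sets borel \<Longrightarrow> emeasure \<mu> ((\<lambda>x. x + y) -` A) = emeasure \<mu> A"
    and ball: "emeasure \<mu> (ball 0 1) = emeasure lborel (ball (0::'a) 1)"
  shows "\<mu> = lborel"
proof (rule measure_eqI)
  fix A assume "A \<in> sets \<mu>"
  then have A[measurable]: "A \<in> sets borel" using sets by simp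
  interpret m: sigma_finite_measure \<mu> by fact
  interpret pair_sigma_finite \<mu> lborel
    by (intro pair_sigma_finite.intro sigma_fin lborel.sigma_finite_measure_axioms)
  define B where "B = ball (0::'a) 1"
  have B[measurable]: "B \<in> sets borel" by (simp add: B_def)
  have ms[measurable_cong]: "sets \<mu> = sets borel" by fact
  have "emeasure \<mu> A * emeasure lborel B = (\<integral>\<^sup>+y. emeasure \<mu> A * indicator B y \<partial>lborel)"
    by (simp add: nn_integral_cmult_indicator)
  also have "\<dots> = (\<integral>\<^sup>+y. (\<integral>\<^sup>+x. indicator A (x + y) * indicator B y \<partial>\<mu>) \<partial>lborel)"
  proof (intro nn_integral_cong)
    fix y :: 'a
    have "(\<integral>\<^sup>+x. indicator A (x + y) * indicator B y \<partial>\<mu>) = (\<integral>\<^sup>+x. indicator A (x + y) \<partial>\<mu>) * indicator B y"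
      by (rule nn_integral_multc) simp
    also have "(\<integral>\<^sup>+x. indicator A (x + y) \<partial>\<mu>) = (\<integral>\<^sup>+x. indicator ((\<lambda>x. x + y) -` A) x \<partial>\<mu>)"
      by (auto intro!: nn_integral_cong simp: indicator_def)
    also have "\<dots> = emeasure \<mu> ((\<lambda>x. x + y) -` A)"
    proof (rule nn_integral_indicator)
      have "(\<lambda>x. x + y) -` A \<inter> space borel \<in> sets borel" by (rule measurable_sets[of _ borel borel]) auto
      then show "(\<lambda>x. x + y) -` A \<in> sets \<mu>" using sets by simp
    qed
    also have "\<dots> = emeasure \<mu> A" by (rule inv[OF A])
    finally show "emeasure \<mu> A * indicator B y = (\<integral>\<^sup>+x. indicator A (x + y) * indicator B y \<partial>\<mu>)" by simp
  qed
  also have "\<dots> = (\<integral>\<^sup>+x. (\<integral>\<^sup>+y. indicator A (x + y) * indicator B y \<partial>lborel) \<partial>\<mu>)"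
    by (subst Fubini') (auto simp: split_beta)
  also have "\<dots> = (\<integral>\<^sup>+x. (\<integral>\<^sup>+y. indicator A y * indicator B (y - x) \<partial>lborel) \<partial>\<mu>)"
  proof (rule nn_integral_cong)
    fix x :: 'a
    have "(\<integral>\<^sup>+y. indicator A y * indicator B (y - x) \<partial>(lborel::'a measure)) 
      = (\<integral>\<^sup>+y. indicator A y * indicator B (y - x) \<partial>(distr lborel borel ((+) x)))"
      by (simp add: lborel_distr_plus)
    also have "\<dots> = (\<integral>\<^sup>+y. indicator A (x + y) * indicator B y \<partial>lborel)"
      by (subst nn_integral_distr) auto
    finally show "(\<integral>\<^sup>+y. indicator A (x + y) * indicator B y \<partial>lborel)
       = (\<integral>\<^sup>+y. indicator A y * indicator B (y - x) \<partial>(lborel::'a measure))" ..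
  qed
  also have "\<dots> = (\<integral>\<^sup>+y. (\<integral>\<^sup>+x. indicator A y * indicator B (y - x) \<partial>\<mu>) \<partial>lborel)"
    by (subst Fubini') (auto simp: split_beta)
  also have "\<dots> = (\<integral>\<^sup>+y. emeasure \<mu> B * indicator A y \<partial>lborel)"
  proof (intro nn_integral_cong)
    fix y :: 'a
    have "(\<integral>\<^sup>+x. indicator A y * indicator B (y - x) \<partial>\<mu>) = indicator A y * (\<integral>\<^sup>+x. indicator B (y - x) \<partial>\<mu>)"
      by (rule nn_integral_cmult) simp
    also have "(\<integral>\<^sup>+x. indicator B (y - x) \<partial>\<mu>) = (\<integral>\<^sup>+x. indicator ((\<lambda>x. x + (-y)) -` B) x \<partial>\<mu>)"
      by (auto intro!: nn_integral_cong simp: indicator_def B_def norm_minus_commute)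
    also have "\<dots> = emeasure \<mu> ((\<lambda>x. x + (-y)) -` B)"
    proof (rule nn_integral_indicator)
      have "(\<lambda>x. x + (-y)) -` B \<inter> space borel \<in> sets borel" by (rule measurable_sets[of _ borel borel]) auto
      then show "(\<lambda>x. x + (-y)) -` B \<in> sets \<mu>" using sets by simp
    qed
    also have "\<dots> = emeasure \<mu> B" by (rule inv[OF B])
    finally show "(\<integral>\<^sup>+x. indicator A y * indicator B (y - x) \<partial>\<mu>) = emeasure \<mu> B * indicator A y" by (simp add: mult.commute)
  qed
  also have "\<dots> = emeasure lborel B * emeasure lborel A"
    by (simp add: nn_integral_cmult_indicator ball B_def)
  finally have eq: "emeasure lborel B * emeasure \<mu> A = emeasure lborel B * emeasure lborel A" by (simp add: mult.commute)
  have "emeasure lborel B \<noteq> 0" "emeasure lborel B \<noteq> top"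
    using emeasure_lborel_ball_finite[of "0::'a" 1] emeasure_lborel_open_pos[of "ball (0::'a) 1"] by (auto simp: B_def)
  with eq show "emeasure \<mu> A = emeasure lborel A" by (simp add: ennreal_mult_cancel_left)
qed (use sets in simp)

text \<open>The push-forward is translation invariant, since by linearity translation by
  \<open>T y'\<close> pulls back to translation by \<open>y'\<close>, and it gives the unit ball the
  right mass, since T preserves norms. It is applied to multiplication of vectors by a unimodular
  complex number.\<close>

lemma distr_lborel_isometry:
  fixes T :: "'a::euclidean_space \<Rightarrow> 'a"
  assumes "orthogonal_transformation T"
  shows "distr lborel borel T = lborel"
proof (rule translation_invariant_eq_lborel)
  have lin: "linear T" and nT: "\<And>x. norm (T x) = norm x" and bij: "bij T"
    using assms orthogonal_transformation_norm orthogonal_transformation_linear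
      orthogonal_transformation_bij by blast+
  have T[measurable]: "T \<in> borel_measurable borel"
    using lin by (intro borel_measurable_continuous_onI) (simp add: linear_continuous_on linear_linear)
  have ball_eq: "T -` ball 0 r = ball 0 r" for r by (auto simp: nT)
  show "sets (distr lborel borel T) = sets borel" by simp
  show "emeasure (distr lborel borel T) (ball 0 1) = emeasure lborel (ball (0::'a) 1)"
    by (subst emeasure_distr) (auto simp: ball_eq)
  show "sigma_finite_measure (distr lborel borel T)"
  proof (rule sigma_finite_measure.intro, intro exI conjI)
    let ?A = "range (\<lambda>n::nat. ball (0::'a) (real n))"
    show "countable ?A" by simp
    show "?A \<subseteq> sets (distr lborel borel T)" by auto
    show "\<Union>?A = space (distr lborel borel T)" using reals_Archimedean2 by auto
    show "\<forall>a\<in>?A. emeasure (distr lborel borel T) a \<noteq> \<infinity>"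
      using emeasure_lborel_ball_finite by (auto simp: emeasure_distr ball_eq less_top)
  qed
  fix A :: "'a set" and y assume A[measurable]: "A \<in> sets borel"
  obtain y' where y': "y = T y'" using bij by (meson bij_pointE)
  have m: "(\<lambda>x. x + y) -` A \<in> sets borel"
    using measurable_sets[of "\<lambda>x. x + y" borel borel A] by auto
  have m2: "T -` A \<in> sets borel"
    using measurable_sets[of T borel borel A] by auto
  have "T -` (\<lambda>x. x + y) -` A = (\<lambda>x. y' + x) -` (T -` A)"
    using lin by (auto simp: y' linear_add add.commute)
  then have "emeasure (distr lborel borel T) ((\<lambda>x. x + y) -` A) = emeasure lborel ((\<lambda>x. y' + x) -` (T -` A))"
    using m by (simp add: emeasure_distr)
  also have "\<dots> = emeasure (distr lborel borel ((+) y')) (T -` A)"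
    using m2 by (subst emeasure_distr) auto
  also have "\<dots> = emeasure (distr lborel borel T) A"
    using m2 by (simp add: lborel_distr_plus emeasure_distr)
  finally show "emeasure (distr lborel borel T) ((\<lambda>x. x + y) -` A) = emeasure (distr lborel borel T) A" .
qed

lemma nn_integral_lborel_scaleR:
  fixes g :: "'a::euclidean_space \<Rightarrow> ennreal"
  assumes [measurable]: "g \<in> borel_measurable borel" and c: "c > 0"
  shows "(\<integral>\<^sup>+z. g (c *\<^sub>R z) \<partial>lborel) = ennreal (1 / c ^ DIM('a)) * (\<integral>\<^sup>+w. g w \<partial>lborel)"
proof -
  have "(\<integral>\<^sup>+w. g w \<partial>lborel) = ennreal (c ^ DIM('a)) * (\<integral>\<^sup>+z. g (c *\<^sub>R z) \<partial>lborel)"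
    using c by (subst lborel_affine[of c 0]) (simp_all add: nn_integral_density nn_integral_distr nn_integral_cmult)
  then have "ennreal (1 / c ^ DIM('a)) * (\<integral>\<^sup>+w. g w \<partial>lborel)
     = (ennreal (1 / c ^ DIM('a)) * ennreal (c ^ DIM('a))) * (\<integral>\<^sup>+z. g (c *\<^sub>R z) \<partial>lborel)"
    by (simp add: mult.assoc)
  also have "ennreal (1 / c ^ DIM('a)) * ennreal (c ^ DIM('a)) = 1"
    using c by (simp flip: ennreal_mult')
  finally show ?thesis by simp
qed

lemma pred_mem_ball [measurable (raw)]:
  fixes f :: "'b \<Rightarrow> 'a::euclidean_space"
  assumes "f \<in> borel_measurable M"
  shows "Measurable.pred M (\<lambda>x. f x \<in> ball c r)"
proof -
  have "f -` ball c r \<inter> space M \<in> sets M" using assms by (rule measurable_sets) simp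
  then show ?thesis by (simp add: pred_def vimage_def Int_def conj_commute)
qed

text \<open>Substitute \<open>r = t * norm z\<close> and then \<open>w = t z\<close> on the right: this yields the weight
  \<open>norm w * (\<integral>t \<ge> norm w. 1 / t ^ (d + 1))\<close> at \<open>w\<close>, and restricting \<open>t\<close> to \<open>{norm w<..<2 * norm w}\<close>
  bounds it below by \<open>1 / 2 ^ (d + 1)\<close>.\<close>

lemma polar_inequality:
  fixes g :: "'a::euclidean_space \<Rightarrow> ennreal"
  assumes [measurable]: "g \<in> borel_measurable borel"
  defines "d \<equiv> DIM('a)"
  shows "(\<integral>\<^sup>+w. g w * indicator (ball 0 1) w \<partial>lborel)
    \<le> 2 ^ (d + 1) * (\<integral>\<^sup>+r. (\<integral>\<^sup>+z. g (r *\<^sub>R sgn z) * indicator (ball 0 1) z \<partial>lborel) * indicator {0<..<1} r \<partial>lborel)"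
proof -
  have sgnm[measurable]: "(sgn :: 'a \<Rightarrow> 'a) \<in> borel_measurable borel"
    unfolding sgn_div_norm by measurable
  let ?B = "ball (0::'a) 1"
  define G where "G w t = ennreal (if 0 < norm w \<and> norm w < 1 \<and> norm w < t then norm w / t ^ (d+1) else 0)"
    for w :: 'a and t :: real
  have Gm[measurable]: "case_prod G \<in> borel_measurable (borel \<Otimes>\<^sub>M borel)"
    unfolding G_def by measurable
  have d0: "d > 0" by (simp add: d_def)
  have "(\<integral>\<^sup>+w. g w * indicator ?B w \<partial>lborel) \<le> (\<integral>\<^sup>+w. 2 ^ (d+1) * (\<integral>\<^sup>+t. g w * G w t \<partial>lborel) \<partial>lborel)"
  proof (rule nn_integral_mono_AE)
    have "AE w in lborel. w \<noteq> (0::'a)" by (rule AE_lborel_singleton)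
    then show "AE w in lborel. g w * indicator ?B w \<le> 2 ^ (d+1) * (\<integral>\<^sup>+t. g w * G w t \<partial>lborel)"
    proof eventually_elim
      case (elim w)
      show ?case
      proof (cases "norm w < 1")
        case True
        have nw: "norm w > 0" using elim by simp
        have "ennreal (norm w / (2 * norm w) ^ (d+1)) * emeasure lborel {norm w<..<2 * norm w}
           = (\<integral>\<^sup>+t. ennreal (norm w / (2 * norm w) ^ (d+1)) * indicator {norm w<..<2 * norm w} t \<partial>lborel)"
          by (simp add: nn_integral_cmult_indicator)
        also have "\<dots> \<le> (\<integral>\<^sup>+t. G w t \<partial>lborel)"
        proof (rule nn_integral_mono)
          fix t :: real
          show "ennreal (norm w / (2 * norm w) ^ (d+1)) * indicator {norm w<..<2 * norm w} t \<le> G w t"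
          proof (cases "norm w < t \<and> t < 2 * norm w")
            case t: True
            then have "t > 0" using nw by linarith
            with t have "t ^ (d+1) \<le> (2 * norm w) ^ (d+1)" by (intro power_mono) auto
            then have "norm w / (2 * norm w) ^ (d+1) \<le> norm w / t ^ (d+1)"
              using nw by (intro divide_left_mono) (auto simp del: power_Suc simp: \<open>t > 0\<close>)
            then show ?thesis using t nw True by (auto simp: G_def indicator_def intro!: ennreal_leI)
          qed (auto simp: indicator_def)
        qed
        also have "emeasure lborel {norm w<..<2 * norm w} = ennreal (norm w)" by simp
        also have "ennreal (norm w / (2 * norm w) ^ (d+1)) * ennreal (norm w)
            = ennreal (1 / 2 ^ (d+1) * (1 / norm w ^ (d - 1)))"
          using nw d0 by (subst ennreal_mult[symmetric])
            (auto simp: power_mult_distrib field_simps power_eq_if[of _ "d"] )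
        finally have 1: "ennreal (1 / 2 ^ (d+1) * (1 / norm w ^ (d - 1))) \<le> (\<integral>\<^sup>+t. G w t \<partial>lborel)" .
        \<comment> \<open>As \<open>norm w < 1\<close> and d is at least 1, the factor
          \<open>1 / norm w ^ (d - 1)\<close> is at least 1 and may be dropped.\<close>
        have "ennreal (1 / 2 ^ (d+1)) \<le> ennreal (1 / 2 ^ (d+1) * (1 / norm w ^ (d - 1)))"
          using True nw by (intro ennreal_leI) (simp add: field_simps power_le_one)
        note 2 = order_trans[OF this 1]
        have "(1::ennreal) = ennreal (2 ^ (d+1)) * ennreal (1 / 2 ^ (d+1))"
          by (subst ennreal_mult[symmetric]) auto
        also have "ennreal (2 ^ (d+1)) = 2 ^ (d+1)" by (metis ennreal_numeral ennreal_power zero_le_numeral)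
        finally have "1 \<le> 2 ^ (d+1) * (\<integral>\<^sup>+t. G w t \<partial>lborel)"
          using mult_left_mono[OF 2, of "2^(d+1)"] by auto
        then have "g w * 1 \<le> g w * (2 ^ (d+1) * (\<integral>\<^sup>+t. G w t \<partial>lborel))" by (rule mult_left_mono) simp
        also have "\<dots> = 2 ^ (d+1) * (\<integral>\<^sup>+t. g w * G w t \<partial>lborel)"
          by (subst nn_integral_cmult) (auto simp: mult_ac)
        finally show ?thesis using True by simp
      qed (simp)
    qed
  qed
  also have "\<dots> = 2 ^ (d+1) * (\<integral>\<^sup>+w. (\<integral>\<^sup>+t. g w * G w t \<partial>lborel) \<partial>lborel)"
    by (rule nn_integral_cmult) measurable
  also have "(\<integral>\<^sup>+w. (\<integral>\<^sup>+t. g w * G w t \<partial>lborel) \<partial>lborel) = (\<integral>\<^sup>+t. (\<integral>\<^sup>+w. g w * G w t \<partial>lborel) \<partial>lborel)"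
    by (rule lborel_pair.Fubini') measurable
  also have "\<dots> = (\<integral>\<^sup>+t. (\<integral>\<^sup>+z. g (t *\<^sub>R z) * ennreal (norm z) * indicator ?B z * indicator {0<..<1} (t * norm z) \<partial>lborel) \<partial>lborel)"
  proof (rule nn_integral_cong)
    fix t :: real
    show "(\<integral>\<^sup>+w. g w * G w t \<partial>lborel) = (\<integral>\<^sup>+z. g (t *\<^sub>R z) * ennreal (norm z) * indicator ?B z * indicator {0<..<1} (t * norm z) \<partial>lborel)"
    proof (cases "t > 0")
      case True
      define k where "k w = (if 0 < norm w \<and> norm w < t \<and> norm w < 1 then g w * ennreal (norm w / t) else 0)" for w
      have [measurable]: "k \<in> borel_measurable borel" unfolding k_def by measurable
      have "(\<integral>\<^sup>+z. g (t *\<^sub>R z) * ennreal (norm z) * indicator ?B z * indicator {0<..<1} (t * norm z) \<partial>lborel)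
         = (\<integral>\<^sup>+z. k (t *\<^sub>R z) \<partial>lborel)"
        using True by (intro nn_integral_cong) (auto simp: k_def indicator_def zero_less_mult_iff)
      also have "\<dots> = ennreal (1 / t ^ d) * (\<integral>\<^sup>+w. k w \<partial>lborel)"
        unfolding d_def by (rule nn_integral_lborel_scaleR) (use True in auto)
      also have "\<dots> = (\<integral>\<^sup>+w. ennreal (1 / t ^ d) * k w \<partial>lborel)" by (simp add: nn_integral_cmult)
      also have "\<dots> = (\<integral>\<^sup>+w. g w * G w t \<partial>lborel)"
      proof (intro nn_integral_cong)
        fix w :: 'a
        have "ennreal (norm w / t ^ (d+1)) = ennreal (1 / t ^ d) * ennreal (norm w / t)"
          using True by (subst ennreal_mult[symmetric]) auto
        then show "ennreal (1 / t ^ d) * k w = g w * G w t"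
          by (auto simp: k_def G_def indicator_def mult_ac)
      qed
      finally show ?thesis by simp
    next
      case False
      then have "G w t = 0" for w by (auto simp: G_def dest: le_less_trans[OF norm_ge_zero])
      moreover have "indicator {0<..<1} (t * norm z) = (0::ennreal)" for z :: 'a
        using False by (auto simp: indicator_def zero_less_mult_iff)
      ultimately show ?thesis by simp
    qed
  qed
  also have "\<dots> = (\<integral>\<^sup>+z. (\<integral>\<^sup>+t. g (t *\<^sub>R z) * ennreal (norm z) * indicator ?B z * indicator {0<..<1} (t * norm z) \<partial>lborel) \<partial>lborel)"
    by (rule lborel_pair.Fubini') measurable
  also have "\<dots> = (\<integral>\<^sup>+z. (\<integral>\<^sup>+r. g (r *\<^sub>R sgn z) * indicator ?B z * indicator {0<..<1} r \<partial>lborel) \<partial>lborel)"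
  proof (rule nn_integral_cong_AE)
    have "AE w in lborel. w \<noteq> (0::'a)" by (rule AE_lborel_singleton)
    then show "AE z in lborel. (\<integral>\<^sup>+t. g (t *\<^sub>R z) * ennreal (norm z) * indicator ?B z * indicator {0<..<1} (t * norm z) \<partial>lborel)
       = (\<integral>\<^sup>+r. g (r *\<^sub>R sgn z) * indicator ?B z * indicator {0<..<1} r \<partial>lborel)"
    proof eventually_elim
      case (elim z)
      have nz: "norm z \<noteq> 0" using elim by simp
      have "(\<integral>\<^sup>+r. g (r *\<^sub>R sgn z) * indicator ?B z * indicator {0<..<1} r \<partial>lborel)
         = ennreal \<bar>norm z\<bar> * (\<integral>\<^sup>+t. g ((0 + norm z * t) *\<^sub>R sgn z) * indicator ?B z * indicator {0<..<1} (0 + norm z * t) \<partial>lborel)"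
        by (rule nn_integral_real_affine) (use nz in auto)
      also have "\<dots> = (\<integral>\<^sup>+t. ennreal (norm z) * (g (t *\<^sub>R z) * indicator ?B z * indicator {0<..<1} (t * norm z)) \<partial>lborel)"
      proof -
        have "(0 + norm z * t) *\<^sub>R sgn z = t *\<^sub>R z" for t
          using nz by (simp add: sgn_div_norm divide_inverse mult_ac)
        then show ?thesis
          by (subst nn_integral_cmult[symmetric]) (auto intro!: nn_integral_cong simp: mult.commute)
      qed
      finally show ?case by (simp add: mult_ac)
    qed
  qed
  also have "\<dots> = (\<integral>\<^sup>+r. (\<integral>\<^sup>+z. g (r *\<^sub>R sgn z) * indicator ?B z * indicator {0<..<1} r \<partial>lborel) \<partial>lborel)"
    by (rule lborel_pair.Fubini') measurable
  also have "\<dots> = (\<integral>\<^sup>+r. (\<integral>\<^sup>+z. g (r *\<^sub>R sgn z) * indicator ?B z \<partial>lborel) * indicator {0<..<1} r \<partial>lborel)"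
    by (intro nn_integral_cong nn_integral_multc) measurable
  finally show ?thesis .
qed

section \<open>The measures on the sphere and on the ball\<close>

lemma unit_ball_emeasure_pos_finite:
  "emeasure lborel (ball (0::'a::euclidean_space) 1) \<noteq> 0" "emeasure lborel (ball (0::'a) 1) \<noteq> top"
  using emeasure_lborel_open_pos[of "ball (0::'a) 1"] emeasure_lborel_ball_finite[of "0::'a" 1] by auto

lemma borel_measurable_sgn_euclidean [measurable]: "(sgn :: 'a::euclidean_space \<Rightarrow> 'a) \<in> borel_measurable borel"
  unfolding sgn_div_norm by measurable

lemma sets_sphere_measure [measurable_cong]:
  "sets (sphere_measure :: (complex^'n::finite) measure) = sets (restrict_space borel (sphere 0 1))"
  and space_sphere_measure: "space (sphere_measure :: (complex^'n) measure) = sphere 0 1"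
  by (simp_all add: sphere_measure_def sets_restrict_space space_restrict_space)

text \<open>The map in the definition of \<^const>\<open>sphere_measure\<close> sends 0 outside the sphere, so it is
  not measurable into it and the facts on push-forwards do not apply directly; changing the
  map at 0 does not affect the measure.\<close>

lemma nn_integral_sphere_measure:
  fixes g :: "complex^'n::finite \<Rightarrow> ennreal"
  assumes g[measurable]: "g \<in> borel_measurable borel"
  shows "(\<integral>\<^sup>+\<zeta>. g \<zeta> \<partial>sphere_measure)
    = (\<integral>\<^sup>+z. g (sgn z) * indicator (ball 0 1) z \<partial>lborel) / emeasure lborel (ball (0::complex^'n) 1)"
proof -
  define V where "V = emeasure lborel (ball (0::complex^'n) 1)"
  define P where "P = density lborel (\<lambda>z. indicator (ball (0::complex^'n) 1) z / V)"
  define N where "N = restrict_space lborel (sphere (0::complex^'n) 1)"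
  obtain e :: "complex^'n" where "norm e = 1" using vector_choose_size[of 1] by auto
  then have e: "e \<in> sphere 0 1" by simp
  define s where "s z = (if z = 0 then e else sgn z)" for z :: "complex^'n"
  have s[measurable]: "s \<in> borel_measurable borel"
    unfolding s_def by measurable
  have sN: "s \<in> measurable P N"
    unfolding N_def P_def using e
    by (intro measurable_restrict_space2) (auto simp: s_def norm_sgn)
  have setsN: "A \<in> sets borel" if "A \<in> sets N" for A
    using that unfolding N_def by (subst (asm) sets_restrict_space_iff) auto
  have "sphere_measure = distr P N sgn" by (simp add: sphere_measure_def P_def N_def V_def)
  also have "\<dots> = distr P N s"
    unfolding distr_def
  proof (rule measure_of_eq)
    show "sets N \<subseteq> Pow (space N)" by (rule sets.space_closed)
    fix A assume "A \<in> sigma_sets (space N) (sets N)"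
    then have A[measurable]: "A \<in> sets borel" using setsN by (simp add: sets.sigma_sets_eq)
    have "AE z in P. (z \<in> sgn -` A \<inter> space P) = (z \<in> s -` A \<inter> space P)"
      unfolding P_def
    proof (subst AE_density)
      show "(\<lambda>z. indicator (ball (0::complex^'n) 1) z / V) \<in> borel_measurable lborel" by measurable
      show "AE z in lborel. 0 < indicator (ball (0::complex^'n) 1) z / V \<longrightarrow>
          (z \<in> sgn -` A \<inter> space (density lborel (\<lambda>z. indicator (ball 0 1) z / V)))
          = (z \<in> s -` A \<inter> space (density lborel (\<lambda>z. indicator (ball 0 1) z / V)))"
        using AE_lborel_singleton[of "0::complex^'n"] by eventually_elim (simp add: s_def)
    qed
    moreover have "sgn -` A \<inter> space P \<in> sets P" "s -` A \<inter> space P \<in> sets P"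
      using measurable_sets[OF borel_measurable_sgn_euclidean A] measurable_sets[OF s A] by (simp_all add: P_def)
    ultimately show "emeasure P (sgn -` A \<inter> space P) = emeasure P (s -` A \<inter> space P)"
      by (rule emeasure_eq_AE)
  qed
  finally have eq: "sphere_measure = distr P N s" .
  have "(\<integral>\<^sup>+\<zeta>. g \<zeta> \<partial>sphere_measure) = (\<integral>\<^sup>+z. g (s z) \<partial>P)"
  proof -
    have "g \<in> borel_measurable N" unfolding N_def by (rule measurable_restrict_space1) simp
    then show ?thesis by (simp add: eq nn_integral_distr[OF sN])
  qed
  also have "\<dots> = (\<integral>\<^sup>+z. indicator (ball 0 1) z / V * g (s z) \<partial>lborel)"
    unfolding P_def by (rule nn_integral_density) auto
  also have "\<dots> = (\<integral>\<^sup>+z. g (sgn z) * indicator (ball 0 1) z / V \<partial>lborel)"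
  proof (rule nn_integral_cong_AE)
    have "AE z in lborel. z \<noteq> (0::complex^'n)" by (rule AE_lborel_singleton)
    then show "AE z in lborel. indicator (ball 0 1) z / V * g (s z) = g (sgn z) * indicator (ball 0 1) z / V"
      by eventually_elim (auto simp: s_def divide_ennreal_def mult_ac)
  qed
  also have "\<dots> = (\<integral>\<^sup>+z. g (sgn z) * indicator (ball 0 1) z \<partial>lborel) / V"
    by (rule nn_integral_divide) measurable
  finally show ?thesis by (simp add: V_def)
qed

lemma emeasure_sphere_measure:
  fixes A :: "(complex^'n::finite) set"
  assumes A[measurable]: "A \<in> sets borel" and "A \<subseteq> sphere 0 1"
  shows "emeasure sphere_measure A
    = emeasure lborel (sgn -` A \<inter> ball 0 1) / emeasure lborel (ball (0::complex^'n) 1)"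
proof -
  have [measurable]: "sgn -` A \<in> sets borel"
    using measurable_sets[OF borel_measurable_sgn_euclidean A] by simp
  have "A \<in> sets sphere_measure"
    using assms by (auto simp: sets_sphere_measure sets_restrict_space_iff)
  then have "emeasure sphere_measure A = (\<integral>\<^sup>+\<zeta>. indicator A \<zeta> \<partial>sphere_measure)" by simp
  also have "\<dots> = (\<integral>\<^sup>+z. indicator A (sgn z) * indicator (ball 0 1) z \<partial>lborel) / emeasure lborel (ball (0::complex^'n) 1)"
    by (rule nn_integral_sphere_measure) simp
  also have "(\<integral>\<^sup>+z. indicator A (sgn z) * indicator (ball 0 1) z \<partial>lborel) = (\<integral>\<^sup>+z. indicator (sgn -` A \<inter> ball 0 1) z \<partial>lborel)"
    by (intro nn_integral_cong) (auto simp: indicator_def)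
  also have "\<dots> = emeasure lborel (sgn -` A \<inter> ball 0 1)" by (rule nn_integral_indicator) simp
  finally show ?thesis .
qed

lemma emeasure_space_sphere_measure:
  "emeasure sphere_measure (space (sphere_measure :: (complex^'n::finite) measure)) = 1"
proof -
  let ?V = "emeasure lborel (ball (0::complex^'n) 1)"
  have "emeasure sphere_measure (space (sphere_measure :: (complex^'n) measure))
     = (\<integral>\<^sup>+\<zeta>. 1 \<partial>(sphere_measure :: (complex^'n) measure))" by simp
  also have "\<dots> = ?V / ?V" by (subst nn_integral_sphere_measure) simp_all
  also have "\<dots> = 1" using unit_ball_emeasure_pos_finite[where 'a = "complex^'n"] by (intro ennreal_divide_self) (auto simp: less_top)
  finally show ?thesis .
qed

lemma borel_measurable_bweight [measurable]: "bweight \<alpha> \<in> borel_measurable borel"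
  unfolding bweight_def[abs_def] by measurable

text \<open>Positivity holds because the weight is positive on the ball. For finiteness, polar
  integration leaves \<open>(1 - r\<^sup>2) powr \<alpha>\<close>; in the factorization 1 - r^2 = (1
  - r) * (1 + r) the second factor lies between 1 and 2, so a Beta integral remains, which converges
  because \<alpha> > -1.\<close>

lemma bweight_mass:
  fixes \<alpha> :: real
  assumes \<alpha>: "\<alpha> > -1"
  defines "W \<equiv> (\<integral>\<^sup>+ w. ennreal (bweight \<alpha> w) * indicator (ball (0::complex^'n::finite) 1) w \<partial>lborel)"
  shows "W \<noteq> 0" "W < top"
proof -
  let ?B = "ball (0::complex^'n) 1"
  show "W \<noteq> 0"
  proof
    assume "W = 0"
    have [measurable]: "ball (0::complex^'n) 1 \<in> sets borel" by simp
    have "(\<lambda>w. ennreal (bweight \<alpha> w) * indicator ?B w) \<in> borel_measurable lborel" by measurable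
    with \<open>W = 0\<close> have "AE w in lborel. ennreal (bweight \<alpha> w) * indicator ?B w = 0"
      unfolding W_def by (subst (asm) nn_integral_0_iff_AE) (auto simp: mult_eq_0_iff)
    then have "AE w in lborel. w \<notin> ?B"
    proof eventually_elim
      case (elim w)
      show ?case
      proof
        assume w: "w \<in> ?B"
        then have "norm w ^ 2 < 1" by (simp add: power_less_one_iff)
        then show False using w elim by (auto simp: bweight_def)
      qed
    qed
    then have "emeasure lborel ?B = 0"
      by (subst (asm) AE_iff_measurable[of ?B]) auto
    then show False using unit_ball_emeasure_pos_finite by blast
  qed
  let ?d = "DIM(complex^'n)"
  have "W \<le> 2 ^ (?d + 1) * (\<integral>\<^sup>+r. (\<integral>\<^sup>+z. ennreal (bweight \<alpha> (r *\<^sub>R sgn z)) * indicator ?B z \<partial>lborel) * indicator {0<..<1} r \<partial>lborel)"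
    unfolding W_def by (rule polar_inequality) measurable
  also have "(\<integral>\<^sup>+r. (\<integral>\<^sup>+z. ennreal (bweight \<alpha> (r *\<^sub>R sgn z)) * indicator ?B z \<partial>lborel) * indicator {0<..<1} r \<partial>lborel)
      \<le> (\<integral>\<^sup>+r. (ennreal (2 powr \<bar>\<alpha>\<bar>) * emeasure lborel ?B) * (ennreal ((1 - r) powr \<alpha>) * indicator {0..1} r) \<partial>lborel)"
  proof (rule nn_integral_mono)
    fix r :: real
    show "(\<integral>\<^sup>+z. ennreal (bweight \<alpha> (r *\<^sub>R sgn z)) * indicator ?B z \<partial>lborel) * indicator {0<..<1} r
       \<le> (ennreal (2 powr \<bar>\<alpha>\<bar>) * emeasure lborel ?B) * (ennreal ((1 - r) powr \<alpha>) * indicator {0..1} r)"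
    proof (cases "r \<in> {0<..<1}")
      case r: True
      have "(1 - r^2) powr \<alpha> = (1 - r) powr \<alpha> * (1 + r) powr \<alpha>"
        using r by (subst powr_mult[symmetric]) (auto simp: power2_eq_square algebra_simps)
      also have "\<dots> \<le> (1 - r) powr \<alpha> * 2 powr \<bar>\<alpha>\<bar>"
      proof (rule mult_left_mono)
        have "(1 + r) powr \<alpha> \<le> (1 + r) powr \<bar>\<alpha>\<bar>" using r by (intro powr_mono) auto
        also have "\<dots> \<le> 2 powr \<bar>\<alpha>\<bar>" using r by (intro powr_mono2) auto
        finally show "(1 + r) powr \<alpha> \<le> 2 powr \<bar>\<alpha>\<bar>" .
      qed simp
      finally have le: "(1 - r^2) powr \<alpha> \<le> 2 powr \<bar>\<alpha>\<bar> * (1 - r) powr \<alpha>" by (simp add: mult.commute)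
      have "(\<integral>\<^sup>+z. ennreal (bweight \<alpha> (r *\<^sub>R sgn z)) * indicator ?B z \<partial>lborel)
          \<le> (\<integral>\<^sup>+z. ennreal (2 powr \<bar>\<alpha>\<bar> * (1 - r) powr \<alpha>) * indicator ?B z \<partial>lborel)"
      proof (rule nn_integral_mono_AE)
        have "AE z in lborel. z \<noteq> (0::complex^'n)" by (rule AE_lborel_singleton)
        then show "AE z in lborel. ennreal (bweight \<alpha> (r *\<^sub>R sgn z)) * indicator ?B z
            \<le> ennreal (2 powr \<bar>\<alpha>\<bar> * (1 - r) powr \<alpha>) * indicator ?B z"
          by eventually_elim
            (use r le in \<open>auto simp: bweight_def norm_sgn power_mult_distrib intro!: mult_right_mono ennreal_leI\<close>)
      qed
      also have "\<dots> = ennreal (2 powr \<bar>\<alpha>\<bar> * (1 - r) powr \<alpha>) * emeasure lborel ?B"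
        by (rule nn_integral_cmult_indicator) simp
      also have "\<dots> = ennreal (2 powr \<bar>\<alpha>\<bar>) * emeasure lborel ?B * ennreal ((1 - r) powr \<alpha>)"
        by (simp add: ennreal_mult mult_ac)
      finally show ?thesis using r by simp
    qed simp
  qed
  also have "\<dots> = (ennreal (2 powr \<bar>\<alpha>\<bar>) * emeasure lborel ?B) * (\<integral>\<^sup>+r. ennreal ((1 - r) powr \<alpha>) * indicator {0..1} r \<partial>lborel)"
    by (rule nn_integral_cmult) measurable
  finally have 1: "W \<le> 2 ^ (?d + 1) * \<dots>" by (simp add: mult_left_mono)
  \<comment> \<open>The Beta integrand with parameters 1 and \<alpha> + 1.\<close>
  have "set_integrable lborel {0..1} (\<lambda>t. t powr (1 - 1) * (1 - t) powr (\<alpha> + 1 - 1))"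
    by (rule integrable_Beta) (use \<alpha> in auto)
  then have "(\<integral>\<^sup>+r. norm (indicator {0..1} r *\<^sub>R (r powr (1 - 1) * (1 - r) powr (\<alpha> + 1 - 1))) \<partial>lborel) < \<infinity>"
    unfolding set_integrable_def by (simp add: integrable_iff_bounded)
  also have "(\<integral>\<^sup>+r. norm (indicator {0..1} r *\<^sub>R (r powr (1 - 1) * (1 - r) powr (\<alpha> + 1 - 1))) \<partial>lborel)
      = (\<integral>\<^sup>+r. ennreal ((1 - r) powr \<alpha>) * indicator {0..1} r \<partial>lborel)"
  proof (rule nn_integral_cong_AE)
    \<comment> \<open>Since \<open>0 powr 0 = 0\<close>, the trivial Beta factor
      \<open>r powr (1 - 1)\<close> is 1 only away from 0.\<close>
    have "AE r in lborel. r \<noteq> (0::real)" by (rule AE_lborel_singleton)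
    then show "AE r in lborel. ennreal (norm (indicator {0..1} r *\<^sub>R (r powr (1 - 1) * (1 - r) powr (\<alpha> + 1 - 1))))
       = ennreal ((1 - r) powr \<alpha>) * indicator {0..1} r"
      by eventually_elim (auto simp: indicator_def)
  qed
  finally have "2 ^ (?d + 1) * ((ennreal (2 powr \<bar>\<alpha>\<bar>) * emeasure lborel ?B) * (\<integral>\<^sup>+r. ennreal ((1 - r) powr \<alpha>) * indicator {0..1} r \<partial>lborel)) < top"
    using unit_ball_emeasure_pos_finite[where 'a = "complex^'n"]
    by (auto simp: ennreal_mult_less_top less_top power_less_top_ennreal)
  with 1 show "W < top" by (rule le_less_trans)
qed

lemma sets_bergman_measure [measurable_cong]:
  "sets (bergman_measure \<alpha> :: (complex^'n::finite) measure) = sets (restrict_space borel (ball 0 1))"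
  and space_bergman_measure: "space (bergman_measure \<alpha> :: (complex^'n) measure) = ball 0 1"
  by (simp_all add: bergman_measure_def sets_restrict_space space_restrict_space)

lemma nn_integral_bergman_measure:
  fixes g :: "complex^'n::finite \<Rightarrow> ennreal"
  assumes g[measurable]: "g \<in> borel_measurable borel"
  shows "(\<integral>\<^sup>+z. g z \<partial>bergman_measure \<alpha>)
    = (\<integral>\<^sup>+z. ennreal (bweight \<alpha> z) * g z * indicator (ball 0 1) z \<partial>lborel) /
      (\<integral>\<^sup>+ w. ennreal (bweight \<alpha> w) * indicator (ball (0::complex^'n) 1) w \<partial>lborel)"
proof -
  let ?B = "ball (0::complex^'n) 1"
  let ?W = "\<integral>\<^sup>+ w. ennreal (bweight \<alpha> w) \<partial>(restrict_space lborel ?B)"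
  have W: "?W = (\<integral>\<^sup>+ w. ennreal (bweight \<alpha> w) * indicator ?B w \<partial>lborel)"
    by (simp add: nn_integral_restrict_space)
  have [measurable]: "g \<in> borel_measurable (restrict_space lborel ?B)"
    "bweight \<alpha> \<in> borel_measurable (restrict_space lborel ?B)"
    by (auto intro!: measurable_restrict_space1)
  have "(\<integral>\<^sup>+z. g z \<partial>bergman_measure \<alpha>) = (\<integral>\<^sup>+z. ennreal (bweight \<alpha> z) / ?W * g z \<partial>(restrict_space lborel ?B))"
    unfolding bergman_measure_def by (rule nn_integral_density) measurable
  also have "\<dots> = (\<integral>\<^sup>+z. ennreal (bweight \<alpha> z) * g z / ?W \<partial>(restrict_space lborel ?B))"
    by (simp add: divide_ennreal_def mult_ac)
  also have "\<dots> = (\<integral>\<^sup>+z. ennreal (bweight \<alpha> z) * g z \<partial>(restrict_space lborel ?B)) / ?W"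
    by (rule nn_integral_divide) measurable
  also have "(\<integral>\<^sup>+z. ennreal (bweight \<alpha> z) * g z \<partial>(restrict_space lborel ?B)) = (\<integral>\<^sup>+z. ennreal (bweight \<alpha> z) * g z * indicator ?B z \<partial>lborel)"
    by (simp add: nn_integral_restrict_space)
  finally show ?thesis unfolding W .
qed

lemma emeasure_space_bergman_measure:
  assumes "\<alpha> > -1"
  shows "emeasure (bergman_measure \<alpha>) (space (bergman_measure \<alpha> :: (complex^'n::finite) measure)) = 1"
proof -
  let ?W = "\<integral>\<^sup>+ w. ennreal (bweight \<alpha> w) * indicator (ball (0::complex^'n) 1) w \<partial>lborel"
  have "emeasure (bergman_measure \<alpha>) (space (bergman_measure \<alpha> :: (complex^'n) measure))
     = (\<integral>\<^sup>+\<zeta>. 1 \<partial>(bergman_measure \<alpha> :: (complex^'n) measure))" by simp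
  also have "\<dots> = ?W / ?W" by (subst nn_integral_bergman_measure) simp_all
  also have "\<dots> = 1" using bweight_mass[OF assms, where 'n = 'n] by (intro ennreal_divide_self) auto
  finally show ?thesis .
qed

section \<open>Holomorphic functions of several variables\<close>

lemma norm_vector_scalar_mult: "norm (c *s v) = norm c * norm (v :: complex^'n::finite)"
  by (simp add: norm_vec_def L2_set_def norm_mult power_mult_distrib real_sqrt_mult flip: sum_distrib_left)

lemma linear_vector_scalar_mult_left: "linear (\<lambda>c::complex. c *s (v :: complex^'n::finite))"
  by (rule linearI) (simp_all add: vec_eq_iff algebra_simps)

lemma linear_vector_scalar_mult_right: "linear (\<lambda>v :: complex^'n::finite. (c::complex) *s v)"
  by (rule linearI) (simp_all add: vec_eq_iff algebra_simps)

lemma holo_onI: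
  assumes "\<And>z. z \<in> S \<Longrightarrow> (f has_derivative L z) (at z)" "\<And>z c v. z \<in> S \<Longrightarrow> L z (c *s v) = c * L z v"
  shows "holo_on f S"
  unfolding holo_on_def using assms by blast

text \<open>Replaces the existential derivative of \<open>holo_on\<close> by a canonical one;
  uniqueness of the derivative transfers complex homogeneity to it.\<close>

lemma holo_on_frechet:
  assumes "holo_on f S" "z \<in> S"
  shows "(f has_derivative frechet_derivative f (at z)) (at z)"
    "frechet_derivative f (at z) (c *s v) = c * frechet_derivative f (at z) v"
  using assms frechet_derivative_at[of f _ z] unfolding holo_on_def by metis+

lemma holo_on_imp_continuous_on: "holo_on f S \<Longrightarrow> continuous_on S f"
  unfolding holo_on_def by (intro continuous_at_imp_continuous_on) (blast intro: has_derivative_continuous)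

lemma holo_on_diff: "holo_on f S \<Longrightarrow> holo_on g S \<Longrightarrow> holo_on (\<lambda>z. f z - g z) S"
  by (rule holo_onI[where L = "\<lambda>z v. frechet_derivative f (at z) v - frechet_derivative g (at z) v"])
    (auto intro!: has_derivative_diff simp: holo_on_frechet right_diff_distrib)

text \<open>The map \<phi> is holomorphic by coordinates, so its total derivative \<open>D\<close>
  is assembled from theirs. It is complex homogeneous because each coordinate is, and the chain rule
  then keeps this property.\<close>

lemma holo_on_compose:
  fixes \<phi> :: "complex^'m::finite \<Rightarrow> complex^'n::finite"
  assumes f: "holo_on f T" and \<phi>: "\<And>i. holo_on (\<lambda>z. \<phi> z $ i) S" and "\<phi> ` S \<subseteq> T"
  shows "holo_on (f \<circ> \<phi>) S"
proof (rule holo_onI)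
  define D where "D z h = (\<chi> i. frechet_derivative (\<lambda>z. \<phi> z $ i) (at z) h)" for z h
  fix z assume z: "z \<in> S"
  have "((\<lambda>x. \<phi> x \<bullet> b) has_derivative (\<lambda>h. D z h \<bullet> b)) (at z)" if "b \<in> Basis" for b
  proof -
    from that obtain i u where b: "b = axis i u" "u \<in> Basis" by (auto simp: Basis_vec_def)
    show ?thesis
      using has_derivative_inner_left[OF holo_on_frechet(1)[OF \<phi> z], of i u] by (simp add: b D_def inner_axis)
  qed
  then have "(\<phi> has_derivative D z) (at z)"
    by (subst has_derivative_componentwise_within) auto
  then show "(f \<circ> \<phi> has_derivative frechet_derivative f (at (\<phi> z)) \<circ> D z) (at z)"
    using assms z by (intro diff_chain_at holo_on_frechet(1)[OF f]) auto
  fix c v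
  have "D z (c *s v) = c *s D z v"
    by (simp add: D_def vec_eq_iff holo_on_frechet(2)[OF \<phi> z])
  then show "(frechet_derivative f (at (\<phi> z)) \<circ> D z) (c *s v) = c * (frechet_derivative f (at (\<phi> z)) \<circ> D z) v"
    using assms z holo_on_frechet(2)[OF f, of "\<phi> z"] by auto
qed

text \<open>The bridge to one complex variable: complex homogeneity turns the real derivative along
  the complex line through \<open>a\<close> in direction \<open>v\<close> into multiplication by a
  complex number.\<close>

lemma holo_on_slice:
  fixes f :: "complex^'n::finite \<Rightarrow> complex"
  assumes "holo_on f S" "a + t *s v \<in> S"
  shows "((\<lambda>t. f (a + t *s v)) has_field_derivative frechet_derivative f (at (a + t *s v)) v) (at t)"
proof -
  have "((\<lambda>t. t *s v) has_derivative (\<lambda>t. t *s v)) (at t)"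
    by (intro bounded_linear_imp_has_derivative linear_linear[THEN iffD2] linear_vector_scalar_mult_left)
  then have "((\<lambda>t. a + t *s v) has_derivative (\<lambda>t. t *s v)) (at t)"
    by (auto intro: derivative_eq_intros)
  then have "(f \<circ> (\<lambda>t. a + t *s v) has_derivative frechet_derivative f (at (a + t *s v)) \<circ> (\<lambda>t. t *s v)) (at t)"
    by (rule diff_chain_at) (rule holo_on_frechet(1)[OF assms])
  moreover have "frechet_derivative f (at (a + t *s v)) \<circ> (\<lambda>t. t *s v) = (*) (frechet_derivative f (at (a + t *s v)) v)"
    by (auto simp: holo_on_frechet(2)[OF assms] mult.commute)
  ultimately show ?thesis by (simp add: has_field_derivative_def o_def)
qed

text \<open>Cauchy's inequality for the slice in direction \<open>v\<close>, which stays in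
  \<open>cball z \<delta>\<close> as long as the parameter has modulus at most
  \<open>\<delta> / norm v\<close>; this radius produces the factor \<open>norm v\<close>.\<close>

lemma holo_on_derivative_bound:
  fixes f :: "complex^'n::finite \<Rightarrow> complex"
  assumes f: "holo_on f S" and sub: "cball z \<delta> \<subseteq> S" and \<delta>: "\<delta> > 0"
    and M: "\<And>w. w \<in> cball z \<delta> \<Longrightarrow> norm (f w) \<le> M"
  shows "norm (frechet_derivative f (at z) v) \<le> M / \<delta> * norm v"
proof (cases "v = 0")
  case True
  have z: "z \<in> S" using sub \<delta> by auto
  show ?thesis
    using has_derivative_linear[OF holo_on_frechet(1)[OF f z]] True by (simp add: linear_0)
next
  case False
  define r where "r = \<delta> / norm v"
  have r: "r > 0" using \<delta> False by (simp add: r_def)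
  define g where "g t = f (z + t *s v)" for t
  have in_ball: "z + t *s v \<in> cball z \<delta>" if "norm t \<le> r" for t
    using that False by (simp add: dist_norm norm_vector_scalar_mult r_def field_simps)
  have der: "(g has_field_derivative frechet_derivative f (at (z + t *s v)) v) (at t)" if "norm t \<le> r" for t
    unfolding g_def by (rule holo_on_slice[OF f]) (use in_ball[OF that] sub in auto)
  have hol: "g holomorphic_on cball 0 r"
    unfolding holomorphic_on_def field_differentiable_def
  proof
    fix t :: complex assume "t \<in> cball 0 r"
    then have "(g has_field_derivative frechet_derivative f (at (z + t *s v)) v) (at t)"
      by (intro der) simp
    then show "\<exists>d. (g has_field_derivative d) (at t within cball 0 r)"
      using has_field_derivative_at_within by blast
  qed
  have "norm ((deriv ^^ 1) g 0) \<le> fact 1 * M / r ^ 1"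
  proof (rule Cauchy_inequality)
    show "g holomorphic_on ball 0 r" using hol holomorphic_on_subset ball_subset_cball by blast
    show "continuous_on (cball 0 r) g" using hol by (rule holomorphic_on_imp_continuous_on)
  qed (use r M in_ball in \<open>auto simp: g_def\<close>)
  moreover have "deriv g 0 = frechet_derivative f (at z) v"
    using DERIV_imp_deriv[OF der[of 0]] r by simp
  ultimately show ?thesis using False by (simp add: r_def)
qed

text \<open>Weierstrass' theorem: the Cauchy estimate for differences \<open>F m - F n\<close> makes
  the derivatives uniformly Cauchy near each point, so the limit is differentiable, and homogeneity
  passes to the limit of the derivatives.\<close>

lemma holo_on_uniform_limit:
  fixes F :: "nat \<Rightarrow> complex^'n::finite \<Rightarrow> complex"
  assumes F: "\<And>n. holo_on (F n) S" and S: "open S" and lim: "uniform_limit S F g sequentially"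
  shows "holo_on g S"
  unfolding holo_on_def
proof
  fix z assume "z \<in> S"
  then obtain \<delta>' where \<delta>': "\<delta>' > 0" "cball z \<delta>' \<subseteq> S" using S open_contains_cball by blast
  \<comment> \<open>Half the radius, so that a closed ball of radius \<delta> around every point of
    \<open>ball z \<delta>\<close> still lies in S and the Cauchy estimate applies uniformly
    there.\<close>
  define \<delta> where "\<delta> = \<delta>' / 2"
  have \<delta>: "\<delta> > 0" "\<And>x. x \<in> ball z \<delta> \<Longrightarrow> cball x \<delta> \<subseteq> S"
  proof -
    show "\<delta> > 0" using \<delta>' by (simp add: \<delta>_def)
    fix x assume "x \<in> ball z \<delta>"
    then have "cball x \<delta> \<subseteq> cball z \<delta>'"
      by (auto simp: \<delta>_def) (smt (verit) dist_triangle field_sum_of_halves)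
    with \<delta>' show "cball x \<delta> \<subseteq> S" by blast
  qed
  have bS: "ball z \<delta> \<subseteq> S" using \<delta> by (metis centre_in_cball less_imp_le subset_iff)
  define L where "L n x = frechet_derivative (F n) (at x)" for n x
  have close: "\<exists>N. \<forall>m\<ge>N. \<forall>n\<ge>N. \<forall>x\<in>ball z \<delta>. \<forall>h. norm (L m x h - L n x h) \<le> e * norm h" if "e > 0" for e
  proof -
    have "0 < e * \<delta>" using that \<delta> by simp
    then obtain N where N': "\<And>n x. n \<ge> N \<Longrightarrow> x \<in> S \<Longrightarrow> dist (F n x) (g x) < e * \<delta> / 2"
      using uniform_limitD[OF lim, of "e * \<delta> / 2"] by (auto simp: eventually_sequentially)
    have N: "dist (F m x) (F n x) < e * \<delta>" if "m \<ge> N" "n \<ge> N" "x \<in> S" for m n x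
      using N'[OF that(1,3)] N'[OF that(2,3)] by (rule dist_triangle_half_l)
    show ?thesis
    proof (intro exI allI impI ballI)
      fix m n x h assume mn: "N \<le> m" "N \<le> n" and x: "x \<in> ball z \<delta>"
      have xS: "x \<in> S" using x bS by blast
      have "((\<lambda>y. F m y - F n y) has_derivative (\<lambda>h. L m x h - L n x h)) (at x)"
        unfolding L_def by (intro has_derivative_diff holo_on_frechet(1)[OF F xS])
      then have "L m x h - L n x h = frechet_derivative (\<lambda>y. F m y - F n y) (at x) h"
        by (simp add: frechet_derivative_at[symmetric])
      also have "norm \<dots> \<le> e * \<delta> / \<delta> * norm h"
        using mn \<delta>(1) \<delta>(2)[OF x]
        by (intro holo_on_derivative_bound[OF holo_on_diff[OF F F]]) (auto simp flip: dist_norm intro!: less_imp_le N)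
      finally show "norm (L m x h - L n x h) \<le> e * norm h" using \<delta> by simp
    qed
  qed
  have Lconv: "convergent (\<lambda>n. L n x h)" if x: "x \<in> ball z \<delta>" for x h
  proof (rule Cauchy_convergent, rule CauchyI)
    fix e :: real assume "e > 0"
    then have "e / (norm h + 1) > 0" by (simp add: add_nonneg_pos)
    from close[OF this] x obtain N where
      N: "\<And>m n. m \<ge> N \<Longrightarrow> n \<ge> N \<Longrightarrow> norm (L m x h - L n x h) \<le> e / (norm h + 1) * norm h" by blast
    have "e / (norm h + 1) * norm h < e"
      using \<open>e > 0\<close> by (simp add: divide_simps add_nonneg_pos add_pos_nonneg) 
    with N show "\<exists>M. \<forall>m\<ge>M. \<forall>n\<ge>M. norm (L m x h - L n x h) < e"
      by (meson le_less_trans)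
  qed
  define g' where "g' x h = lim (\<lambda>n. L n x h)" for x h
  have g': "(\<lambda>n. L n x h) \<longlonglongrightarrow> g' x h" if "x \<in> ball z \<delta>" for x h
    unfolding g'_def using Lconv[OF that] by (rule convergent_LIMSEQ_iff[THEN iffD1])
  have "\<exists>\<gamma>. \<forall>x\<in>ball z \<delta>. (\<lambda>n. F n x) \<longlonglongrightarrow> \<gamma> x \<and> (\<gamma> has_derivative g' x) (at x within ball z \<delta>)"
  proof (rule has_derivative_sequence[where f' = L])
    show "convex (ball z \<delta>)" by simp
    show "(F n has_derivative L n x) (at x within ball z \<delta>)" if "x \<in> ball z \<delta>" for n x
      unfolding L_def using that bS by (intro has_derivative_at_withinI[OF holo_on_frechet(1)[OF F]]) auto
    show "z \<in> ball z \<delta>" using \<delta> by simp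
    show "(\<lambda>n. F n z) \<longlonglongrightarrow> g z" using lim \<open>z \<in> S\<close> by (rule tendsto_uniform_limitI)
    fix e :: real assume "e > 0"
    from close[OF this] obtain N where
      N: "\<And>m n x h. m \<ge> N \<Longrightarrow> n \<ge> N \<Longrightarrow> x \<in> ball z \<delta> \<Longrightarrow> norm (L m x h - L n x h) \<le> e * norm h" by blast
    have "norm (L n x h - g' x h) \<le> e * norm h" if "n \<ge> N" "x \<in> ball z \<delta>" for n x h
    proof (rule Lim_bounded)
      show "(\<lambda>m. norm (L n x h - L m x h)) \<longlonglongrightarrow> norm (L n x h - g' x h)"
        by (intro tendsto_intros g' that)
      show "\<forall>m\<ge>N. norm (L n x h - L m x h) \<le> e * norm h" using N that by blast
    qed
    then show "\<forall>\<^sub>F n in sequentially. \<forall>x\<in>ball z \<delta>. \<forall>h. norm (L n x h - g' x h) \<le> e * norm h"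
      unfolding eventually_sequentially by blast
  qed
  then obtain \<gamma> where \<gamma>: "\<And>x. x \<in> ball z \<delta> \<Longrightarrow> (\<lambda>n. F n x) \<longlonglongrightarrow> \<gamma> x"
    "\<And>x. x \<in> ball z \<delta> \<Longrightarrow> (\<gamma> has_derivative g' x) (at x within ball z \<delta>)" by blast
  have zb: "z \<in> ball z \<delta>" using \<delta> by simp
  have "\<gamma> x = g x" if "x \<in> ball z \<delta>" for x
    using LIMSEQ_unique[OF \<gamma>(1)[OF that] tendsto_uniform_limitI[OF lim]] that bS by blast
  moreover have "(\<gamma> has_derivative g' z) (at z)"
    using \<gamma>(2)[OF zb] by (simp add: at_within_open[OF zb open_ball])
  ultimately have "(g has_derivative g' z) (at z)"
    using has_derivative_transform_within_open[OF _ open_ball zb] by blast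
  moreover have "g' z (c *s v) = c * g' z v" for c v
  proof (rule LIMSEQ_unique)
    show "(\<lambda>n. L n z (c *s v)) \<longlonglongrightarrow> g' z (c *s v)" by (rule g'[OF zb])
    show "(\<lambda>n. L n z (c *s v)) \<longlonglongrightarrow> c * g' z v"
      unfolding L_def holo_on_frechet(2)[OF F \<open>z \<in> S\<close>] by (intro tendsto_intros g'[OF zb, unfolded L_def])
  qed
  ultimately show "\<exists>L. (g has_derivative L) (at z) \<and> (\<forall>c v. L (c *s v) = c * L v)" by blast
qed

section \<open>Mean value inequalities and Montel's theorem\<close>

lemma holomorphic_mean_value_inequality:
  fixes g :: "complex \<Rightarrow> complex"
  assumes g: "g holomorphic_on cball 0 1"
  shows "ennreal (norm (g 0)) \<le> (\<integral>\<^sup>+\<theta>. ennreal (norm (g (exp (2 * of_real pi * \<i> * of_real \<theta>)))) * indicator {0..1} \<theta> \<partial>lborel)"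
proof -
  define e where "e \<theta> = exp (2 * of_real pi * \<i> * of_real \<theta>)" for \<theta> :: real
  have e: "norm (e \<theta>) = 1" for \<theta> by (simp add: e_def)
  have e0: "e \<theta> \<noteq> 0" for \<theta> by (simp add: e_def)
  have "((\<lambda>u. g u / (u - 0)) has_contour_integral (2 * of_real pi * \<i> * g 0)) (circlepath 0 1)"
    by (rule Cauchy_integral_circlepath_simple) (use g in auto)
  then have "((\<lambda>\<theta>. g (e \<theta>) / e \<theta> * (2 * pi * \<i> * e \<theta>)) has_integral (2 * of_real pi * \<i> * g 0)) {0..1}"
    unfolding has_contour_integral_def
    by (subst (asm) has_integral_cong[where g = "\<lambda>\<theta>. g (e \<theta>) / e \<theta> * (2 * pi * \<i> * e \<theta>)"])
      (simp add: vector_derivative_circlepath01, simp add: circlepath e_def)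
  then have "((\<lambda>\<theta>. (1 / (2 * of_real pi * \<i>)) * (g (e \<theta>) / e \<theta> * (2 * pi * \<i> * e \<theta>))) has_integral (1 / (2 * of_real pi * \<i>)) * (2 * of_real pi * \<i> * g 0)) {0..1}"
    by (rule has_integral_mult_right)
  \<comment> \<open>At the centre of the circle the Cauchy kernel cancels against the derivative of
    the path, which leaves the plain average of \<open>g\<close>.\<close>
  then have int: "((\<lambda>\<theta>. g (e \<theta>)) has_integral g 0) {0..1}"
    by (simp add: e0)
  have "continuous_on {0..1} (\<lambda>\<theta>. norm (g (e \<theta>)))"
  proof (intro continuous_on_norm continuous_on_compose2[OF holomorphic_on_imp_continuous_on[OF g]])
    show "continuous_on {0..1} e" unfolding e_def by (intro continuous_intros)
  qed (auto simp: e)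
  then have nint: "(\<lambda>\<theta>. norm (g (e \<theta>))) integrable_on {0..1}" by (rule integrable_continuous_real)
  have "norm (g 0) \<le> integral {0..1} (\<lambda>\<theta>. norm (g (e \<theta>)))"
    using integral_norm_bound_integral[OF _ nint, of "\<lambda>\<theta>. g (e \<theta>)"] int
    by (metis has_integral_integrable integral_unique order_refl)
  then have "ennreal (norm (g 0)) \<le> ennreal (integral {0..1} (\<lambda>\<theta>. norm (g (e \<theta>))))" by (rule ennreal_leI)
  also have "\<dots> = (\<integral>\<^sup>+\<theta>. ennreal (indicator {0..1} \<theta> * norm (g (e \<theta>))) \<partial>lborel)"
    by (rule nn_integral_has_integral_lebesgue[symmetric]) (use nint in \<open>auto simp: integrable_integral\<close>)
  also have "\<dots> = (\<integral>\<^sup>+\<theta>. ennreal (norm (g (e \<theta>))) * indicator {0..1} \<theta> \<partial>lborel)"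
    by (intro nn_integral_cong) (auto simp: indicator_def)
  finally show ?thesis by (simp add: e_def)
qed

lemma borel_measurable_vector_scalar_mult [measurable (raw)]:
  fixes h :: "'a \<Rightarrow> complex^'n::finite"
  assumes "g \<in> borel_measurable M" "h \<in> borel_measurable M"
  shows "(\<lambda>x. g x *s h x) \<in> borel_measurable M"
proof (rule borel_measurable_continuous_Pair[OF assms])
  show "continuous_on UNIV (\<lambda>p :: complex \<times> (complex^'n). fst p *s snd p)"
    unfolding vector_scalar_mult_def by (intro continuous_intros)
qed

text \<open>Apply the one-variable inequality on the circle of all
  \<open>z + e \<theta> *s u\<close> for each \<open>u\<close> in the ball, integrate over
  \<open>u\<close> and exchange the integrals. Multiplication by \<open>e \<theta>\<close> is an
  isometry, so the inner integral does not depend on \<theta>.\<close>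

lemma holo_on_mean_value_inequality:
  fixes f :: "complex^'n::finite \<Rightarrow> complex"
  assumes f: "holo_on f S" and S: "open S" "cball z \<rho> \<subseteq> S"
  shows "ennreal (norm (f z)) * emeasure lborel (ball (0::complex^'n) \<rho>)
    \<le> (\<integral>\<^sup>+w. ennreal (norm (f w)) * indicator (ball z \<rho>) w \<partial>lborel)"
proof -
  \<comment> \<open>Nothing is known about \<open>f\<close> outside S; extension by zero gives a
    Borel function on the whole space.\<close>
  define F where "F w = ennreal (indicator S w *\<^sub>R norm (f w))" for w
  have F[measurable]: "F \<in> borel_measurable borel"
    unfolding F_def using S holo_on_imp_continuous_on[OF f]
    by (intro measurable_compose[OF _ measurable_ennreal] borel_measurable_continuous_on_indicator continuous_on_norm) auto
  define e where "e \<theta> = exp (2 * of_real pi * \<i> * of_real \<theta>)" for \<theta> :: real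
  have e: "norm (e \<theta>) = 1" for \<theta> by (simp add: e_def)
  let ?B = "ball (0::complex^'n) \<rho>"
  define k where "k u = F (z + u) * indicator ?B u" for u
  have k[measurable]: "k \<in> borel_measurable borel" unfolding k_def by measurable
  have [measurable]: "e \<in> borel_measurable borel"
    unfolding e_def by (intro borel_measurable_continuous_onI continuous_intros)
  have orth: "orthogonal_transformation (\<lambda>u :: complex^'n. e \<theta> *s u)" for \<theta>
    by (simp add: orthogonal_transformation linear_vector_scalar_mult_right norm_vector_scalar_mult e)
  have "ennreal (norm (f z)) * emeasure lborel ?B = (\<integral>\<^sup>+u. ennreal (norm (f z)) * indicator ?B u \<partial>lborel)"
    by (simp add: nn_integral_cmult_indicator)
  also have "\<dots> \<le> (\<integral>\<^sup>+u. (\<integral>\<^sup>+\<theta>. k (e \<theta> *s u) * indicator {0..1} \<theta> \<partial>lborel) \<partial>lborel)"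
  proof (rule nn_integral_mono)
    fix u :: "complex^'n"
    show "ennreal (norm (f z)) * indicator ?B u \<le> (\<integral>\<^sup>+\<theta>. k (e \<theta> *s u) * indicator {0..1} \<theta> \<partial>lborel)"
    proof (cases "u \<in> ?B")
      case True
      define g where "g t = f (z + t *s u)" for t
      have inS: "z + t *s u \<in> S" if "norm t \<le> 1" for t
      proof -
        have "norm t * norm u \<le> 1 * norm u" using that by (intro mult_right_mono) auto
        then have "z + t *s u \<in> cball z \<rho>"
          using True by (simp add: dist_norm norm_vector_scalar_mult)
        with S show ?thesis by blast
      qed
      have "g holomorphic_on cball 0 1"
        unfolding holomorphic_on_def field_differentiable_def
      proof
        fix t :: complex assume "t \<in> cball 0 1"
        then have "(g has_field_derivative frechet_derivative f (at (z + t *s u)) u) (at t)"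
          unfolding g_def by (intro holo_on_slice[OF f] inS) simp
        then show "\<exists>d. (g has_field_derivative d) (at t within cball 0 1)"
          using has_field_derivative_at_within by blast
      qed
      then have "ennreal (norm (g 0)) \<le> (\<integral>\<^sup>+\<theta>. ennreal (norm (g (e \<theta>))) * indicator {0..1} \<theta> \<partial>lborel)"
        unfolding e_def by (rule holomorphic_mean_value_inequality)
      also have "\<dots> = (\<integral>\<^sup>+\<theta>. k (e \<theta> *s u) * indicator {0..1} \<theta> \<partial>lborel)"
        using inS True by (intro nn_integral_cong) (auto simp: k_def F_def g_def norm_vector_scalar_mult e)
      finally show ?thesis using True by (simp add: g_def)
    qed simp
  qed
  also have "\<dots> = (\<integral>\<^sup>+\<theta>. (\<integral>\<^sup>+u. k (e \<theta> *s u) * indicator {0..1} \<theta> \<partial>lborel) \<partial>lborel)"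
    by (rule lborel_pair.Fubini') measurable
  also have "\<dots> = (\<integral>\<^sup>+\<theta>. (\<integral>\<^sup>+u. k u \<partial>lborel) * indicator {0..1::real} \<theta> \<partial>lborel)"
  proof (rule nn_integral_cong)
    fix \<theta> :: real
    have "(\<integral>\<^sup>+u. k (e \<theta> *s u) * indicator {0..1} \<theta> \<partial>lborel) = (\<integral>\<^sup>+u. k (e \<theta> *s u) \<partial>lborel) * indicator {0..1} \<theta>"
      by (rule nn_integral_multc) measurable
    also have "(\<integral>\<^sup>+u. k (e \<theta> *s u) \<partial>lborel) = (\<integral>\<^sup>+u. k u \<partial>distr lborel borel (\<lambda>u. e \<theta> *s u))"
      by (subst nn_integral_distr) auto
    also have "\<dots> = (\<integral>\<^sup>+u. k u \<partial>lborel)" by (simp add: distr_lborel_isometry[OF orth])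
    finally show "(\<integral>\<^sup>+u. k (e \<theta> *s u) * indicator {0..1} \<theta> \<partial>lborel) = (\<integral>\<^sup>+u. k u \<partial>lborel) * indicator {0..1} \<theta>" .
  qed
  also have "\<dots> = (\<integral>\<^sup>+u. k u \<partial>lborel)"
    by (simp add: nn_integral_cmult_indicator)
  also have "\<dots> = (\<integral>\<^sup>+w. k (w - z) \<partial>distr lborel borel ((+) z))"
    by (subst nn_integral_distr) auto
  also have "\<dots> = (\<integral>\<^sup>+w. k (w - z) \<partial>lborel)" by (simp add: lborel_distr_plus)
  also have "\<dots> = (\<integral>\<^sup>+w. ennreal (norm (f w)) * indicator (ball z \<rho>) w \<partial>lborel)"
  proof (rule nn_integral_cong)
    fix w
    show "k (w - z) = ennreal (norm (f w)) * indicator (ball z \<rho>) w"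
    proof (cases "w \<in> ball z \<rho>")
      case True
      with S have "w \<in> S" by auto
      with True show ?thesis by (simp add: k_def F_def dist_norm norm_minus_commute)
    qed (simp add: k_def dist_norm norm_minus_commute)
  qed
  finally show ?thesis .
qed

text \<open>The Cauchy estimate turns the uniform bound on a slightly larger ball into a common
  Lipschitz constant, and Arzela-Ascoli applies. Convergence is wanted on a single closed ball, so
  one extraction is enough and no diagonal sequence appears.\<close>

lemma holo_on_Montel:
  fixes F :: "nat \<Rightarrow> complex^'n::finite \<Rightarrow> complex"
  assumes F: "\<And>n. holo_on (F n) (ball 0 1)" and s: "s < 1"
    and bd: "\<And>s'. s' < 1 \<Longrightarrow> \<exists>C. \<forall>n. \<forall>z\<in>cball 0 s'. norm (F n z) \<le> C"
  obtains g r where "strict_mono (r :: nat \<Rightarrow> nat)" "uniform_limit (cball 0 s) (F \<circ> r) g sequentially"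
proof -
  \<comment> \<open>Halfway between s and 1, with \<open>\<delta> = s' - s\<close>: balls of radius
    \<delta> around points of \<open>cball 0 s\<close> stay in \<open>cball 0 s'\<close>.\<close>
  define s' where "s' = (s + 1) / 2"
  define \<delta> where "\<delta> = (1 - s) / 2"
  have s': "s' < 1" "\<delta> > 0" using s by (simp_all add: s'_def \<delta>_def)
  obtain C where C: "\<And>n z. z \<in> cball 0 s' \<Longrightarrow> norm (F n z) \<le> C" using bd[OF s'(1)] by blast
  have sub: "cball x \<delta> \<subseteq> cball 0 s'" if "x \<in> cball 0 s" for x :: "complex^'n"
  proof
    fix y assume "y \<in> cball x \<delta>"
    then have "norm y \<le> norm x + \<delta>" using norm_triangle_sub[of y x] by (simp add: dist_norm norm_minus_commute)
    also have "\<dots> \<le> s + \<delta>" using that by simp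
    finally show "y \<in> cball 0 s'" by (simp add: s'_def \<delta>_def field_simps)
  qed
  have sub1: "cball 0 s' \<subseteq> ball (0::complex^'n) 1" using s' by auto
  \<comment> \<open>The maximum with 1 makes K positive, as needed for the modulus of continuity
    \<open>e / K\<close>; \<open>C\<close> itself may fail to be positive.\<close>
  define K where "K = max (C / \<delta>) 1"
  have lip: "norm (F n x - F n y) \<le> K * norm (x - y)" if "x \<in> cball 0 s" "y \<in> cball 0 s" for n x y
  proof (rule differentiable_bound[where S = "cball 0 s" and f' = "\<lambda>x. frechet_derivative (F n) (at x)"])
    fix x :: "complex^'n" assume x: "x \<in> cball 0 s"
    then have x1: "x \<in> ball 0 1" using s by simp
    show "(F n has_derivative frechet_derivative (F n) (at x)) (at x within cball 0 s)"
      by (rule has_derivative_at_withinI[OF holo_on_frechet(1)[OF F x1]])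
    show "onorm (frechet_derivative (F n) (at x)) \<le> K"
    proof (rule onorm_bound)
      fix v
      have "norm (frechet_derivative (F n) (at x) v) \<le> C / \<delta> * norm v"
        by (rule holo_on_derivative_bound[OF F]) (use sub[OF x] sub1 s' C in auto)
      also have "\<dots> \<le> K * norm v" by (intro mult_right_mono) (auto simp: K_def)
      finally show "norm (frechet_derivative (F n) (at x) v) \<le> K * norm v" .
    qed (simp add: K_def)
  qed (use that in auto)
  obtain g k where gk: "strict_mono (k :: nat \<Rightarrow> nat)"
    "\<And>e. 0 < e \<Longrightarrow> \<exists>N. \<forall>n x. n \<ge> N \<and> x \<in> cball 0 s \<longrightarrow> norm (F (k n) x - g x) < e"
  proof (rule Arzela_Ascoli[of "cball (0::complex^'n) s" F C])
    show "norm (F n x) \<le> C" if "x \<in> cball 0 s" for n x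
      using C sub[OF that] s' by (meson centre_in_cball less_imp_le subsetD)
    fix x :: "complex^'n" and e :: real assume x: "x \<in> cball 0 s" and e: "0 < e"
    have K: "K > 0" by (simp add: K_def)
    show "\<exists>d>0. \<forall>n y. y \<in> cball 0 s \<and> norm (x - y) < d \<longrightarrow> norm (F n x - F n y) < e"
    proof (intro exI conjI allI impI)
      show "e / K > 0" using e K by simp
      fix n y assume y: "y \<in> cball 0 s \<and> norm (x - y) < e / K"
      have "norm (F n x - F n y) \<le> K * norm (x - y)" using lip x y by blast
      also have "\<dots> < e" using y K by (simp add: field_simps)
      finally show "norm (F n x - F n y) < e" .
    qed
  qed (auto intro: that)
  show thesis
  proof (rule that[OF gk(1)])
    show "uniform_limit (cball 0 s) (F \<circ> k) g sequentially"
      unfolding uniform_limit_sequentially_iff dist_norm o_def using gk(2) by blast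
  qed
qed

section \<open>Orlicz functions and the Luxemburg norm\<close>

lemma orlicz_fun_nonneg: "orlicz_fun \<psi> \<Longrightarrow> 0 \<le> x \<Longrightarrow> 0 \<le> \<psi> x"
  and orlicz_fun_zero: "orlicz_fun \<psi> \<Longrightarrow> \<psi> 0 = 0"
  by (auto simp: orlicz_fun_def)

lemma orlicz_fun_convex:
  assumes "orlicz_fun \<psi>" "0 \<le> x" "0 \<le> y" "0 \<le> t" "t \<le> 1"
  shows "\<psi> ((1 - t) * x + t * y) \<le> (1 - t) * \<psi> x + t * \<psi> y"
proof (cases "x = y \<or> t = 0 \<or> t = 1")
  case True
  then show ?thesis by (auto simp: algebra_simps)
next
  case False
  with assms have "\<psi> ((1 - t) * x + t * y) < (1 - t) * \<psi> x + t * \<psi> y"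
    unfolding orlicz_fun_def strict_convex_on_def by simp
  then show ?thesis by simp
qed

lemma orlicz_fun_scale:
  assumes "orlicz_fun \<psi>" "0 \<le> x" "0 \<le> t" "t \<le> 1"
  shows "\<psi> (t * x) \<le> t * \<psi> x"
  using orlicz_fun_convex[OF assms(1) _ assms(2-4), of 0] by (simp add: orlicz_fun_zero[OF assms(1)])

text \<open>Monotonicity is not built into \<open>orlicz_fun\<close>: it follows by writing x as (x
  / y) * y and using convexity against the value 0 at 0, together with nonnegativity.\<close>

lemma orlicz_fun_mono:
  assumes "orlicz_fun \<psi>" "0 \<le> x" "x \<le> y"
  shows "\<psi> x \<le> \<psi> y"
proof (cases "y = 0")
  case False
  then have y: "y > 0" using assms by simp
  have "\<psi> (x / y * y) \<le> x / y * \<psi> y" using assms y by (intro orlicz_fun_scale) auto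
  also have "\<dots> \<le> 1 * \<psi> y"
    using assms y orlicz_fun_nonneg[OF assms(1), of y] by (intro mult_right_mono) auto
  finally show ?thesis using y by simp
qed (use assms in auto)

text \<open>Superlinear growth gives \<open>x \<le> \<psi> x\<close> from some point on; K absorbs
  the rest. This is how the \<psi>-modular comes to control the \<open>L\<^sup>1\<close>
  norm.\<close>

lemma orlicz_fun_dominates:
  assumes "orlicz_fun \<psi>"
  obtains K where "K > 0" "\<And>x. 0 \<le> x \<Longrightarrow> x \<le> K + \<psi> x"
proof -
  have "eventually (\<lambda>x. 1 \<le> \<psi> x / x) at_top"
    using assms unfolding orlicz_fun_def filterlim_at_top by blast
  then obtain N where N: "\<And>x. x \<ge> N \<Longrightarrow> 1 \<le> \<psi> x / x" by (auto simp: eventually_at_top_linorder)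
  have "x \<le> max N 1 + \<psi> x" if "0 \<le> x" for x
  proof (cases "x \<ge> max N 1")
    case True
    then have "x \<le> \<psi> x" using N[of x] by (simp add: field_simps)
    then show ?thesis by simp
  qed (use orlicz_fun_nonneg[OF assms that] in auto)
  then show thesis by (intro that[of "max N 1"]) auto
qed

lemma borel_measurable_orlicz_fun:
  fixes f :: "'a \<Rightarrow> complex"
  assumes "orlicz_fun \<psi>" and [measurable]: "f \<in> borel_measurable M" and "C > 0"
  shows "(\<lambda>x. \<psi> (norm (f x) / C)) \<in> borel_measurable M"
proof -
  \<comment> \<open>Measurability comes from monotonicity. Since \<psi> is unconstrained on negative
    arguments, it is first made constant there.\<close>
  have "mono (\<lambda>x. \<psi> (max 0 x))"
    by (rule monoI) (auto intro!: orlicz_fun_mono[OF assms(1)])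
  then have [measurable]: "(\<lambda>x. \<psi> (max 0 x)) \<in> borel_measurable borel"
    by (rule borel_measurable_mono)
  have "(\<lambda>x. (\<lambda>x. \<psi> (max 0 x)) (norm (f x) / C)) \<in> borel_measurable M" by measurable
  then show ?thesis using \<open>C > 0\<close> by simp
qed

section \<open>The modular and the Luxemburg norm\<close>

definition modular :: "'a measure \<Rightarrow> (real \<Rightarrow> real) \<Rightarrow> ('a \<Rightarrow> complex) \<Rightarrow> real \<Rightarrow> ennreal" where
  "modular M \<psi> f C = (\<integral>\<^sup>+ x. ennreal (\<psi> (norm (f x) / C)) \<partial>M)"

lemma lux_norm_eq: "lux_norm M \<psi> f = Inf {C. C > 0 \<and> modular M \<psi> f C \<le> 1}"
  by (simp add: lux_norm_def modular_def)

lemma lux_norm_cong: "(\<And>x. x \<in> space M \<Longrightarrow> f x = g x) \<Longrightarrow> lux_norm M \<psi> f = lux_norm M \<psi> g"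
  unfolding lux_norm_def by (simp cong: nn_integral_cong)

lemma modular_mono:
  assumes "orlicz_fun \<psi>" "0 < C" "C \<le> D"
  shows "modular M \<psi> f D \<le> modular M \<psi> f C"
  unfolding modular_def using assms
  by (intro nn_integral_mono ennreal_leI orlicz_fun_mono[OF assms(1)]) (auto intro!: divide_left_mono)

lemma lux_norm_le: "C > 0 \<Longrightarrow> modular M \<psi> f C \<le> 1 \<Longrightarrow> lux_norm M \<psi> f \<le> C"
  unfolding lux_norm_eq by (rule cInf_lower) (auto intro!: bdd_belowI[of _ 0])

text \<open>If the modular is finite at \<open>C\<close>, convexity divides it by at least k on
  passing to \<open>k * C\<close>. This makes the set in the definition of \<open>lux_norm\<close>
  nonempty, without which its real infimum would carry no information.\<close>

lemma orlicz_space_modular_le_1: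
  assumes \<psi>: "orlicz_fun \<psi>" and f: "f \<in> orlicz_space M \<psi>"
  obtains C where "C > 0" "modular M \<psi> f C \<le> 1"
proof -
  from f obtain C where [measurable]: "f \<in> borel_measurable M" and C: "C > 0" "modular M \<psi> f C < top"
    by (auto simp: orlicz_space_def modular_def)
  note [measurable] = borel_measurable_orlicz_fun[OF \<psi>]
  define k where "k = max 1 (enn2real (modular M \<psi> f C))"
  have k: "k \<ge> 1" by (simp add: k_def)
  have "modular M \<psi> f (k * C) \<le> (\<integral>\<^sup>+ x. ennreal (1 / k) * ennreal (\<psi> (norm (f x) / C)) \<partial>M)"
    unfolding modular_def
  proof (rule nn_integral_mono)
    fix x
    have "\<psi> (1 / k * (norm (f x) / C)) \<le> 1 / k * \<psi> (norm (f x) / C)"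
      using k C by (intro orlicz_fun_scale[OF \<psi>]) auto
    then show "ennreal (\<psi> (norm (f x) / (k * C))) \<le> ennreal (1 / k) * ennreal (\<psi> (norm (f x) / C))"
      using k by (subst ennreal_mult''[symmetric]) (auto intro!: ennreal_leI orlicz_fun_nonneg[OF \<psi>] simp: C(1) less_imp_le)
  qed
  also have "\<dots> = ennreal (1 / k) * modular M \<psi> f C"
    unfolding modular_def using borel_measurable_orlicz_fun[OF \<psi>, of f M C] C(1) by (intro nn_integral_cmult) simp
  also have "\<dots> \<le> ennreal (1 / k) * ennreal k"
  proof (rule mult_left_mono)
    show "modular M \<psi> f C \<le> ennreal k"
      using C(2) by (simp add: k_def) (metis ennreal_enn2real ennreal_leI max.cobounded2)
  qed simp
  also have "\<dots> = 1" using k by (simp flip: ennreal_mult')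
  finally show thesis using k C by (intro that[of "k * C"]) auto
qed

lemma lux_norm_nonneg:
  assumes "orlicz_fun \<psi>" "f \<in> orlicz_space M \<psi>"
  shows "0 \<le> lux_norm M \<psi> f"
  unfolding lux_norm_eq
  by (rule cInf_greatest) (use orlicz_space_modular_le_1[OF assms] in auto)

text \<open>The infimum is not claimed to be attained, hence the strict inequality: some admissible
  D lies below \<open>C\<close>, and the modular decreases in the scale.\<close>

lemma lux_norm_less_imp_modular:
  assumes "orlicz_fun \<psi>" "f \<in> orlicz_space M \<psi>" "lux_norm M \<psi> f < C"
  shows "modular M \<psi> f C \<le> 1"
proof -
  have "{C. C > 0 \<and> modular M \<psi> f C \<le> 1} \<noteq> {}" using orlicz_space_modular_le_1[OF assms(1,2)] by blast
  then obtain D where D: "D > 0" "modular M \<psi> f D \<le> 1" "D < C"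
    using cInf_lessD[of "{C. C > 0 \<and> modular M \<psi> f C \<le> 1}" C] assms(3) unfolding lux_norm_eq by auto
  then show ?thesis using modular_mono[OF assms(1), of D C M f] by simp
qed

text \<open>Integrate \<open>x \<le> K + \<psi> x\<close> at x = |f| / C over a probability space,
  which gives the factor K + 1 for every \<open>C\<close> above the norm, and let \<open>C\<close>
  decrease to the norm.\<close>

lemma nn_integral_le_lux_norm:
  assumes \<psi>: "orlicz_fun \<psi>" and M: "emeasure M (space M) = 1"
  obtains K where "K > 0"
    "\<And>f. f \<in> orlicz_space M \<psi> \<Longrightarrow> (\<integral>\<^sup>+x. ennreal (norm (f x)) \<partial>M) \<le> ennreal (K * lux_norm M \<psi> f)"
proof -
  obtain K where K: "K > 0" "\<And>x. 0 \<le> x \<Longrightarrow> x \<le> K + \<psi> x" by (rule orlicz_fun_dominates[OF \<psi>]) blast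
  have "(\<integral>\<^sup>+x. ennreal (norm (f x)) \<partial>M) \<le> ennreal ((K + 1) * lux_norm M \<psi> f)" if f: "f \<in> orlicz_space M \<psi>" for f
  proof -
    have fm: "f \<in> borel_measurable M" using f by (simp add: orlicz_space_def)
    have le: "(\<integral>\<^sup>+x. ennreal (norm (f x)) \<partial>M) \<le> ennreal ((K + 1) * C)" if C: "lux_norm M \<psi> f < C" for C
    proof -
      have C0: "C > 0" using C lux_norm_nonneg[OF \<psi> f] by simp
      have [measurable]: "(\<lambda>x. \<psi> (norm (f x) / C)) \<in> borel_measurable M"
        by (rule borel_measurable_orlicz_fun[OF \<psi> fm C0])
      have "(\<integral>\<^sup>+x. ennreal (norm (f x)) \<partial>M) \<le> (\<integral>\<^sup>+x. ennreal C * (ennreal K + ennreal (\<psi> (norm (f x) / C))) \<partial>M)"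
      proof (rule nn_integral_mono)
        fix x
        have "norm (f x) = C * (norm (f x) / C)" using C0 by simp
        also have "\<dots> \<le> C * (K + \<psi> (norm (f x) / C))" using C0 by (intro mult_left_mono K) auto
        finally show "ennreal (norm (f x)) \<le> ennreal C * (ennreal K + ennreal (\<psi> (norm (f x) / C)))"
          using C0 K(1) by (simp add: ennreal_leI orlicz_fun_nonneg[OF \<psi>] flip: ennreal_plus ennreal_mult'')
      qed
      also have "\<dots> = ennreal C * (ennreal K * emeasure M (space M) + modular M \<psi> f C)"
        unfolding modular_def by (simp add: nn_integral_cmult nn_integral_add)
      also have "\<dots> \<le> ennreal C * (ennreal K * 1 + 1)"
        using lux_norm_less_imp_modular[OF \<psi> f C] by (intro mult_left_mono add_left_mono) (auto simp: M)
      also have "\<dots> = ennreal ((K + 1) * C)"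
        using K(1) C0 by (simp add: ennreal_mult'' mult.commute)
      finally show ?thesis .
    qed
    \<comment> \<open>The limit in \<open>C\<close> is taken among reals; the bound at
      \<open>lux_norm M \<psi> f + 1\<close> shows that the integral is finite.\<close>
    define a where "a = enn2real (\<integral>\<^sup>+x. ennreal (norm (f x)) \<partial>M)"
    have fin: "(\<integral>\<^sup>+x. ennreal (norm (f x)) \<partial>M) = ennreal a"
      unfolding a_def using le[of "lux_norm M \<psi> f + 1"] by (intro ennreal_enn2real[symmetric]) (auto simp: less_top[symmetric] top_unique)
    have "a / (K + 1) \<le> C" if "lux_norm M \<psi> f < C" for C
    proof -
      have "C > 0" using that lux_norm_nonneg[OF \<psi> f] by simp
      then have "a \<le> (K + 1) * C" using le[OF that] K(1) by (simp add: fin)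
      then show ?thesis using K(1) by (simp add: field_simps)
    qed
    then have "a / (K + 1) \<le> lux_norm M \<psi> f" by (rule dense_ge)
    then have "a \<le> (K + 1) * lux_norm M \<psi> f" using K(1) by (simp add: field_simps)
    then show ?thesis by (simp add: fin ennreal_leI)
  qed
  then show thesis using K(1) by (intro that[of "K + 1"]) auto
qed

lemma bounded_orlicz_space:
  assumes \<psi>: "orlicz_fun \<psi>"
  obtains K where "K > 0"
    "\<And>M f S. emeasure M (space M) = 1 \<Longrightarrow> f \<in> borel_measurable M \<Longrightarrow> S > 0 \<Longrightarrow>
       (\<And>x. x \<in> space M \<Longrightarrow> norm (f x) \<le> S) \<Longrightarrow> f \<in> orlicz_space M \<psi> \<and> lux_norm M \<psi> f \<le> K * S"
proof -
  \<comment> \<open>Chosen so that \<open>\<psi> (1 / K) \<le> 1\<close> by convexity. It depends on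
    \<psi> alone, so one K serves all functions and, in the Hardy case, all radii.\<close>
  define K where "K = max 1 (\<psi> 1)"
  have K: "K \<ge> 1" by (simp add: K_def)
  have "\<psi> (1 / K * 1) \<le> 1 / K * \<psi> 1" using K by (intro orlicz_fun_scale[OF \<psi>]) auto
  also have "\<dots> \<le> 1" using K by (simp add: K_def)
  finally have K1: "\<psi> (1 / K) \<le> 1" by simp
  have "f \<in> orlicz_space M \<psi> \<and> lux_norm M \<psi> f \<le> K * S"
    if M: "emeasure M (space M) = 1" and f: "f \<in> borel_measurable M" and S: "S > 0"
      and le: "\<And>x. x \<in> space M \<Longrightarrow> norm (f x) \<le> S" for M :: "'a measure" and f S
  proof -
    have "modular M \<psi> f (K * S) \<le> (\<integral>\<^sup>+ x. 1 \<partial>M)"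
      unfolding modular_def
    proof (rule nn_integral_mono)
      fix x assume "x \<in> space M"
      then have "\<psi> (norm (f x) / (K * S)) \<le> \<psi> (1 / K)"
        using le[of x] S K by (intro orlicz_fun_mono[OF \<psi>]) (auto simp: field_simps)
      with K1 show "ennreal (\<psi> (norm (f x) / (K * S))) \<le> 1" by (simp add: ennreal_le_1)
    qed
    also have "\<dots> = 1" by (simp add: M)
    finally have *: "modular M \<psi> f (K * S) \<le> 1" .
    have "K * S > 0" using K S by simp
    with * f have "f \<in> orlicz_space M \<psi>"
      unfolding orlicz_space_def modular_def by (auto intro!: exI[of _ "K * S"] simp: le_less_trans[OF _ ennreal_one_less_top])
    with lux_norm_le[OF \<open>K * S > 0\<close> *] show ?thesis by simp
  qed
  then show thesis using K by (intro that[of K]) auto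
qed

text \<open>The usual proof of the triangle inequality for a Luxemburg norm: |f - g| / (a + b) is at
  most the convex combination of |f| / a and |g| / b with weights a / (a + b) and b / (a +
  b).\<close>

lemma orlicz_space_diff:
  assumes \<psi>: "orlicz_fun \<psi>" and f: "f \<in> orlicz_space M \<psi>" and g: "g \<in> orlicz_space M \<psi>"
  shows "(\<lambda>x. f x - g x) \<in> orlicz_space M \<psi>"
    "lux_norm M \<psi> (\<lambda>x. f x - g x) \<le> lux_norm M \<psi> f + lux_norm M \<psi> g"
proof -
  have fm[measurable]: "f \<in> borel_measurable M" "g \<in> borel_measurable M"
    using f g by (auto simp: orlicz_space_def)
  have mod: "modular M \<psi> (\<lambda>x. f x - g x) (a + b) \<le> 1" if ab: "a > lux_norm M \<psi> f" "b > lux_norm M \<psi> g" for a b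
  proof -
    have pos: "a > 0" "b > 0" using ab lux_norm_nonneg[OF \<psi>] f g by (meson le_less_trans)+
    note [measurable] = borel_measurable_orlicz_fun[OF \<psi> fm(1) pos(1)] borel_measurable_orlicz_fun[OF \<psi> fm(2) pos(2)]
    define t where "t = b / (a + b)"
    have t: "0 \<le> t" "t \<le> 1" "1 - t = a / (a + b)" using pos by (auto simp: t_def field_simps)
    have "modular M \<psi> (\<lambda>x. f x - g x) (a + b)
        \<le> (\<integral>\<^sup>+ x. ennreal (1 - t) * ennreal (\<psi> (norm (f x) / a)) + ennreal t * ennreal (\<psi> (norm (g x) / b)) \<partial>M)"
      unfolding modular_def
    proof (rule nn_integral_mono)
      fix x
      have "norm (f x - g x) / (a + b) \<le> (norm (f x) + norm (g x)) / (a + b)"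
        using pos by (intro divide_right_mono norm_triangle_ineq4) auto
      also have "\<dots> = (1 - t) * (norm (f x) / a) + t * (norm (g x) / b)"
        unfolding t(3) using pos by (simp add: t_def add_divide_distrib)
      finally have "\<psi> (norm (f x - g x) / (a + b)) \<le> \<psi> ((1 - t) * (norm (f x) / a) + t * (norm (g x) / b))"
        using pos by (intro orlicz_fun_mono[OF \<psi>]) auto
      also have "\<dots> \<le> (1 - t) * \<psi> (norm (f x) / a) + t * \<psi> (norm (g x) / b)"
        using pos t by (intro orlicz_fun_convex[OF \<psi>]) auto
      finally show "ennreal (\<psi> (norm (f x - g x) / (a + b)))
          \<le> ennreal (1 - t) * ennreal (\<psi> (norm (f x) / a)) + ennreal t * ennreal (\<psi> (norm (g x) / b))"
        using pos t by (simp add: ennreal_leI orlicz_fun_nonneg[OF \<psi>] flip: ennreal_plus ennreal_mult'')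
    qed
    also have "\<dots> = ennreal (1 - t) * modular M \<psi> f a + ennreal t * modular M \<psi> g b"
      unfolding modular_def by (simp add: nn_integral_add nn_integral_cmult)
    also have "\<dots> \<le> ennreal (1 - t) * 1 + ennreal t * 1"
      using lux_norm_less_imp_modular[OF \<psi>] f g ab by (intro add_mono mult_left_mono) auto
    also have "\<dots> = 1" using t by (simp flip: ennreal_plus)
    finally show ?thesis .
  qed
  have pos: "lux_norm M \<psi> f \<ge> 0" "lux_norm M \<psi> g \<ge> 0" using lux_norm_nonneg[OF \<psi>] f g by auto
  show "(\<lambda>x. f x - g x) \<in> orlicz_space M \<psi>"
    using mod[of "lux_norm M \<psi> f + 1" "lux_norm M \<psi> g + 1"] pos unfolding orlicz_space_def modular_def
    by (auto intro!: exI[of _ "lux_norm M \<psi> f + 1 + (lux_norm M \<psi> g + 1)"] simp: le_less_trans[OF _ ennreal_one_less_top])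
  show "lux_norm M \<psi> (\<lambda>x. f x - g x) \<le> lux_norm M \<psi> f + lux_norm M \<psi> g"
  proof (rule field_le_epsilon)
    fix e :: real assume "e > 0"
    then have "lux_norm M \<psi> (\<lambda>x. f x - g x) \<le> (lux_norm M \<psi> f + e / 2) + (lux_norm M \<psi> g + e / 2)"
      using pos by (intro lux_norm_le mod) auto
    then show "lux_norm M \<psi> (\<lambda>x. f x - g x) \<le> lux_norm M \<psi> f + lux_norm M \<psi> g + e" by simp
  qed
qed

text \<open>Chebyshev's inequality: at scale \<open>c\<close>, the set A alone already pushes the
  modular above 1.\<close>

lemma lux_norm_lower_bound:
  assumes \<psi>: "orlicz_fun \<psi>" and f: "f \<in> orlicz_space M \<psi>"
    and A: "A \<in> sets M" "\<And>x. x \<in> A \<Longrightarrow> a \<le> norm (f x)" and ac: "a \<ge> 0" "c > 0"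
    and gt: "ennreal (\<psi> (a / c)) * emeasure M A > 1"
  shows "c \<le> lux_norm M \<psi> f"
proof (rule ccontr)
  assume "\<not> c \<le> lux_norm M \<psi> f"
  then have "modular M \<psi> f c \<le> 1" using lux_norm_less_imp_modular[OF \<psi> f] by simp
  moreover have "ennreal (\<psi> (a / c)) * emeasure M A = (\<integral>\<^sup>+x. ennreal (\<psi> (a / c)) * indicator A x \<partial>M)"
    using A by (simp add: nn_integral_cmult_indicator)
  moreover have "\<dots> \<le> modular M \<psi> f c"
    unfolding modular_def using A ac
    by (intro nn_integral_mono) (auto simp: indicator_def intro!: ennreal_leI orlicz_fun_mono[OF \<psi>] divide_right_mono)
  ultimately show False using gt by (simp add: not_less)
qed

section \<open>An Orlicz function of prescribed growth\<close>

lemma strictly_convex_square: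
  fixes x y t :: real
  assumes "x \<noteq> y" "0 < t" "t < 1"
  shows "((1 - t) * x + t * y)\<^sup>2 < (1 - t) * x\<^sup>2 + t * y\<^sup>2"
proof -
  have "(1 - t) * x\<^sup>2 + t * y\<^sup>2 - ((1 - t) * x + t * y)\<^sup>2 = t * (1 - t) * (x - y)\<^sup>2"
    by (simp add: power2_eq_square algebra_simps)
  moreover have "\<dots> > 0" using assms by simp
  ultimately show ?thesis by linarith
qed

lemma convex_positive_part:
  fixes x y t a :: real
  assumes "0 \<le> t" "t \<le> 1"
  shows "max 0 ((1 - t) * x + t * y - a) \<le> (1 - t) * max 0 (x - a) + t * max 0 (y - a)"
proof -
  have "(1 - t) * x + t * y - a = (1 - t) * (x - a) + t * (y - a)" by (simp add: algebra_simps)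
  also have "\<dots> \<le> (1 - t) * max 0 (x - a) + t * max 0 (y - a)"
    using assms by (intro add_mono mult_left_mono) auto
  finally show ?thesis using assms by simp
qed

text \<open>The function is \<open>x\<^sup>2 + \<Sum>k. c k * (x - (k + 1))\<^sub>+\<close>. On \<open>{0..k + 1}\<close> it only depends on the
  slopes before \<open>c k\<close>, so \<open>m k\<close> can be chosen first and \<open>c k\<close> afterwards.\<close>

lemma fast_growing_orlicz_fun:
  fixes I \<epsilon> :: "nat \<Rightarrow> real"
  assumes I: "I \<longlonglongrightarrow> 0" and \<epsilon>: "\<And>m. \<epsilon> m > 0"
  obtains \<psi> m where "orlicz_fun \<psi>" "\<And>k. m k \<ge> k" "\<And>k. \<psi> (real (k + 1)) * I (m k) \<le> 1"
    "\<And>k. \<psi> (2 * real (k + 1)) * \<epsilon> (m k) > 1"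
proof -
  \<comment> \<open>The factor of \<open>\<bar>I m\<bar>\<close> is a bound for
    \<open>\<psi> (k + 1)\<close> when the slopes before \<open>c k\<close> have sum
    \<open>s\<close>. Leaving \<open>s\<close> free allows m to be chosen before \<psi>
    exists.\<close>
  have "\<exists>m. m \<ge> k \<and> ((real (k + 1))\<^sup>2 + real (k + 1) * s) * \<bar>I m\<bar> \<le> 1" for k s
  proof -
    have "(\<lambda>m. ((real (k + 1))\<^sup>2 + real (k + 1) * s) * \<bar>I m\<bar>) \<longlonglongrightarrow> ((real (k + 1))\<^sup>2 + real (k + 1) * s) * \<bar>0\<bar>"
      by (intro tendsto_intros I)
    then have "eventually (\<lambda>m. ((real (k + 1))\<^sup>2 + real (k + 1) * s) * \<bar>I m\<bar> < 1) sequentially"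
      by (rule order_tendstoD) simp
    then have "eventually (\<lambda>m. m \<ge> k \<and> ((real (k + 1))\<^sup>2 + real (k + 1) * s) * \<bar>I m\<bar> < 1) sequentially"
      using eventually_ge_at_top[of k] by eventually_elim simp
    then show ?thesis unfolding eventually_sequentially by (meson less_imp_le order_refl)
  qed
  then obtain M where M: "\<And>k s. M k s \<ge> k"
    "\<And>k s. ((real (k + 1))\<^sup>2 + real (k + 1) * s) * \<bar>I (M k s)\<bar> \<le> 1" by metis
  \<comment> \<open>\<open>S k\<close> is the sum of the slopes before \<open>c k\<close>; it
    determines \<open>m k\<close>, which determines \<open>c k\<close>, which yields
    \<open>S (k + 1)\<close>.\<close>
  define S where "S = rec_nat 0 (\<lambda>k s. s + 2 / \<epsilon> (M k s))"
  define m where "m k = M k (S k)" for k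
  define c where "c k = 2 / \<epsilon> (m k)" for k
  have c: "c k > 0" for k using \<epsilon> by (simp add: c_def)
  have S: "S k = (\<Sum>j<k. c j)" for k
    by (induction k) (simp_all add: S_def c_def m_def)
  define \<psi> where "\<psi> x = x\<^sup>2 + (\<Sum>k<nat \<lceil>x\<rceil>. c k * max 0 (x - real (k + 1)))" for x
  \<comment> \<open>Terms whose kink lies beyond x vanish, so any cut-off n above x will do. A
    common n lets values of \<psi> at several points be compared term by term.\<close>
  have \<psi>: "\<psi> x = x\<^sup>2 + (\<Sum>k<n. c k * max 0 (x - real (k + 1)))" if "x \<le> real n" for x n
  proof -
    have "(\<Sum>k<nat \<lceil>x\<rceil>. c k * max 0 (x - real (k + 1))) = (\<Sum>k<n. c k * max 0 (x - real (k + 1)))"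
    proof (rule sum.mono_neutral_left)
      show "{..<nat \<lceil>x\<rceil>} \<subseteq> {..<n}" using that by (auto simp: ceiling_le_iff nat_le_iff intro: less_le_trans)
      show "\<forall>k\<in>{..<n} - {..<nat \<lceil>x\<rceil>}. c k * max 0 (x - real (k + 1)) = 0"
      proof
        fix k assume "k \<in> {..<n} - {..<nat \<lceil>x\<rceil>}"
        then have "x \<le> real k" by (simp add: nat_le_iff ceiling_le_iff not_less)
        then show "c k * max 0 (x - real (k + 1)) = 0" by simp
      qed
    qed simp
    then show ?thesis by (simp add: \<psi>_def)
  qed
  have ge: "\<psi> x \<ge> x\<^sup>2" for x
    using c by (simp add: \<psi>_def sum_nonneg less_imp_le)
  have "orlicz_fun \<psi>"
    unfolding orlicz_fun_def
  proof (intro conjI allI impI)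
    show "strict_convex_on {0..} \<psi>"
      unfolding strict_convex_on_def
    proof (intro ballI impI allI, elim conjE)
      fix x y t :: real assume xy: "x \<in> {0..}" "y \<in> {0..}" "x \<noteq> y" and t: "0 < t" "t < 1"
      obtain n where n: "max x y \<le> real n" using real_arch_simple by blast
      have "(1 - t) * x + t * y \<le> (1 - t) * real n + t * real n"
        using n t by (intro add_mono mult_left_mono) auto
      then have n': "(1 - t) * x + t * y \<le> real n" by (simp add: algebra_simps)
      have "(\<Sum>k<n. c k * max 0 ((1 - t) * x + t * y - real (k + 1)))
          \<le> (\<Sum>k<n. c k * ((1 - t) * max 0 (x - real (k + 1)) + t * max 0 (y - real (k + 1))))"
        using t c by (intro sum_mono mult_left_mono convex_positive_part) (auto intro: less_imp_le)
      also have "\<dots> = (1 - t) * (\<Sum>k<n. c k * max 0 (x - real (k + 1))) + t * (\<Sum>k<n. c k * max 0 (y - real (k + 1)))"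
        by (simp add: sum_distrib_left sum.distrib distrib_left mult_ac)
      finally show "\<psi> ((1 - t) * x + t * y) < (1 - t) * \<psi> x + t * \<psi> y"
        using strictly_convex_square[OF xy(3) t] n n' by (simp add: \<psi>[of _ n] distrib_left)
    qed
    show "0 \<le> \<psi> x" for x using ge[of x] by (meson order_trans zero_le_power2)
    show "\<psi> 0 = 0" by (simp add: \<psi>_def)
    \<comment> \<open>The first kink is at 1, so near 0 only the square is left. The square also
      supplies the strictness of the convexity and the superlinear growth.\<close>
    have sq: "\<psi> x = x\<^sup>2" if "x \<le> 1" for x using \<psi>[of x 1] that by simp
    have "continuous (at 0 within {0..}) (\<lambda>x::real. x\<^sup>2)" by (intro continuous_intros)
    moreover have "eventually (\<lambda>x. x\<^sup>2 = \<psi> x) (at 0 within {0..})"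
      using order_tendstoD(2)[OF tendsto_ident_at[of 0 "{0..}"] zero_less_one] by (auto elim!: eventually_mono simp: sq)
    ultimately show "continuous (at 0 within {0..}) \<psi>"
      unfolding continuous_within by (simp add: sq filterlim_cong[OF refl refl, of "\<lambda>x. x\<^sup>2" \<psi>])
    show "filterlim (\<lambda>x. \<psi> x / x) at_top at_top"
    proof (rule filterlim_at_top_mono[OF filterlim_ident])
      show "eventually (\<lambda>x. x \<le> \<psi> x / x) at_top"
        using eventually_gt_at_top[of 0]
      proof eventually_elim
        case (elim x)
        then show ?case using ge[of x] by (simp add: field_simps power2_eq_square)
      qed
    qed
  qed
  moreover have "m k \<ge> k" for k using M by (simp add: m_def)
  moreover have "\<psi> (real (k + 1)) * I (m k) \<le> 1" for k
  proof -
    \<comment> \<open>The term j = k has its kink exactly at k + 1 and contributes nothing; hence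
      \<open>S k\<close> rather than \<open>S (k + 1)\<close> appears in the bound.\<close>
    have "(\<Sum>j<k + 1. c j * max 0 (real (k + 1) - real (j + 1))) \<le> (\<Sum>j<k + 1. if j < k then c j * real (k + 1) else 0)"
    proof (rule sum_mono)
      fix j assume "j \<in> {..<k + 1}"
      then consider "j < k" | "j = k" by fastforce
      then show "c j * max 0 (real (k + 1) - real (j + 1)) \<le> (if j < k then c j * real (k + 1) else 0)"
        by cases (use c[of j] in \<open>auto intro!: mult_left_mono\<close>)
    qed
    also have "\<dots> = real (k + 1) * S k" by (simp add: S sum_distrib_left mult.commute cong: sum.cong_simp)
    finally have "\<psi> (real (k + 1)) \<le> (real (k + 1))\<^sup>2 + real (k + 1) * S k"
      using \<psi>[of "real (k + 1)" "k + 1"] by simp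
    moreover have "\<psi> (real (k + 1)) \<ge> 0" using ge[of "real (k + 1)"] by (meson order_trans zero_le_power2)
    ultimately have "\<psi> (real (k + 1)) * I (m k) \<le> ((real (k + 1))\<^sup>2 + real (k + 1) * S k) * \<bar>I (m k)\<bar>"
      by (intro order_trans[OF mult_left_mono[OF abs_ge_self] mult_right_mono]) auto
    also have "\<dots> \<le> 1" unfolding m_def by (rule M)
    finally show ?thesis .
  qed
  moreover have "\<psi> (2 * real (k + 1)) * \<epsilon> (m k) > 1" for k
  proof -
    \<comment> \<open>The point 2 * (k + 1) lies at least 1 beyond kink k, so this single term
      contributes at least \<open>c k\<close>, that is \<open>2 / \<epsilon> (m k)\<close>.\<close>
    have "c k * 1 \<le> c k * max 0 (2 * real (k + 1) - real (k + 1))"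
      using c[of k] by (intro mult_left_mono) auto
    also have "\<dots> \<le> (\<Sum>j<2 * (k + 1). c j * max 0 (2 * real (k + 1) - real (j + 1)))"
      by (rule member_le_sum) (use c in \<open>auto intro!: mult_nonneg_nonneg simp: less_imp_le\<close>)
    also have "\<dots> \<le> \<psi> (2 * real (k + 1))" using \<psi>[of "2 * real (k + 1)" "2 * (k + 1)"] by simp
    finally have "c k \<le> \<psi> (2 * real (k + 1))" by simp
    then have "c k * \<epsilon> (m k) \<le> \<psi> (2 * real (k + 1)) * \<epsilon> (m k)"
      using \<epsilon> by (intro mult_right_mono) (auto intro: less_imp_le)
    moreover have "c k * \<epsilon> (m k) = 2" using \<epsilon>[of "m k"] by (simp add: c_def)
    ultimately show ?thesis by simp
  qed
  ultimately show thesis by (rule that)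
qed

section \<open>Composition operators on normed function spaces on the ball\<close>

text \<open>What the three kinds of spaces share. \<open>eval\<close> and \<open>bounded\<close>
  place convergence in the norm between uniform convergence on the ball and locally uniform
  convergence. Elements of X are total functions with arbitrary values off the ball, and
  \<open>cong\<close> makes the norm blind to these.\<close>

locale ball_space =
  fixes X :: "(complex^'n::finite \<Rightarrow> complex) set" and nrm :: "(complex^'n \<Rightarrow> complex) \<Rightarrow> real"
  assumes holo: "f \<in> X \<Longrightarrow> holo_on f unit_ball"
    and eval: "s < 1 \<Longrightarrow> \<exists>C\<ge>0. \<forall>f\<in>X. \<forall>z\<in>cball 0 s. norm (f z) \<le> C * nrm f"
    and bounded: "\<exists>K>0. \<forall>f S. S > 0 \<longrightarrow> holo_on f unit_ball \<longrightarrow> (\<forall>z\<in>unit_ball. norm (f z) \<le> S) \<longrightarrow>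
       f \<in> X \<and> 0 \<le> nrm f \<and> nrm f \<le> K * S"
    and diff: "f \<in> X \<Longrightarrow> g \<in> X \<Longrightarrow> (\<lambda>z. f z - g z) \<in> X"
    and cong: "(\<And>z. z \<in> unit_ball \<Longrightarrow> f z = g z) \<Longrightarrow> nrm f = nrm g"
begin

lemma compact_comp_if_norm_bounded_away:
  assumes \<phi>: "holo_self_map \<phi>" and s: "s < 1" "\<phi> ` unit_ball \<subseteq> cball 0 s"
  shows "compact_comp X nrm \<phi>"
proof -
  obtain K where K: "K > 0" and bd: "\<And>f S. S > 0 \<Longrightarrow> holo_on f unit_ball \<Longrightarrow>
      (\<And>z. z \<in> unit_ball \<Longrightarrow> norm (f z) \<le> S) \<Longrightarrow> f \<in> X \<and> 0 \<le> nrm f \<and> nrm f \<le> K * S"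
    using bounded by metis
  have comp: "holo_on (f \<circ> \<phi>) unit_ball" if "holo_on f unit_ball" for f
    using holo_on_compose[OF that, of \<phi> unit_ball] \<phi> by (auto simp: holo_self_map_def)
  show ?thesis
  unfolding compact_comp_def
proof (intro conjI ballI allI impI)
  fix f assume "f \<in> X"
  from eval[OF s(1)] obtain C where C: "\<And>z. z \<in> cball 0 s \<Longrightarrow> norm (f z) \<le> C * nrm f" using \<open>f \<in> X\<close> by blast
  have "norm ((f \<circ> \<phi>) z) \<le> max 1 (C * nrm f)" if "z \<in> unit_ball" for z
    using C[of "\<phi> z"] s(2) that by fastforce
  with comp[OF holo[OF \<open>f \<in> X\<close>]] show "f \<circ> \<phi> \<in> X"
    using bd[of "max 1 (C * nrm f)" "f \<circ> \<phi>"] by simp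
next
  fix F :: "nat \<Rightarrow> complex^'n \<Rightarrow> complex" assume F: "\<forall>n. F n \<in> X \<and> nrm (F n) \<le> 1"
  have Fh: "holo_on (F n) (ball 0 1)" for n using F holo by (simp add: unit_ball_def)
  have "\<exists>C. \<forall>n. \<forall>z\<in>cball 0 s'. norm (F n z) \<le> C" if "s' < 1" for s'
  proof -
    from eval[OF that] obtain C where C: "C \<ge> 0" "\<And>f z. f \<in> X \<Longrightarrow> z \<in> cball 0 s' \<Longrightarrow> norm (f z) \<le> C * nrm f" by blast
    have "norm (F n z) \<le> C * 1" if "z \<in> cball 0 s'" for n z
      using C(2)[of "F n" z] that F mult_left_mono[OF _ C(1), of "nrm (F n)" 1] by fastforce
    then show ?thesis by blast
  qed
  from holo_on_Montel[OF Fh s(1) this] obtain g r where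
    r: "strict_mono r" and g: "uniform_limit (cball 0 s) (F \<circ> r) g sequentially" by blast
  have lim: "uniform_limit unit_ball (\<lambda>k. F (r k) \<circ> \<phi>) (g \<circ> \<phi>) sequentially"
    using uniform_limit_compose'[OF g, of \<phi> unit_ball] s(2) by (auto simp: o_def)
  \<comment> \<open>Holomorphy is obtained for the composition, not for \<open>g\<close>: the
    compositions converge uniformly on the whole open ball, while \<open>g\<close> is a limit on a
    closed ball only.\<close>
  have hg: "holo_on (g \<circ> \<phi>) unit_ball"
  proof (rule holo_on_uniform_limit[OF _ _ lim])
    show "holo_on (F (r n) \<circ> \<phi>) unit_ball" for n by (rule comp) (simp add: Fh unit_ball_def)
  qed (simp add: unit_ball_def)
  have ev: "eventually (\<lambda>k. \<forall>z\<in>unit_ball. norm (F (r k) (\<phi> z) - g (\<phi> z)) \<le> e) sequentially" if "e > 0" for e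
    using uniform_limitD[OF lim that] by eventually_elim (auto simp: dist_norm less_imp_le)
  \<comment> \<open>One member of the sequence within distance 1 of the limit bounds the limit,
    which puts it into X.\<close>
  obtain k0 where k0: "\<And>z. z \<in> unit_ball \<Longrightarrow> norm (F (r k0) (\<phi> z) - g (\<phi> z)) \<le> 1"
    using ev[of 1] by (auto simp: eventually_sequentially)
  obtain C where C: "\<And>z. z \<in> cball 0 s \<Longrightarrow> norm (F (r k0) z) \<le> C * nrm (F (r k0))" using eval[OF s(1)] F by blast
  have "norm ((g \<circ> \<phi>) z) \<le> max 1 (C * nrm (F (r k0)) + 1)" if z: "z \<in> unit_ball" for z
  proof -
    have "norm (g (\<phi> z)) \<le> norm (F (r k0) (\<phi> z)) + norm (F (r k0) (\<phi> z) - g (\<phi> z))"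
      by (metis norm_minus_commute norm_triangle_sub)
    also have "\<dots> \<le> C * nrm (F (r k0)) + 1" using C[of "\<phi> z"] k0[OF z] z s(2) by (intro add_mono) auto
    finally show ?thesis by simp
  qed
  then have gX: "g \<circ> \<phi> \<in> X" using bd[OF _ hg] by (metis less_max_iff_disj zero_less_one)
  have "(\<lambda>k. nrm (\<lambda>z. F (r k) (\<phi> z) - (g \<circ> \<phi>) z)) \<longlonglongrightarrow> 0"
  proof (rule tendstoI)
    fix e :: real assume "e > 0"
    then have e: "e / (2 * K) > 0" using K by simp
    show "eventually (\<lambda>k. dist (nrm (\<lambda>z. F (r k) (\<phi> z) - (g \<circ> \<phi>) z)) 0 < e) sequentially"
      using ev[OF e]
    proof eventually_elim
      case (elim k)
      have "holo_on (\<lambda>z. (F (r k) \<circ> \<phi>) z - (g \<circ> \<phi>) z) unit_ball"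
        by (intro holo_on_diff hg comp) (simp add: Fh unit_ball_def)
      from bd[OF e this] elim have "0 \<le> nrm (\<lambda>z. F (r k) (\<phi> z) - (g \<circ> \<phi>) z)"
        "nrm (\<lambda>z. F (r k) (\<phi> z) - (g \<circ> \<phi>) z) \<le> K * (e / (2 * K))" by auto
      moreover have "K * (e / (2 * K)) < e" using K \<open>e > 0\<close> by simp
      ultimately show ?case by simp
    qed
  qed
  with r gX show "\<exists>r g. strict_mono r \<and> g \<in> X \<and> (\<lambda>k. nrm (\<lambda>z. F (r k) (\<phi> z) - g z)) \<longlonglongrightarrow> 0" by blast
qed
qed

text \<open>Point evaluations are continuous on X, so a norm limit of a subsequence of the
  compositions must agree with their pointwise limit 0 on the ball; the norms would then tend to 0.
  Membership of the compositions in X may be assumed in \<open>lower\<close> because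
  \<open>compact_comp\<close> provides it.\<close>

lemma not_compact_comp:
  assumes F: "\<And>k::nat. F k \<in> X" "\<And>k. nrm (F k) \<le> 1"
    and pointwise: "\<And>z. z \<in> unit_ball \<Longrightarrow> (\<lambda>k. F k (\<phi> z)) \<longlonglongrightarrow> 0"
    and lower: "\<And>k. F k \<circ> \<phi> \<in> X \<Longrightarrow> \<delta> \<le> nrm (F k \<circ> \<phi>)" and \<delta>: "\<delta> > 0"
  shows "\<not> compact_comp X nrm \<phi>"
proof
  assume c: "compact_comp X nrm \<phi>"
  then obtain r g where r: "strict_mono (r :: nat \<Rightarrow> nat)" and g: "g \<in> X"
    and lim: "(\<lambda>k. nrm (\<lambda>z. F (r k) (\<phi> z) - g z)) \<longlonglongrightarrow> 0"
    unfolding compact_comp_def using F by blast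
  have FX: "F k \<circ> \<phi> \<in> X" for k using c F unfolding compact_comp_def by blast
  have g0: "g z = 0" if z: "z \<in> unit_ball" for z
  proof -
    have "norm z < 1" using z by (simp add: unit_ball_def)
    from eval[OF this] obtain C where C: "\<And>f. f \<in> X \<Longrightarrow> norm (f z) \<le> C * nrm f"
      by (metis mem_cball_0 order_refl)
    have "(\<lambda>k. F (r k) (\<phi> z) - g z) \<longlonglongrightarrow> 0"
    proof (rule Lim_null_comparison)
      show "(\<lambda>k. C * nrm (\<lambda>z. F (r k) (\<phi> z) - g z)) \<longlonglongrightarrow> 0"
        using tendsto_mult_left[OF lim, of C] by simp
      show "eventually (\<lambda>k. norm (F (r k) (\<phi> z) - g z) \<le> C * nrm (\<lambda>z. F (r k) (\<phi> z) - g z)) sequentially"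
        using C[OF diff[OF FX g]] by simp
    qed
    moreover have "(\<lambda>k. F (r k) (\<phi> z) - g z) \<longlonglongrightarrow> 0 - g z"
      using LIMSEQ_subseq_LIMSEQ[OF pointwise[OF z] r] by (intro tendsto_intros) (simp add: o_def)
    ultimately show "g z = 0" using LIMSEQ_unique by fastforce
  qed
  \<comment> \<open>\<open>g\<close> is known to vanish on the ball only; \<open>cong\<close>
    disposes of its other values.\<close>
  have "\<delta> \<le> nrm (\<lambda>z. F (r k) (\<phi> z) - g z)" for k
    using lower[OF FX, of "r k"] cong[of "\<lambda>z. F (r k) (\<phi> z) - g z" "F (r k) \<circ> \<phi>"] g0 by simp
  then have "\<delta> \<le> 0" using lim by (intro LIMSEQ_le_const[OF lim]) auto
  with \<delta> show False by simp
qed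
end

section \<open>Hardy-Orlicz, Bergman-Orlicz and bounded functions\<close>

text \<open>The mean value inequality on balls of radius (1 - s) / 2. The integral is confined to a
  ball of radius less than 1, so that in the Bergman case the weight is bounded below on the domain
  of integration.\<close>

lemma holo_on_eval_le_L1:
  assumes s: "s < 1"
  obtains C where "C > 0"
    "\<And>(f :: complex^'n::finite \<Rightarrow> complex) z. holo_on f unit_ball \<Longrightarrow> z \<in> cball 0 s \<Longrightarrow>
      ennreal (norm (f z)) \<le> ennreal C * (\<integral>\<^sup>+w. ennreal (norm (f w)) * indicator (ball 0 ((1 + s) / 2)) w \<partial>lborel)"
proof -
  define \<rho> where "\<rho> = (1 - s) / 2"
  have \<rho>: "\<rho> > 0" using s by (simp add: \<rho>_def)
  define V where "V = measure lborel (ball (0::complex^'n) \<rho>)"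
  have V: "emeasure lborel (ball (0::complex^'n) \<rho>) = ennreal V"
    unfolding V_def using emeasure_lborel_ball_finite[of "0::complex^'n" \<rho>] by (intro emeasure_eq_ennreal_measure) auto
  have Vpos: "V > 0"
    using emeasure_lborel_open_pos[of "ball (0::complex^'n) \<rho>"] \<rho> unfolding V by simp
  show thesis
  proof (rule that[of "1 / V"])
    fix f :: "complex^'n \<Rightarrow> complex" and z :: "complex^'n"
    assume f: "holo_on f unit_ball" and z: "z \<in> cball 0 s"
    have sub: "cball z \<rho> \<subseteq> cball 0 ((1 + s) / 2)"
    proof
      fix y :: "complex^'n" assume "y \<in> cball z \<rho>"
      then have "norm y \<le> norm z + \<rho>" using norm_triangle_sub[of y z] by (simp add: dist_norm norm_minus_commute)
      also have "\<dots> \<le> s + \<rho>" using z by simp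
      finally show "y \<in> cball 0 ((1 + s) / 2)" by (simp add: \<rho>_def field_simps)
    qed
    have sub': "ball z \<rho> \<subseteq> ball 0 ((1 + s) / 2)"
      using interior_mono[OF sub] \<rho> by (simp add: interior_cball)
    have "ennreal (norm (f z)) * ennreal V \<le> (\<integral>\<^sup>+w. ennreal (norm (f w)) * indicator (ball z \<rho>) w \<partial>lborel)"
      using sub s unfolding V[symmetric]
      by (intro holo_on_mean_value_inequality[OF f]) (auto simp: unit_ball_def subset_iff)
    also have "\<dots> \<le> (\<integral>\<^sup>+w. ennreal (norm (f w)) * indicator (ball 0 ((1 + s) / 2)) w \<partial>lborel)"
      using sub' by (intro nn_integral_mono mult_left_mono) (auto simp: indicator_def)
    finally have "ennreal (1 / V) * (ennreal (norm (f z)) * ennreal V)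
      \<le> ennreal (1 / V) * (\<integral>\<^sup>+w. ennreal (norm (f w)) * indicator (ball 0 ((1 + s) / 2)) w \<partial>lborel)"
      by (rule mult_left_mono) simp
    also have "ennreal (1 / V) * (ennreal (norm (f z)) * ennreal V) = ennreal (norm (f z))"
      using Vpos by (simp flip: ennreal_mult'')
    finally show "ennreal (norm (f z)) \<le> ennreal (1 / V) * (\<integral>\<^sup>+w. ennreal (norm (f w)) * indicator (ball 0 ((1 + s) / 2)) w \<partial>lborel)" .
  qed (use Vpos in simp)
qed

lemma borel_measurable_holo_on:
  assumes "holo_on f unit_ball"
  shows "(\<lambda>w. ennreal (indicator (ball 0 1) w *\<^sub>R norm (f w))) \<in> borel_measurable borel"
  using holo_on_imp_continuous_on[OF assms]
  by (intro measurable_compose[OF _ measurable_ennreal] borel_measurable_continuous_on_indicator continuous_on_norm)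
    (auto simp: unit_ball_def)

lemma borel_measurable_dilate_sphere:
  fixes f :: "complex^'n::finite \<Rightarrow> complex"
  assumes "holo_on f unit_ball" "r \<in> {0<..<1}"
  shows "(\<lambda>\<zeta>. f (r *\<^sub>R \<zeta>)) \<in> borel_measurable sphere_measure"
proof -
  have "continuous_on (sphere 0 1) (\<lambda>\<zeta>. f (r *\<^sub>R \<zeta>))"
    using assms by (intro continuous_on_compose2[OF holo_on_imp_continuous_on[OF assms(1)]] continuous_intros)
      (auto simp: unit_ball_def)
  then have "(\<lambda>\<zeta>. f (r *\<^sub>R \<zeta>)) \<in> borel_measurable (restrict_space borel (sphere 0 1))"
    by (rule borel_measurable_continuous_on_restrict)
  then show ?thesis by (simp add: measurable_cong_sets[OF sets_sphere_measure refl])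
qed

lemma borel_measurable_bergman:
  fixes f :: "complex^'n::finite \<Rightarrow> complex"
  assumes "holo_on f unit_ball"
  shows "f \<in> borel_measurable (bergman_measure \<alpha>)"
  using borel_measurable_continuous_on_restrict[OF holo_on_imp_continuous_on[OF assms]]
  by (simp add: measurable_cong_sets[OF sets_bergman_measure refl] unit_ball_def)

lemma hardy_orlicz_lux_le:
  assumes "f \<in> hardy_orlicz \<psi>" "r \<in> {0<..<1}"
  shows "lux_norm sphere_measure \<psi> (\<lambda>\<zeta>. f (r *\<^sub>R \<zeta>)) \<le> hardy_orlicz_norm \<psi> f"
  unfolding hardy_orlicz_norm_def using assms by (intro cSUP_upper) (auto simp: hardy_orlicz_def)

text \<open>For \<open>eval\<close>, the volume integral is bounded through
  \<open>polar_inequality\<close> by integrals over the spheres of radius r, each of which is at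
  most a constant times the Hardy norm; integration over r in (0,1) leaves the constant
  unchanged.\<close>

lemma ball_space_hardy_orlicz:
  assumes \<psi>: "orlicz_fun \<psi>"
  shows "ball_space (hardy_orlicz \<psi> :: (complex^'n::finite \<Rightarrow> complex) set) (hardy_orlicz_norm \<psi>)"
proof
  fix f g :: "complex^'n \<Rightarrow> complex"
  show "f \<in> hardy_orlicz \<psi> \<Longrightarrow> holo_on f unit_ball" by (simp add: hardy_orlicz_def)
  show "(\<lambda>z. f z - g z) \<in> hardy_orlicz \<psi>" if f: "f \<in> hardy_orlicz \<psi>" and g: "g \<in> hardy_orlicz \<psi>"
  proof -
    have "bdd_above ((\<lambda>r. lux_norm sphere_measure \<psi> (\<lambda>\<zeta>. f (r *\<^sub>R \<zeta>) - g (r *\<^sub>R \<zeta>))) ` {0<..<1})"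
    proof (rule bdd_aboveI2)
      fix r :: real assume r: "r \<in> {0<..<1}"
      have "lux_norm sphere_measure \<psi> (\<lambda>\<zeta>. f (r *\<^sub>R \<zeta>) - g (r *\<^sub>R \<zeta>))
         \<le> lux_norm sphere_measure \<psi> (\<lambda>\<zeta>. f (r *\<^sub>R \<zeta>)) + lux_norm sphere_measure \<psi> (\<lambda>\<zeta>. g (r *\<^sub>R \<zeta>))"
        using f g r by (intro orlicz_space_diff[OF \<psi>]) (auto simp: hardy_orlicz_def)
      also have "\<dots> \<le> hardy_orlicz_norm \<psi> f + hardy_orlicz_norm \<psi> g"
        using f g r by (intro add_mono hardy_orlicz_lux_le)
      finally show "lux_norm sphere_measure \<psi> (\<lambda>\<zeta>. f (r *\<^sub>R \<zeta>) - g (r *\<^sub>R \<zeta>)) \<le> hardy_orlicz_norm \<psi> f + hardy_orlicz_norm \<psi> g" .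
    qed
    with f g show ?thesis
      unfolding hardy_orlicz_def by (auto intro!: holo_on_diff orlicz_space_diff[OF \<psi>])
  qed
  show "hardy_orlicz_norm \<psi> f = hardy_orlicz_norm \<psi> g" if "\<And>z. z \<in> unit_ball \<Longrightarrow> f z = g z"
    unfolding hardy_orlicz_norm_def
    by (intro SUP_cong lux_norm_cong refl that) (auto simp: space_sphere_measure unit_ball_def)
next
  obtain K where K: "K > 0" and bd: "\<And>M (f :: complex^'n \<Rightarrow> complex) S. emeasure M (space M) = 1 \<Longrightarrow> f \<in> borel_measurable M \<Longrightarrow> S > 0 \<Longrightarrow>
       (\<And>x. x \<in> space M \<Longrightarrow> norm (f x) \<le> S) \<Longrightarrow> f \<in> orlicz_space M \<psi> \<and> lux_norm M \<psi> f \<le> K * S"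
    by (rule bounded_orlicz_space[OF \<psi>]) blast
  show "\<exists>K>0. \<forall>f S. S > 0 \<longrightarrow> holo_on f unit_ball \<longrightarrow> (\<forall>z\<in>unit_ball. norm (f z) \<le> S) \<longrightarrow>
       (f :: complex^'n \<Rightarrow> complex) \<in> hardy_orlicz \<psi> \<and> 0 \<le> hardy_orlicz_norm \<psi> f \<and> hardy_orlicz_norm \<psi> f \<le> K * S"
  proof (intro exI[of _ K] conjI[OF K] allI impI)
    fix f :: "complex^'n \<Rightarrow> complex" and S :: real
    assume S: "S > 0" and f: "holo_on f unit_ball" and le: "\<forall>z\<in>unit_ball. norm (f z) \<le> S"
    have r: "(\<lambda>\<zeta>. f (r *\<^sub>R \<zeta>)) \<in> orlicz_space sphere_measure \<psi> \<and> lux_norm sphere_measure \<psi> (\<lambda>\<zeta>. f (r *\<^sub>R \<zeta>)) \<le> K * S"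
      if "r \<in> {0<..<1}" for r
      using that le by (intro bd[OF emeasure_space_sphere_measure borel_measurable_dilate_sphere[OF f] S])
        (auto simp: space_sphere_measure unit_ball_def)
    then have fX: "f \<in> hardy_orlicz \<psi>" using f by (auto simp: hardy_orlicz_def intro!: bdd_aboveI2[of _ _ "K * S"])
    \<comment> \<open>A supremum is nonnegative as soon as one member is; the radius 1/2 is an
      arbitrary choice.\<close>
    have "0 \<le> lux_norm sphere_measure \<psi> (\<lambda>\<zeta>. f ((1/2) *\<^sub>R \<zeta>))" using r by (intro lux_norm_nonneg[OF \<psi>]) auto
    also have "\<dots> \<le> hardy_orlicz_norm \<psi> f" by (rule hardy_orlicz_lux_le[OF fX]) auto
    finally have "0 \<le> hardy_orlicz_norm \<psi> f" .
    moreover have "hardy_orlicz_norm \<psi> f \<le> K * S"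
      unfolding hardy_orlicz_norm_def using r by (intro cSUP_least) auto
    ultimately show "f \<in> hardy_orlicz \<psi> \<and> 0 \<le> hardy_orlicz_norm \<psi> f \<and> hardy_orlicz_norm \<psi> f \<le> K * S"
      using fX by blast
  qed
next
  fix s :: real assume s: "s < 1"
  obtain C where C: "C > 0" "\<And>(f :: complex^'n::finite \<Rightarrow> complex) z. holo_on f unit_ball \<Longrightarrow> z \<in> cball 0 s \<Longrightarrow>
      ennreal (norm (f z)) \<le> ennreal C * (\<integral>\<^sup>+w. ennreal (norm (f w)) * indicator (ball 0 ((1 + s) / 2)) w \<partial>lborel)"
    by (rule holo_on_eval_le_L1[OF s]) blast
  obtain K where K: "K > 0" "\<And>f :: complex^'n \<Rightarrow> complex. f \<in> orlicz_space sphere_measure \<psi> \<Longrightarrow>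
      (\<integral>\<^sup>+x. ennreal (norm (f x)) \<partial>sphere_measure) \<le> ennreal (K * lux_norm sphere_measure \<psi> f)"
    by (rule nn_integral_le_lux_norm[OF \<psi> emeasure_space_sphere_measure]) blast
  let ?B = "ball (0::complex^'n) 1"
  define V where "V = measure lborel ?B"
  have V: "emeasure lborel ?B = ennreal V"
    unfolding V_def using emeasure_lborel_ball_finite[of "0::complex^'n" 1] by (intro emeasure_eq_ennreal_measure) auto
  let ?d = "DIM(complex^'n)"
  have bound: "norm (f z) \<le> C * (2 ^ (?d + 1) * (V * K)) * hardy_orlicz_norm \<psi> f"
    if fX: "f \<in> hardy_orlicz \<psi>" and z: "z \<in> cball 0 s" for f :: "complex^'n \<Rightarrow> complex" and z
  proof -
    define N where "N = hardy_orlicz_norm \<psi> f"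
    have f: "holo_on f unit_ball" using fX by (simp add: hardy_orlicz_def)
    define F where "F w = ennreal (indicator ?B w *\<^sub>R norm (f w))" for w
    have Fm[measurable]: "F \<in> borel_measurable borel"
      unfolding F_def by (rule borel_measurable_holo_on[OF f])
    have "0 \<le> lux_norm sphere_measure \<psi> (\<lambda>\<zeta>. f ((1/2) *\<^sub>R \<zeta>))"
      using fX by (intro lux_norm_nonneg[OF \<psi>]) (auto simp: hardy_orlicz_def)
    also have "\<dots> \<le> N" unfolding N_def by (rule hardy_orlicz_lux_le[OF fX]) auto
    finally have N: "0 \<le> N" .
    have V0: "V \<ge> 0" by (simp add: V_def)
    have "(\<integral>\<^sup>+w. ennreal (norm (f w)) * indicator (ball 0 ((1 + s) / 2)) w \<partial>lborel) \<le> (\<integral>\<^sup>+w. F w * indicator ?B w \<partial>lborel)"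
      using s by (intro nn_integral_mono) (auto simp: F_def indicator_def)
    also have "\<dots> \<le> 2 ^ (?d + 1) * (\<integral>\<^sup>+r. (\<integral>\<^sup>+z. F (r *\<^sub>R sgn z) * indicator ?B z \<partial>lborel) * indicator {0<..<1} r \<partial>lborel)"
      by (rule polar_inequality) measurable
    also have "\<dots> \<le> 2 ^ (?d + 1) * (\<integral>\<^sup>+r. ennreal (V * K * N) * indicator {0<..<1::real} r \<partial>lborel)"
    proof (intro mult_left_mono nn_integral_mono)
      fix r :: real
      show "(\<integral>\<^sup>+z. F (r *\<^sub>R sgn z) * indicator ?B z \<partial>lborel) * indicator {0<..<1} r \<le> ennreal (V * K * N) * indicator {0<..<1} r"
      proof (cases "r \<in> {0<..<1}")
        case r: True
        have [measurable]: "(\<lambda>\<zeta>. F (r *\<^sub>R \<zeta>)) \<in> borel_measurable borel" by measurable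
        have "(\<integral>\<^sup>+\<zeta>. F (r *\<^sub>R \<zeta>) \<partial>sphere_measure) = (\<integral>\<^sup>+z. F (r *\<^sub>R sgn z) * indicator ?B z \<partial>lborel) / ennreal V"
          by (simp add: nn_integral_sphere_measure V)
        then have "(\<integral>\<^sup>+z. F (r *\<^sub>R sgn z) * indicator ?B z \<partial>lborel) = (\<integral>\<^sup>+\<zeta>. F (r *\<^sub>R \<zeta>) \<partial>sphere_measure) * ennreal V"
          using unit_ball_emeasure_pos_finite[where 'a = "complex^'n"] unfolding V
          by (simp add: ennreal_divide_times ennreal_mult_divide_eq)
        also have "(\<integral>\<^sup>+\<zeta>. F (r *\<^sub>R \<zeta>) \<partial>sphere_measure) = (\<integral>\<^sup>+\<zeta>. ennreal (norm (f (r *\<^sub>R \<zeta>))) \<partial>sphere_measure)"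
          using r by (intro nn_integral_cong) (auto simp: F_def space_sphere_measure)
        also have "\<dots> \<le> ennreal (K * lux_norm sphere_measure \<psi> (\<lambda>\<zeta>. f (r *\<^sub>R \<zeta>)))"
          using fX r by (intro K(2)) (auto simp: hardy_orlicz_def)
        also have "\<dots> \<le> ennreal (K * N)"
          unfolding N_def using K(1) hardy_orlicz_lux_le[OF fX r] by (intro ennreal_leI mult_left_mono) auto
        finally have "(\<integral>\<^sup>+z. F (r *\<^sub>R sgn z) * indicator ?B z \<partial>lborel) \<le> ennreal (K * N) * ennreal V"
          by (simp add: mult_right_mono)
        also have "\<dots> = ennreal (V * K * N)" using K(1) N V0 by (simp add: mult_ac flip: ennreal_mult'')
        finally show ?thesis using r by simp
      qed simp
    qed simp
    also have "\<dots> = ennreal (2 ^ (?d + 1)) * ennreal (V * K * N)"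
      by (simp add: nn_integral_cmult_indicator del: power_Suc flip: ennreal_power)
    also have "\<dots> = ennreal (2 ^ (?d + 1) * (V * K * N))" by (simp add: ennreal_mult')
    finally have "(\<integral>\<^sup>+w. ennreal (norm (f w)) * indicator (ball 0 ((1 + s) / 2)) w \<partial>lborel) \<le> \<dots>" .
    then have "ennreal C * (\<integral>\<^sup>+w. ennreal (norm (f w)) * indicator (ball 0 ((1 + s) / 2)) w \<partial>lborel)
        \<le> ennreal C * ennreal (2 ^ (?d + 1) * (V * K * N))" by (rule mult_left_mono) simp
    with C(2)[OF f z] have "ennreal (norm (f z)) \<le> ennreal C * ennreal (2 ^ (?d + 1) * (V * K * N))" by (rule order_trans)
    also have "\<dots> = ennreal (C * (2 ^ (?d + 1) * (V * K * N)))" using C(1) by (simp add: ennreal_mult')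
    finally show ?thesis
      using C(1) K(1) N V0 by (subst (asm) ennreal_le_iff) (auto simp: N_def mult_ac)
  qed
  show "\<exists>C\<ge>0. \<forall>f\<in>hardy_orlicz \<psi>. \<forall>z\<in>cball 0 s. norm ((f :: complex^'n \<Rightarrow> complex) z) \<le> C * hardy_orlicz_norm \<psi> f"
    using bound C(1) K(1) by (intro exI[of _ "C * (2 ^ (?d + 1) * (V * K))"]) (auto simp: V_def)
qed

text \<open>The minimum merges the two signs of \<alpha>: for \<alpha> nonnegative the weight
  decreases towards the sphere, for \<alpha> negative it is at least 1 everywhere in the
  ball.\<close>

lemma bweight_ge:
  assumes "norm z \<le> s" "0 \<le> s" "s < 1"
  shows "bweight \<alpha> z \<ge> min 1 ((1 - s\<^sup>2) powr \<alpha>)"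
proof -
  have "(norm z)\<^sup>2 \<le> s\<^sup>2" "s\<^sup>2 < 1" using assms by (auto intro: power_mono simp: power_less_one_iff)
  then have *: "1 - s\<^sup>2 \<le> 1 - (norm z)\<^sup>2" "0 < 1 - s\<^sup>2" "1 - (norm z)\<^sup>2 \<le> 1" by auto
  show ?thesis
  proof (cases "\<alpha> \<ge> 0")
    case True
    then show ?thesis unfolding bweight_def using * by (intro min.coboundedI2 powr_mono2) auto
  next
    case False
    have "1 = (1 - (norm z)\<^sup>2) powr 0" using * by simp
    also have "\<dots> \<le> (1 - (norm z)\<^sup>2) powr \<alpha>" using * False by (intro powr_mono') auto
    finally show ?thesis unfolding bweight_def by simp
  qed
qed

lemma ball_space_bergman_orlicz:
  assumes \<psi>: "orlicz_fun \<psi>" and \<alpha>: "\<alpha> > -1"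
  shows "ball_space (bergman_orlicz \<psi> \<alpha> :: (complex^'n::finite \<Rightarrow> complex) set) (bergman_orlicz_norm \<psi> \<alpha>)"
proof
  fix f g :: "complex^'n \<Rightarrow> complex"
  show "f \<in> bergman_orlicz \<psi> \<alpha> \<Longrightarrow> holo_on f unit_ball" by (simp add: bergman_orlicz_def)
  show "f \<in> bergman_orlicz \<psi> \<alpha> \<Longrightarrow> g \<in> bergman_orlicz \<psi> \<alpha> \<Longrightarrow> (\<lambda>z. f z - g z) \<in> bergman_orlicz \<psi> \<alpha>"
    by (auto simp: bergman_orlicz_def intro!: holo_on_diff orlicz_space_diff[OF \<psi>])
  show "bergman_orlicz_norm \<psi> \<alpha> f = bergman_orlicz_norm \<psi> \<alpha> g" if "\<And>z. z \<in> unit_ball \<Longrightarrow> f z = g z"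
    unfolding bergman_orlicz_norm_def
    by (intro lux_norm_cong that) (auto simp: space_bergman_measure unit_ball_def)
next
  obtain K where K: "K > 0" and bd: "\<And>M (f :: complex^'n \<Rightarrow> complex) S. emeasure M (space M) = 1 \<Longrightarrow> f \<in> borel_measurable M \<Longrightarrow> S > 0 \<Longrightarrow>
       (\<And>x. x \<in> space M \<Longrightarrow> norm (f x) \<le> S) \<Longrightarrow> f \<in> orlicz_space M \<psi> \<and> lux_norm M \<psi> f \<le> K * S"
    by (rule bounded_orlicz_space[OF \<psi>]) blast
  show "\<exists>K>0. \<forall>f S. S > 0 \<longrightarrow> holo_on f unit_ball \<longrightarrow> (\<forall>z\<in>unit_ball. norm (f z) \<le> S) \<longrightarrow>
       (f :: complex^'n \<Rightarrow> complex) \<in> bergman_orlicz \<psi> \<alpha> \<and> 0 \<le> bergman_orlicz_norm \<psi> \<alpha> f \<and> bergman_orlicz_norm \<psi> \<alpha> f \<le> K * S"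
  proof (intro exI[of _ K] conjI[OF K] allI impI)
    fix f :: "complex^'n \<Rightarrow> complex" and S :: real
    assume S: "S > 0" and f: "holo_on f unit_ball" and le: "\<forall>z\<in>unit_ball. norm (f z) \<le> S"
    have "f \<in> orlicz_space (bergman_measure \<alpha>) \<psi> \<and> lux_norm (bergman_measure \<alpha>) \<psi> f \<le> K * S"
      using le by (intro bd[OF emeasure_space_bergman_measure[OF \<alpha>] borel_measurable_bergman[OF f] S])
        (auto simp: space_bergman_measure unit_ball_def)
    then show "f \<in> bergman_orlicz \<psi> \<alpha> \<and> 0 \<le> bergman_orlicz_norm \<psi> \<alpha> f \<and> bergman_orlicz_norm \<psi> \<alpha> f \<le> K * S"
      using f lux_norm_nonneg[OF \<psi>] by (auto simp: bergman_orlicz_def bergman_orlicz_norm_def)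
  qed
next
  fix s :: real assume s: "s < 1"
  obtain C where C: "C > 0" "\<And>(f :: complex^'n::finite \<Rightarrow> complex) z. holo_on f unit_ball \<Longrightarrow> z \<in> cball 0 s \<Longrightarrow>
      ennreal (norm (f z)) \<le> ennreal C * (\<integral>\<^sup>+w. ennreal (norm (f w)) * indicator (ball 0 ((1 + s) / 2)) w \<partial>lborel)"
    by (rule holo_on_eval_le_L1[OF s]) blast
  obtain K where K: "K > 0" "\<And>f :: complex^'n \<Rightarrow> complex. f \<in> orlicz_space (bergman_measure \<alpha>) \<psi> \<Longrightarrow>
      (\<integral>\<^sup>+x. ennreal (norm (f x)) \<partial>bergman_measure \<alpha>) \<le> ennreal (K * lux_norm (bergman_measure \<alpha>) \<psi> f)"
    by (rule nn_integral_le_lux_norm[OF \<psi> emeasure_space_bergman_measure[OF \<alpha>]]) blast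
  let ?B = "ball (0::complex^'n) 1"
  define W where "W = enn2real (\<integral>\<^sup>+ w. ennreal (bweight \<alpha> w) * indicator ?B w \<partial>lborel)"
  have W: "(\<integral>\<^sup>+ w. ennreal (bweight \<alpha> w) * indicator ?B w \<partial>lborel) = ennreal W"
    unfolding W_def using bweight_mass[OF \<alpha>, where 'n = 'n] by (simp add: less_top)
  have W0: "ennreal W \<noteq> 0" "W \<ge> 0" unfolding W[symmetric] using bweight_mass[OF \<alpha>, where 'n = 'n] by (auto simp: W_def)
  \<comment> \<open>\<open>s\<close> may be any real below 1, so (1 + s) / 2 can be negative, but
    \<open>bweight_ge\<close> wants a nonnegative radius.\<close>
  define s' where "s' = max 0 ((1 + s) / 2)"
  define c where "c = min 1 ((1 - s'\<^sup>2) powr \<alpha>)"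
  have s': "0 \<le> s'" "s' < 1" using s by (auto simp: s'_def)
  then have "s'\<^sup>2 < 1" by (simp add: power_less_one_iff)
  then have c: "c > 0" by (simp add: c_def)
  have bound: "norm (f z) \<le> C * (1 / c * (K * W)) * bergman_orlicz_norm \<psi> \<alpha> f"
    if fX: "f \<in> bergman_orlicz \<psi> \<alpha>" and z: "z \<in> cball 0 s" for f :: "complex^'n \<Rightarrow> complex" and z
  proof -
    define N where "N = bergman_orlicz_norm \<psi> \<alpha> f"
    have f: "holo_on f unit_ball" and fo: "f \<in> orlicz_space (bergman_measure \<alpha>) \<psi>" using fX by (auto simp: bergman_orlicz_def)
    have N: "N \<ge> 0" using lux_norm_nonneg[OF \<psi> fo] by (simp add: N_def bergman_orlicz_norm_def)
    define F where "F w = ennreal (indicator ?B w *\<^sub>R norm (f w))" for w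
    have Fm[measurable]: "F \<in> borel_measurable borel"
      unfolding F_def by (rule borel_measurable_holo_on[OF f])
    have "(\<integral>\<^sup>+w. ennreal (norm (f w)) * indicator (ball 0 ((1 + s) / 2)) w \<partial>lborel)
       \<le> (\<integral>\<^sup>+w. ennreal (1 / c) * (ennreal (bweight \<alpha> w) * F w * indicator ?B w) \<partial>lborel)"
    proof (rule nn_integral_mono)
      fix w :: "complex^'n"
      show "ennreal (norm (f w)) * indicator (ball 0 ((1 + s) / 2)) w
         \<le> ennreal (1 / c) * (ennreal (bweight \<alpha> w) * F w * indicator ?B w)"
      proof (cases "w \<in> ball 0 ((1 + s) / 2)")
        case True
        then have w: "norm w \<le> s'" "w \<in> ?B" unfolding s'_def using s by (simp_all add: le_max_iff_disj)
        have "c \<le> bweight \<alpha> w" unfolding c_def by (rule bweight_ge[OF w(1) s'])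
        then have "1 * norm (f w) \<le> (1 / c * bweight \<alpha> w) * norm (f w)"
          using c by (intro mult_right_mono) (auto simp: field_simps)
        then have "ennreal (norm (f w)) \<le> ennreal (1 / c * bweight \<alpha> w * norm (f w))" by (simp add: ennreal_leI)
        also have "\<dots> = ennreal (1 / c) * (ennreal (bweight \<alpha> w) * ennreal (norm (f w)))"
          using c by (simp add: ennreal_mult' ennreal_mult'' bweight_def mult.assoc del: times_divide_eq_left)
        finally show ?thesis using True w by (simp add: F_def)
      qed simp
    qed
    also have "\<dots> = ennreal (1 / c) * (\<integral>\<^sup>+w. ennreal (bweight \<alpha> w) * F w * indicator ?B w \<partial>lborel)"
      by (rule nn_integral_cmult) measurable
    also have "(\<integral>\<^sup>+w. ennreal (bweight \<alpha> w) * F w * indicator ?B w \<partial>lborel) = (\<integral>\<^sup>+z. F z \<partial>bergman_measure \<alpha>) * ennreal W"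
      using nn_integral_bergman_measure[OF Fm, of \<alpha>] W0 unfolding W
      by (simp add: ennreal_divide_times ennreal_mult_divide_eq)
    also have "(\<integral>\<^sup>+z. F z \<partial>bergman_measure \<alpha>) = (\<integral>\<^sup>+z. ennreal (norm (f z)) \<partial>bergman_measure \<alpha>)"
      by (intro nn_integral_cong) (auto simp: F_def space_bergman_measure)
    also have "ennreal (1 / c) * (\<dots> * ennreal W) \<le> ennreal (1 / c) * (ennreal (K * N) * ennreal W)"
      unfolding N_def bergman_orlicz_norm_def by (intro mult_left_mono mult_right_mono K(2) fo) auto
    also have "\<dots> = ennreal (1 / c * (K * N * W))"
      using c K(1) N W0 by (simp add: ennreal_mult' ennreal_mult'' del: times_divide_eq_left)
    finally have "ennreal C * (\<integral>\<^sup>+w. ennreal (norm (f w)) * indicator (ball 0 ((1 + s) / 2)) w \<partial>lborel)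
        \<le> ennreal C * ennreal (1 / c * (K * N * W))" by (rule mult_left_mono) simp
    with C(2)[OF f z] have "ennreal (norm (f z)) \<le> ennreal C * ennreal (1 / c * (K * N * W))" by (rule order_trans)
    also have "\<dots> = ennreal (C * (1 / c * (K * N * W)))" using C(1) by (intro ennreal_mult'[symmetric]) simp
    finally show ?thesis
      using C(1) c K(1) N W0 by (subst (asm) ennreal_le_iff) (auto simp: N_def mult_ac)
  qed
  show "\<exists>C\<ge>0. \<forall>f\<in>bergman_orlicz \<psi> \<alpha>. \<forall>z\<in>cball 0 s. norm ((f :: complex^'n \<Rightarrow> complex) z) \<le> C * bergman_orlicz_norm \<psi> \<alpha> f"
    using bound C(1) K(1) c W0 by (intro exI[of _ "C * (1 / c * (K * W))"]) auto
qed

lemma ball_space_hinf: "ball_space (hinf :: (complex^'n::finite \<Rightarrow> complex) set) hinf_norm"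
proof
  have b0: "(0::complex^'n) \<in> unit_ball" by (simp add: unit_ball_def)
  have upper: "norm (f z) \<le> hinf_norm f" if f: "f \<in> hinf" and z: "z \<in> unit_ball" for f :: "complex^'n \<Rightarrow> complex" and z
  proof -
    obtain B where "\<And>x. x \<in> unit_ball \<Longrightarrow> norm (f x) \<le> B" using f unfolding hinf_def bounded_iff by blast
    then have "bdd_above ((\<lambda>z. norm (f z)) ` unit_ball)" by (rule bdd_aboveI2)
    with z show ?thesis unfolding hinf_norm_def by (intro cSUP_upper)
  qed
  fix f g :: "complex^'n \<Rightarrow> complex"
  show "f \<in> hinf \<Longrightarrow> holo_on f unit_ball" by (simp add: hinf_def)
  show "f \<in> hinf \<Longrightarrow> g \<in> hinf \<Longrightarrow> (\<lambda>z. f z - g z) \<in> hinf"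
    by (auto simp: hinf_def intro!: holo_on_diff bounded_minus_comp)
  show "hinf_norm f = hinf_norm g" if "\<And>z. z \<in> unit_ball \<Longrightarrow> f z = g z"
    unfolding hinf_norm_def using that by (intro SUP_cong) auto
  show "\<exists>C\<ge>0. \<forall>f\<in>hinf. \<forall>z\<in>cball 0 s. norm ((f :: complex^'n \<Rightarrow> complex) z) \<le> C * hinf_norm f" if "s < 1" for s
    using upper that by (intro exI[of _ 1]) (auto simp: unit_ball_def)
  show "\<exists>K>0. \<forall>f S. S > 0 \<longrightarrow> holo_on f unit_ball \<longrightarrow> (\<forall>z\<in>unit_ball. norm (f z) \<le> S) \<longrightarrow>
       (f :: complex^'n \<Rightarrow> complex) \<in> hinf \<and> 0 \<le> hinf_norm f \<and> hinf_norm f \<le> K * S"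
  proof (intro exI[of _ 1] conjI allI impI)
    fix f :: "complex^'n \<Rightarrow> complex" and S :: real
    assume "holo_on f unit_ball" and le: "\<forall>z\<in>unit_ball. norm (f z) \<le> S"
    then show f: "f \<in> hinf" by (auto simp: hinf_def bounded_iff)
    show "0 \<le> hinf_norm f" using upper[OF f b0] norm_ge_zero order_trans by blast
    show "hinf_norm f \<le> 1 * S" unfolding hinf_norm_def using le b0 by (intro cSUP_least) auto
  qed simp
qed

section \<open>Peak functions\<close>

text \<open>The conjugate sits on the second argument, which makes the product complex linear, hence
  holomorphic, in the first.\<close>

definition hermitian_prod :: "complex^'n::finite \<Rightarrow> complex^'n \<Rightarrow> complex" where
  "hermitian_prod z u = (\<Sum>i\<in>UNIV. z $ i * cnj (u $ i))"

lemma Re_hermitian_prod: "Re (hermitian_prod z u) = z \<bullet> u"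
  by (simp add: hermitian_prod_def inner_vec_def inner_complex_def)

lemma hermitian_prod_scale: "hermitian_prod (c *s z) u = c * hermitian_prod z u"
  by (simp add: hermitian_prod_def sum_distrib_left mult.assoc)

lemma hermitian_prod_scaleR: "hermitian_prod (r *\<^sub>R z) u = of_real r * hermitian_prod z u"
  by (simp add: hermitian_prod_def sum_distrib_left scaleR_conv_of_real[where 'a = complex] mult.assoc)

text \<open>Rotating \<open>z\<close> by a unimodular \<open>c\<close> makes the product real and
  equal to its modulus; the real Cauchy-Schwarz inequality then applies.\<close>

lemma norm_hermitian_prod_le: "norm (hermitian_prod z u) \<le> norm z * norm u"
proof (cases "hermitian_prod z u = 0")
  case False
  define a where "a = hermitian_prod z u"
  define c where "c = cnj a / of_real (norm a)"
  have a: "a \<noteq> 0" using False by (simp add: a_def)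
  have "c * a = of_real (norm a)"
    using a by (simp add: c_def field_simps power2_eq_square flip: complex_norm_square)
  then have "norm a = (c *s z) \<bullet> u"
    by (metis Re_complex_of_real Re_hermitian_prod a_def hermitian_prod_scale)
  also have "\<dots> \<le> norm (c *s z) * norm u" by (rule norm_cauchy_schwarz)
  also have "norm (c *s z) = norm z"
    using a by (simp add: norm_vector_scalar_mult c_def norm_divide)
  finally show ?thesis by (simp add: a_def)
qed simp

definition peak :: "complex^'n::finite \<Rightarrow> complex^'n \<Rightarrow> complex" where
  "peak u z = (1 + hermitian_prod z u) / 2"

text \<open>The formula comes from expanding |1 + r a|^2 = 1 + 2 r Re a + r^2 |a|^2 with |a| at most
  1, which is at most 2 + 2 max 0 (Re a) for every r in [0,1]; division by 4 and a square root give
  the expression.\<close>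

definition peak_bound :: "complex^'n::finite \<Rightarrow> complex^'n \<Rightarrow> real" where
  "peak_bound u z = sqrt ((1 + max 0 (z \<bullet> u)) / 2)"

lemma holo_on_peak:
  fixes u :: "complex^'n::finite"
  shows "holo_on (peak u) S"
proof (rule holo_onI)
  fix z :: "complex^'n"
  have "linear (\<lambda>z. hermitian_prod z u)"
    by (rule linearI) (simp_all add: hermitian_prod_def sum.distrib distrib_right scaleR_sum_right)
  then have "((\<lambda>z. hermitian_prod z u) has_derivative (\<lambda>v. hermitian_prod v u)) (at z)"
    by (intro bounded_linear_imp_has_derivative linear_linear[THEN iffD2])
  then show "(peak u has_derivative (\<lambda>v. hermitian_prod v u / 2)) (at z)"
    unfolding peak_def[abs_def] by (auto intro!: derivative_eq_intros)
qed (simp add: hermitian_prod_scale)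

lemma holo_on_field_compose:
  assumes f: "holo_on f S" and g: "\<And>w. (g has_field_derivative g' w) (at w)"
  shows "holo_on (\<lambda>z. g (f z)) S"
proof (rule holo_onI)
  fix z assume z: "z \<in> S"
  have "(g \<circ> f has_derivative (*) (g' (f z)) \<circ> frechet_derivative f (at z)) (at z)"
    using g[of "f z"] by (intro diff_chain_at holo_on_frechet(1)[OF f z]) (simp add: has_field_derivative_def)
  then show "((\<lambda>z. g (f z)) has_derivative (\<lambda>v. g' (f z) * frechet_derivative f (at z) v)) (at z)"
    by (simp add: o_def)
qed (simp add: holo_on_frechet(2)[OF f])

lemma holo_on_peak_power: "holo_on (\<lambda>z. c * peak u z ^ m) S"
  by (rule holo_on_field_compose[OF holo_on_peak, where g = "\<lambda>w. c * w ^ m" and g' = "\<lambda>w. c * (of_nat m * w ^ (m - 1))"])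
    (auto intro!: derivative_eq_intros)

lemma norm_peak_less_1:
  assumes "norm u = 1" "norm z < 1"
  shows "norm (peak u z) < 1"
proof -
  have "norm (1 + hermitian_prod z u) \<le> 1 + norm z"
    using norm_triangle_ineq[of 1 "hermitian_prod z u"] norm_hermitian_prod_le[of z u] assms by simp
  then show ?thesis using assms by (simp add: peak_def norm_divide)
qed

lemma peak_self:
  assumes "norm u = 1" shows "peak u u = 1"
proof -
  have "Re (hermitian_prod u u) = 1" using assms by (simp add: Re_hermitian_prod dot_square_norm)
  moreover have "(norm (hermitian_prod u u))\<^sup>2 \<le> 1\<^sup>2"
    using norm_hermitian_prod_le[of u u] assms by (intro power_mono) auto
  ultimately have "hermitian_prod u u = 1" by (simp add: cmod_power2 complex_eq_iff)
  then show ?thesis by (simp add: peak_def)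
qed

text \<open>The modulus of the peak function is not monotone along radii, so its powers on the spheres of
  radius \<open>r\<close> are all compared with one majorant on the unit sphere.\<close>

lemma norm_peak_le:
  assumes "norm u = 1" "norm z \<le> 1" "0 \<le> r" "r \<le> 1"
  shows "norm (peak u (r *\<^sub>R z)) \<le> peak_bound u z"
proof -
  define a where "a = hermitian_prod z u"
  have "norm a \<le> 1" using norm_hermitian_prod_le[of z u] assms by (simp add: a_def)
  then have "(norm a)\<^sup>2 \<le> 1" by (simp add: power_le_one)
  moreover have "r\<^sup>2 \<le> 1" using assms by (simp add: power_le_one)
  ultimately have ra: "r\<^sup>2 * (norm a)\<^sup>2 \<le> 1 * 1" by (intro mult_mono) auto
  have "(norm (1 + of_real r * a))\<^sup>2 = 1 + 2 * (r * Re a) + r\<^sup>2 * (norm a)\<^sup>2"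
    by (simp only: cmod_power2) (simp add: power2_eq_square algebra_simps)
  also have "r * Re a \<le> max 0 (Re a)"
    using assms mult_right_mono[of r 1 "Re a"] mult_nonneg_nonpos[of r "Re a"] by (cases "Re a \<ge> 0") auto
  finally have "(norm (1 + of_real r * a))\<^sup>2 \<le> 2 + 2 * max 0 (Re a)" using ra by simp
  then have "(norm (peak u (r *\<^sub>R z)))\<^sup>2 \<le> (1 + max 0 (z \<bullet> u)) / 2"
    by (simp add: peak_def hermitian_prod_scaleR a_def Re_hermitian_prod norm_divide power_divide)
  then show ?thesis unfolding peak_bound_def by (rule real_le_rsqrt)
qed

lemma peak_bound_range:
  assumes "norm u = 1" "norm z \<le> 1"
  shows "0 \<le> peak_bound u z" "peak_bound u z \<le> 1" "z \<noteq> u \<Longrightarrow> peak_bound u z < 1"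
proof -
  have "z \<bullet> u \<le> 1" using norm_cauchy_schwarz[of z u] assms by simp
  then show "0 \<le> peak_bound u z" "peak_bound u z \<le> 1" by (auto simp: peak_bound_def)
  assume "z \<noteq> u"
  have "(norm z)\<^sup>2 \<le> 1" using assms by (simp add: power_le_one)
  moreover have "(norm (z - u))\<^sup>2 > 0" using \<open>z \<noteq> u\<close> by simp
  moreover have "(norm (z - u))\<^sup>2 = (norm z)\<^sup>2 - 2 * (z \<bullet> u) + (norm u)\<^sup>2"
    by (simp add: power2_norm_eq_inner inner_diff algebra_simps inner_commute)
  ultimately have "z \<bullet> u < 1" using assms by simp
  then show "peak_bound u z < 1" by (auto simp: peak_bound_def)
qed

lemma borel_measurable_peak_bound [measurable]: "peak_bound u \<in> borel_measurable borel"
  unfolding peak_bound_def[abs_def] by measurable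

text \<open>Dominated convergence with majorant 1: on the closed ball \<open>peak_bound u\<close> is
  less than 1 except at u, which is a null set. The integrals are delivered as reals because
  \<open>fast_growing_orlicz_fun\<close> expects a real sequence.\<close>

lemma peak_bound_power_integrals:
  assumes M: "emeasure M (space M) = 1" "space M \<subseteq> cball 0 1" "peak_bound u \<in> borel_measurable M"
    and u: "norm u = 1" and AE: "AE x in M. x \<noteq> u"
  obtains I where "I \<longlonglongrightarrow> 0" "\<And>m. (\<integral>\<^sup>+x. ennreal (peak_bound u x ^ m) \<partial>M) = ennreal (I m)"
proof -
  note [measurable] = M(3)
  define J where "J m = (\<integral>\<^sup>+x. ennreal (peak_bound u x ^ m) \<partial>M)" for m
  have range: "0 \<le> peak_bound u x" "peak_bound u x \<le> 1" if "x \<in> space M" for x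
    using peak_bound_range[OF u, of x] that M(2) by auto
  have "J m \<le> (\<integral>\<^sup>+x. 1 \<partial>M)" for m
    unfolding J_def using range by (intro nn_integral_mono) (auto simp: ennreal_le_1 power_le_one)
  then have J1: "J m \<le> 1" for m by (simp add: M(1))
  have "J \<longlonglongrightarrow> (\<integral>\<^sup>+x. 0 \<partial>M)"
    unfolding J_def
  proof (rule nn_integral_dominated_convergence[where w = "\<lambda>_. 1"])
    show "AE x in M. ennreal (peak_bound u x ^ m) \<le> 1" for m
      using range by (intro AE_I2) (auto simp: ennreal_le_1 power_le_one)
    show "(\<integral>\<^sup>+x. 1 \<partial>M) < \<infinity>" by (simp add: M(1))
    show "AE x in M. (\<lambda>m. ennreal (peak_bound u x ^ m)) \<longlonglongrightarrow> 0"
      using AE AE_space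
    proof eventually_elim
      case (elim x)
      then have "norm (peak_bound u x) < 1"
        using peak_bound_range(3)[OF u, of x] range[of x] M(2) by auto
      then have "(\<lambda>m. peak_bound u x ^ m) \<longlonglongrightarrow> 0" by (rule LIMSEQ_power_zero)
      then have "(\<lambda>m. ennreal (peak_bound u x ^ m)) \<longlonglongrightarrow> ennreal 0" by (rule tendsto_ennrealI)
      then show ?case by simp
    qed
  qed measurable
  then have "J \<longlonglongrightarrow> 0" by simp
  then have "(\<lambda>m. enn2real (J m)) \<longlonglongrightarrow> enn2real 0" by (intro tendsto_enn2real) auto
  then have "(\<lambda>m. enn2real (J m)) \<longlonglongrightarrow> 0" by simp
  moreover have "(\<integral>\<^sup>+x. ennreal (peak_bound u x ^ m) \<partial>M) = ennreal (enn2real (J m))" for m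
    using le_less_trans[OF J1[of m] ennreal_one_less_top] by (simp add: J_def)
  ultimately show thesis by (rule that)
qed

text \<open>Since the power p of \<open>peak_bound\<close> lies in [0,1], convexity gives
  \<open>\<psi> (p * A) \<le> p * \<psi> A\<close>. Thus \<psi> enters through the single value
  \<open>\<psi> A\<close>, and the modular at scale 1 is at most
  \<open>\<psi> A * I\<close>.\<close>

lemma lux_norm_peak_power_le_1:
  fixes f :: "complex^'n::finite \<Rightarrow> complex"
  assumes \<psi>: "orlicz_fun \<psi>" and A: "A \<ge> 0" and u: "norm u = 1"
    and M: "space M \<subseteq> cball 0 1" "peak_bound u \<in> borel_measurable M"
    and I: "(\<integral>\<^sup>+x. ennreal (peak_bound u x ^ m) \<partial>M) = ennreal I" "\<psi> A * I \<le> 1"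
    and f: "\<And>x. x \<in> space M \<Longrightarrow> norm (f x) \<le> A * peak_bound u x ^ m"
  shows "lux_norm M \<psi> f \<le> 1"
proof (rule lux_norm_le)
  note [measurable] = M(2)
  have \<psi>A: "\<psi> A \<ge> 0" using orlicz_fun_nonneg[OF \<psi> A] .
  have "modular M \<psi> f 1 \<le> (\<integral>\<^sup>+x. ennreal (\<psi> A) * ennreal (peak_bound u x ^ m) \<partial>M)"
    unfolding modular_def
  proof (rule nn_integral_mono)
    fix x assume x: "x \<in> space M"
    then have r: "0 \<le> peak_bound u x" "peak_bound u x \<le> 1"
      using peak_bound_range[OF u, of x] M by auto
    have "\<psi> (norm (f x) / 1) \<le> \<psi> (peak_bound u x ^ m * A)"
      using f[OF x] by (intro orlicz_fun_mono[OF \<psi>]) (auto simp: mult.commute)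
    also have "\<dots> \<le> peak_bound u x ^ m * \<psi> A"
      using r A by (intro orlicz_fun_scale[OF \<psi>]) (auto simp: power_le_one)
    finally show "ennreal (\<psi> (norm (f x) / 1)) \<le> ennreal (\<psi> A) * ennreal (peak_bound u x ^ m)"
      using \<psi>A r by (simp add: ennreal_leI mult.commute flip: ennreal_mult')
  qed
  also have "\<dots> = ennreal (\<psi> A) * ennreal I"
    unfolding I(1)[symmetric] by (rule nn_integral_cmult) measurable
  also have "\<dots> = ennreal (\<psi> A * I)" using \<psi>A by (simp add: ennreal_mult')
  also have "\<dots> \<le> 1" using I(2) by (simp add: ennreal_le_1)
  finally show "modular M \<psi> f 1 \<le> 1" .
qed simp

text \<open>u is a limit of image points whose norms tend to 1. For each fixed m, continuity of
  \<open>peak u\<close> at u, where its value is 1, makes the m-th powers along this sequence tend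
  to 1; so the same u serves every m.\<close>

lemma boundary_point_of_image:
  fixes \<phi> :: "complex^'n::finite \<Rightarrow> complex^'n"
  assumes \<phi>: "\<phi> ` unit_ball \<subseteq> unit_ball" and sup: "\<not> (SUP z\<in>unit_ball. norm (\<phi> z)) < 1"
  obtains u where "norm u = 1" "\<And>m. \<exists>z\<in>unit_ball. norm (peak u (\<phi> z) ^ m) > 1 / 2"
proof -
  have "\<exists>z\<in>unit_ball. norm (\<phi> z) > 1 - inverse (real (Suc k))" for k
  proof (rule ccontr)
    assume "\<not> (\<exists>z\<in>unit_ball. norm (\<phi> z) > 1 - inverse (real (Suc k)))"
    then have "(SUP z\<in>unit_ball. norm (\<phi> z)) \<le> 1 - inverse (real (Suc k))"
      by (intro cSUP_least) (auto simp: unit_ball_def not_less)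
    also have "\<dots> < 1" by simp
    finally show False using sup by simp
  qed
  then obtain z where z: "\<And>k. z k \<in> unit_ball" "\<And>k. norm (\<phi> (z k)) > 1 - inverse (real (Suc k))" by metis
  have le: "norm (\<phi> (z k)) \<le> 1" for k
  proof -
    have "\<phi> (z k) \<in> unit_ball" using z(1) \<phi> by blast
    then show ?thesis by (simp add: unit_ball_def)
  qed
  obtain u r where r: "strict_mono r" and lim: "((\<lambda>k. \<phi> (z k)) \<circ> r) \<longlonglongrightarrow> u"
    by (rule seq_compactE[OF compact_imp_seq_compact[OF compact_cball], of "\<lambda>k. \<phi> (z k)" 0 1])
      (use le in auto)
  have "(\<lambda>k. norm (\<phi> (z k))) \<longlonglongrightarrow> 1"
  proof (rule tendsto_sandwich[where h = "\<lambda>_. 1"])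
    show "(\<lambda>k. 1 - inverse (real (Suc k))) \<longlonglongrightarrow> 1"
      using tendsto_diff[OF tendsto_const LIMSEQ_inverse_real_of_nat, of "1::real"] by simp
  qed (use z(2) le in \<open>auto intro!: always_eventually simp: less_imp_le\<close>)
  from LIMSEQ_subseq_LIMSEQ[OF this r] have "norm u = 1"
    using LIMSEQ_unique[OF tendsto_norm[OF lim]] by (simp add: o_def)
  moreover have "\<exists>z\<in>unit_ball. norm (peak u (\<phi> z) ^ m) > 1 / 2" for m
  proof -
    have "continuous_on UNIV (peak u)" by (rule holo_on_imp_continuous_on[OF holo_on_peak])
    then have "isCont (peak u) u" by (simp add: continuous_on_eq_continuous_at)
    then have "(\<lambda>k. peak u (((\<lambda>k. \<phi> (z k)) \<circ> r) k)) \<longlonglongrightarrow> peak u u" using lim by (rule isCont_tendsto_compose)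
    then have "(\<lambda>k. norm (peak u (\<phi> (z (r k))) ^ m)) \<longlonglongrightarrow> norm (1 ^ m :: complex)"
      using peak_self[OF \<open>norm u = 1\<close>] by (intro tendsto_intros) (simp add: o_def)
    then have "eventually (\<lambda>k. norm (peak u (\<phi> (z (r k))) ^ m) > 1 / 2) sequentially"
      by (rule order_tendstoD) simp
    then show ?thesis using z(1) by (auto simp: eventually_sequentially)
  qed
  ultimately show thesis by (rule that)
qed

text \<open>\<open>I m\<close> and \<open>\<epsilon> m\<close> stand for the integral of the majorant of \<open>|peak u| ^ m\<close> and for the measure of the
  set where \<open>|peak u \<circ> \<phi>| ^ m > 1/2\<close>.\<close>

lemma exists_orlicz_not_compact_comp:
  fixes \<phi> :: "complex^'n::finite \<Rightarrow> complex^'n"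
  assumes space: "\<And>\<psi>. orlicz_fun \<psi> \<Longrightarrow> ball_space (X \<psi>) (nrm \<psi>)"
    and \<phi>: "\<phi> ` unit_ball \<subseteq> unit_ball" and u: "norm u = 1"
    and I: "I \<longlonglongrightarrow> 0" and \<epsilon>: "\<And>m. \<epsilon> m > 0"
    and upper: "\<And>\<psi> A m. orlicz_fun \<psi> \<Longrightarrow> A \<ge> 0 \<Longrightarrow> \<psi> A * I m \<le> 1 \<Longrightarrow>
      nrm \<psi> (\<lambda>z. of_real A * peak u z ^ m) \<le> 1"
    and lower: "\<And>\<psi> A m. orlicz_fun \<psi> \<Longrightarrow> A \<ge> 0 \<Longrightarrow> \<psi> (2 * A) * \<epsilon> m > 1 \<Longrightarrow>
      (\<lambda>z. of_real A * peak u z ^ m) \<circ> \<phi> \<in> X \<psi> \<Longrightarrow> 1 / 4 \<le> nrm \<psi> ((\<lambda>z. of_real A * peak u z ^ m) \<circ> \<phi>)"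
  shows "\<exists>\<psi>. orlicz_fun \<psi> \<and> \<not> compact_comp (X \<psi>) (nrm \<psi>) \<phi>"
proof -
  obtain \<psi> m where \<psi>: "orlicz_fun \<psi>" and m: "\<And>k. m k \<ge> k" "\<And>k. \<psi> (real (k + 1)) * I (m k) \<le> 1"
    "\<And>k. \<psi> (2 * real (k + 1)) * \<epsilon> (m k) > 1"
    by (rule fast_growing_orlicz_fun[where I = I and \<epsilon> = \<epsilon>, OF I \<epsilon>]) blast
  interpret ball_space "X \<psi>" "nrm \<psi>" by (rule space[OF \<psi>])
  define F where "F k z = of_real (real (k + 1)) * peak u z ^ m k" for k z
  have "\<not> compact_comp (X \<psi>) (nrm \<psi>) \<phi>"
  proof (rule not_compact_comp[of F _ "1 / 4"])
    fix k
    have "norm (F k z) \<le> real (k + 1)" if "z \<in> unit_ball" for z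
      using norm_peak_less_1[OF u, of z] that mult_left_mono[OF power_le_one[of "norm (peak u z)" "m k"], of "real (k + 1)"]
      by (simp add: F_def norm_mult norm_power unit_ball_def del: of_nat_add of_nat_Suc of_real_of_nat_eq)
    then show "F k \<in> X \<psi>"
      using bounded holo_on_peak_power[of "of_real (real (k + 1))" u "m k" unit_ball]
      unfolding F_def by (metis of_nat_0_less_iff zero_less_Suc Suc_eq_plus1)
    show "nrm \<psi> (F k) \<le> 1" unfolding F_def by (rule upper[OF \<psi> _ m(2)]) simp
    show "1 / 4 \<le> nrm \<psi> (F k \<circ> \<phi>)" if "F k \<circ> \<phi> \<in> X \<psi>"
      using lower[OF \<psi> _ m(3), of k] that unfolding F_def by simp
  next
    fix z :: "complex^'n" assume z: "z \<in> unit_ball"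
    define t where "t = norm (peak u (\<phi> z))"
    have "\<phi> z \<in> unit_ball" using \<phi> z by blast
    then have t: "0 \<le> t" "t < 1" using norm_peak_less_1[OF u, of "\<phi> z"] by (auto simp: t_def unit_ball_def)
    show "(\<lambda>k. F k (\<phi> z)) \<longlonglongrightarrow> 0"
    proof (rule Lim_null_comparison)
      \<comment> \<open>This is where \<open>m k \<ge> k\<close> matters: it replaces the exponent
        \<open>m k\<close> by k, and geometric decay beats the amplitude k + 1.\<close>
      have "(\<lambda>k. real k * t ^ k + t ^ k) \<longlonglongrightarrow> 0 + 0"
        using t by (intro tendsto_add LIMSEQ_power_zero powser_times_n_limit_0) auto
      then show "(\<lambda>k. real (k + 1) * t ^ k) \<longlonglongrightarrow> 0" by (simp add: distrib_right add.commute)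
      have "norm (F k (\<phi> z)) \<le> real (k + 1) * t ^ k" for k
      proof -
        have "norm (F k (\<phi> z)) = real (k + 1) * t ^ m k"
          by (simp add: F_def t_def norm_mult norm_power del: of_nat_add of_nat_Suc of_real_of_nat_eq)
        also have "\<dots> \<le> real (k + 1) * t ^ k"
          using t m(1) by (intro mult_left_mono power_decreasing) auto
        finally show ?thesis .
      qed
      then show "\<forall>\<^sub>F k in sequentially. norm (F k (\<phi> z)) \<le> real (k + 1) * t ^ k" by simp
    qed
  qed simp
  with \<psi> show ?thesis by blast
qed

section \<open>Non-compactness\<close>

text \<open>The cone over {u} lies on a real line, and the real dimension of the space is 2N, hence
  at least 2.\<close>

lemma emeasure_sphere_measure_singleton:
  fixes u :: "complex^'n::finite"
  assumes "norm u = 1"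
  shows "emeasure sphere_measure {u} = 0"
proof -
  have "dim {u} \<le> card {u}" by (rule dim_le_card') simp
  moreover have "1 < DIM(complex^'n)"
  proof -
    have "0 < CARD('n)" by simp
    then have "1 < CARD('n) * 2" by linarith
    then show ?thesis by simp
  qed
  ultimately have "negligible (span {u})" by (intro negligible_lowdim) (simp add: dim_span)
  moreover have sub: "sgn -` {u} \<inter> ball 0 1 \<subseteq> span {u}"
  proof
    fix w assume "w \<in> sgn -` {u} \<inter> ball 0 1"
    then have "w = norm w *\<^sub>R u" by (cases "w = 0") (auto simp: sgn_div_norm)
    then show "w \<in> span {u}" by (metis span_base span_scale singletonI)
  qed
  ultimately have "negligible (sgn -` {u} \<inter> ball 0 1)" by (rule negligible_subset)
  then have "emeasure lebesgue (sgn -` {u} \<inter> ball 0 1) = 0" by (simp add: negligible_iff_null_sets null_sets_def)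
  moreover have "sgn -` {u} \<inter> ball (0::complex^'n) 1 \<in> sets borel"
    using measurable_sets[OF borel_measurable_sgn_euclidean, of "{u}"] by simp
  ultimately have "emeasure lborel (sgn -` {u} \<inter> ball 0 1) = 0" by simp
  then show ?thesis using assms by (subst emeasure_sphere_measure) auto
qed

text \<open>Take the sphere through a nonzero point w of U. The directions in which this sphere
  meets U span a cone that contains a nonempty open set, hence has positive volume. One such radius
  is enough, as the Hardy norm is a supremum over radii.\<close>

lemma emeasure_sphere_measure_dilate_pos:
  fixes U :: "(complex^'n::finite) set"
  assumes U: "open U" "U \<subseteq> unit_ball" "U \<noteq> {}"
  obtains r where "r \<in> {0<..<1}" "{\<zeta> \<in> sphere 0 1. r *\<^sub>R \<zeta> \<in> U} \<in> sets sphere_measure"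
    "emeasure sphere_measure {\<zeta> \<in> sphere 0 1. r *\<^sub>R \<zeta> \<in> U} > 0"
proof -
  have "U \<noteq> {0}" using U(1) not_open_singleton by metis
  with U(3) obtain w where w: "w \<in> U" "w \<noteq> 0" by blast
  define r where "r = norm w"
  have r: "r \<in> {0<..<1}" using w U(2) by (auto simp: r_def unit_ball_def)
  define A where "A = {\<zeta> \<in> sphere (0::complex^'n) 1. r *\<^sub>R \<zeta> \<in> U}"
  have "(\<lambda>\<zeta>. r *\<^sub>R \<zeta>) -` U \<in> sets borel"
    using U(1) by (intro borel_open open_vimage continuous_intros)
  moreover have "A = (\<lambda>\<zeta>. r *\<^sub>R \<zeta>) -` U \<inter> sphere 0 1" by (auto simp: A_def)
  ultimately have Ab: "A \<in> sets borel" by simp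
  have As: "A \<in> sets sphere_measure"
    using Ab by (auto simp: sets_sphere_measure sets_restrict_space_iff A_def)
  \<comment> \<open>The origin is removed because \<open>sgn\<close> is discontinuous there.\<close>
  define O' where "O' = {z \<in> ball 0 1 - {0}. r *\<^sub>R sgn z \<in> U}"
  have "open O'"
  proof -
    have "continuous_on (ball 0 1 - {0}) (\<lambda>z::complex^'n. r *\<^sub>R sgn z)"
      unfolding sgn_div_norm by (intro continuous_intros) auto
    from continuous_open_preimage[OF this _ U(1)] have "open ((ball 0 1 - {0}) \<inter> (\<lambda>z::complex^'n. r *\<^sub>R sgn z) -` U)"
      by (simp add: open_delete)
    moreover have "O' = (ball 0 1 - {0}) \<inter> (\<lambda>z. r *\<^sub>R sgn z) -` U" by (auto simp: O'_def)
    ultimately show ?thesis by simp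
  qed
  moreover have "w \<in> O'" using w U(2) by (auto simp: O'_def r_def sgn_div_norm unit_ball_def)
  ultimately have "0 < emeasure lborel O'" by (intro emeasure_lborel_open_pos) auto
  also have "\<dots> \<le> emeasure lborel (sgn -` A \<inter> ball 0 1)"
  proof (rule emeasure_mono)
    show "O' \<subseteq> sgn -` A \<inter> ball 0 1" by (auto simp: O'_def A_def norm_sgn)
    show "sgn -` A \<inter> ball 0 1 \<in> sets lborel"
      using measurable_sets[OF borel_measurable_sgn_euclidean Ab] by simp
  qed
  finally have "0 < emeasure sphere_measure A"
    using Ab unit_ball_emeasure_pos_finite[where 'a = "complex^'n"]
    by (subst emeasure_sphere_measure) (auto simp: A_def ennreal_zero_less_divide less_top)
  then show thesis using r As by (intro that[of r]) (auto simp: A_def)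
qed

lemma emeasure_bergman_measure_open_pos:
  fixes U :: "(complex^'n::finite) set"
  assumes U: "open U" "U \<subseteq> unit_ball" "U \<noteq> {}" and \<alpha>: "\<alpha> > -1"
  shows "U \<in> sets (bergman_measure \<alpha>)" "emeasure (bergman_measure \<alpha>) U > 0"
proof -
  have [measurable]: "U \<in> sets borel" using U by simp
  show Us: "U \<in> sets (bergman_measure \<alpha>)"
    using U by (auto simp: sets_bergman_measure sets_restrict_space_iff unit_ball_def)
  have [measurable]: "ball (0::complex^'n) 1 \<in> sets borel" by simp
  let ?g = "\<lambda>z. ennreal (bweight \<alpha> z) * indicator U z * indicator (ball 0 1) z"
  have "(\<integral>\<^sup>+z. ?g z \<partial>lborel) \<noteq> 0"
  proof
    assume *: "(\<integral>\<^sup>+z. ?g z \<partial>lborel) = 0"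
    have "?g \<in> borel_measurable lborel" by measurable
    with * have "AE z in lborel. ?g z = 0" by (subst (asm) nn_integral_0_iff_AE) (auto simp: mult_eq_0_iff)
    then have "AE z in lborel. z \<notin> U"
    proof eventually_elim
      case (elim z)
      show ?case
      proof
        assume z: "z \<in> U"
        then have "norm z < 1" using U(2) by (auto simp: unit_ball_def)
        then have "(norm z)\<^sup>2 < 1" by (simp add: power_less_one_iff)
        then show False using z elim \<open>norm z < 1\<close> by (auto simp: bweight_def)
      qed
    qed
    then have "emeasure lborel U = 0" by (subst (asm) AE_iff_measurable[of U]) auto
    then show False using emeasure_lborel_open_pos[OF U(1,3)] by simp
  qed
  moreover have "emeasure (bergman_measure \<alpha>) U = (\<integral>\<^sup>+z. indicator U z \<partial>bergman_measure \<alpha>)"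
    using Us by simp
  ultimately show "emeasure (bergman_measure \<alpha>) U > 0"
    using bweight_mass[OF \<alpha>, where 'n = 'n]
    by (simp add: nn_integral_bergman_measure ennreal_zero_less_divide less_top zero_less_iff_neq_zero)
qed

lemma open_superlevel_set:
  fixes f :: "complex^'n::finite \<Rightarrow> complex"
  assumes "holo_on f unit_ball"
  shows "open {z \<in> unit_ball. norm (f z) > a}"
proof -
  have "continuous_on unit_ball (\<lambda>z. norm (f z))"
    by (intro continuous_on_norm holo_on_imp_continuous_on assms)
  moreover have "open (unit_ball :: (complex^'n) set)" by (simp add: unit_ball_def)
  ultimately have "open (unit_ball \<inter> (\<lambda>z. norm (f z)) -` {a<..})"
    by (rule continuous_open_preimage) simp
  moreover have "unit_ball \<inter> (\<lambda>z. norm (f z)) -` {a<..} = {z \<in> unit_ball. norm (f z) > a}" by auto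
  ultimately show ?thesis by simp
qed

text \<open>Origin of the constant 1/4: the threshold A / 2 divided by the scale 1/4 is 2 * A, the
  argument at which \<psi> has been made large.\<close>

lemma lux_norm_peak_power_ge:
  assumes \<psi>: "orlicz_fun \<psi>" and A: "A \<ge> 0" and f: "f \<in> orlicz_space M \<psi>"
    and M: "emeasure M (space M) = 1" and S: "S \<in> sets M" "\<And>x. x \<in> S \<Longrightarrow> A / 2 \<le> norm (f x)"
    and gt: "\<psi> (2 * A) * measure M S > 1"
  shows "1 / 4 \<le> lux_norm M \<psi> f"
proof (rule lux_norm_lower_bound[OF \<psi> f S])
  have "emeasure M S \<le> 1" using emeasure_space[of M S] M by simp
  then have "emeasure M S = ennreal (measure M S)"
    by (intro emeasure_eq_ennreal_measure) (metis ennreal_one_less_top leD)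
  moreover have "ennreal (\<psi> (2 * A)) * ennreal (measure M S) = ennreal (\<psi> (2 * A) * measure M S)"
    by (intro ennreal_mult''[symmetric]) simp
  moreover have "\<dots> > 1" using gt by (metis ennreal_1 ennreal_less_iff zero_le_one)
  ultimately show "1 < ennreal (\<psi> (A / 2 / (1 / 4))) * emeasure M S" by (simp add: mult.commute)
qed (use A in auto)

section \<open>Failure of compactness on each space when the image of \<phi> reaches the
  sphere\<close>

context
  fixes \<phi> :: "complex^'n::finite \<Rightarrow> complex^'n" and u :: "complex^'n"
  assumes \<phi>: "holo_self_map \<phi>" and u: "norm u = 1"
    and peak: "\<And>m. \<exists>z\<in>unit_ball. norm (peak u (\<phi> z) ^ m) > 1 / 2"
begin

text \<open>The strict inequality makes the set open, which is what yields positive measure.\<close>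

definition peak_set :: "nat \<Rightarrow> (complex^'n) set" where
  "peak_set m = {z \<in> unit_ball. norm (peak u (\<phi> z) ^ m) > 1 / 2}"

lemma peak_set: "open (peak_set m)" "peak_set m \<subseteq> unit_ball" "peak_set m \<noteq> {}"
proof -
  have "holo_on ((\<lambda>z. 1 * peak u z ^ m) \<circ> \<phi>) unit_ball"
    using \<phi> by (intro holo_on_compose[OF holo_on_peak_power[where S = unit_ball]]) (auto simp: holo_self_map_def)
  from open_superlevel_set[OF this, of "1 / 2"] show "open (peak_set m)" by (simp add: peak_set_def)
  show "peak_set m \<subseteq> unit_ball" "peak_set m \<noteq> {}" using peak[of m] by (auto simp: peak_set_def)
qed

lemma norm_peak_power_on_peak_set:
  assumes "z \<in> peak_set m" "A \<ge> 0"
  shows "A / 2 \<le> norm (of_real A * peak u (\<phi> z) ^ m)"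
  using assms mult_left_mono[of "1 / 2" "norm (peak u (\<phi> z) ^ m)" A]
  by (simp add: peak_set_def norm_mult)

text \<open>Here \<open>\<epsilon> m\<close> is the surface measure of the slice of
  \<open>peak_set m\<close> at a radius \<open>r m\<close> depending on m; the norm on that one
  sphere bounds the Hardy norm from below. From above, \<open>peak_bound\<close> serves all radii at
  once, so a single sequence \<open>I\<close> suffices.\<close>

lemma hardy_orlicz_not_compact: "\<exists>\<psi>. orlicz_fun \<psi> \<and> \<not> compact_comp (hardy_orlicz \<psi>) (hardy_orlicz_norm \<psi>) \<phi>"
proof -
  let ?\<sigma> = "sphere_measure :: (complex^'n) measure"
  have pm: "peak_bound u \<in> borel_measurable ?\<sigma>"
    by (simp add: measurable_cong_sets[OF sets_sphere_measure refl] measurable_restrict_space1)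
  have "{u} \<in> sets ?\<sigma>" using u by (auto simp: sets_sphere_measure sets_restrict_space_iff)
  then have AE: "AE x in ?\<sigma>. x \<noteq> u"
    using emeasure_sphere_measure_singleton[OF u] by (intro AE_I[of _ _ "{u}"]) auto
  obtain I where I: "I \<longlonglongrightarrow> 0" "\<And>m. (\<integral>\<^sup>+x. ennreal (peak_bound u x ^ m) \<partial>?\<sigma>) = ennreal (I m)"
    by (rule peak_bound_power_integrals[OF emeasure_space_sphere_measure _ pm u AE]) (auto simp: space_sphere_measure)
  have "\<exists>r. r \<in> {0<..<1} \<and> {\<zeta> \<in> sphere 0 1. r *\<^sub>R \<zeta> \<in> peak_set m} \<in> sets ?\<sigma>
      \<and> emeasure ?\<sigma> {\<zeta> \<in> sphere 0 1. r *\<^sub>R \<zeta> \<in> peak_set m} > 0" for m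
    by (rule emeasure_sphere_measure_dilate_pos[OF peak_set[of m]]) blast
  then have "\<exists>r. \<forall>m. r m \<in> {0<..<1} \<and> {\<zeta> \<in> sphere 0 1. r m *\<^sub>R \<zeta> \<in> peak_set m} \<in> sets ?\<sigma>
      \<and> emeasure ?\<sigma> {\<zeta> \<in> sphere 0 1. r m *\<^sub>R \<zeta> \<in> peak_set m} > 0"
    by (intro choice allI)
  then obtain r where r: "\<And>m. r m \<in> {0<..<1}"
    "\<And>m. {\<zeta> \<in> sphere 0 1. r m *\<^sub>R \<zeta> \<in> peak_set m} \<in> sets ?\<sigma>"
    "\<And>m. emeasure ?\<sigma> {\<zeta> \<in> sphere 0 1. r m *\<^sub>R \<zeta> \<in> peak_set m} > 0" by blast
  define S where "S m = {\<zeta> \<in> sphere 0 1. r m *\<^sub>R \<zeta> \<in> peak_set m}" for m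
  have pos: "measure ?\<sigma> (S m) > 0" for m
  proof -
    have "emeasure ?\<sigma> (S m) \<le> 1" using emeasure_space[of ?\<sigma> "S m"] emeasure_space_sphere_measure[where 'n = 'n] by simp
    then show ?thesis using r(3)[of m] unfolding S_def[symmetric] measure_def
      by (simp add: enn2real_positive_iff le_less_trans[OF _ ennreal_one_less_top])
  qed
  show ?thesis
  proof (rule exists_orlicz_not_compact_comp[OF ball_space_hardy_orlicz _ u I(1) pos])
    show "\<phi> ` unit_ball \<subseteq> unit_ball" using \<phi> by (simp add: holo_self_map_def)
    fix \<psi> :: "real \<Rightarrow> real" and A :: real and m :: nat
    assume \<psi>: "orlicz_fun \<psi>" and A: "A \<ge> 0"
    show "hardy_orlicz_norm \<psi> (\<lambda>z. of_real A * peak u z ^ m) \<le> 1" if "\<psi> A * I m \<le> 1"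
      unfolding hardy_orlicz_norm_def
    proof (rule cSUP_least)
      fix \<rho> :: real assume \<rho>: "\<rho> \<in> {0<..<1}"
      show "lux_norm ?\<sigma> \<psi> (\<lambda>\<zeta>. of_real A * peak u (\<rho> *\<^sub>R \<zeta>) ^ m) \<le> 1"
      proof (rule lux_norm_peak_power_le_1[OF \<psi> A u _ pm I(2) that])
        fix \<zeta> assume "\<zeta> \<in> space ?\<sigma>"
        then have "norm (peak u (\<rho> *\<^sub>R \<zeta>)) \<le> peak_bound u \<zeta>"
          using \<rho> by (intro norm_peak_le[OF u]) (auto simp: space_sphere_measure)
        then show "norm (of_real A * peak u (\<rho> *\<^sub>R \<zeta>) ^ m) \<le> A * peak_bound u \<zeta> ^ m"
          using A by (simp add: norm_mult norm_power mult_left_mono power_mono)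
      qed (auto simp: space_sphere_measure)
    qed simp
    assume gt: "\<psi> (2 * A) * measure ?\<sigma> (S m) > 1" and X: "(\<lambda>z. of_real A * peak u z ^ m) \<circ> \<phi> \<in> hardy_orlicz \<psi>"
    have "1 / 4 \<le> lux_norm ?\<sigma> \<psi> (\<lambda>\<zeta>. ((\<lambda>z. of_real A * peak u z ^ m) \<circ> \<phi>) (r m *\<^sub>R \<zeta>))"
    proof (rule lux_norm_peak_power_ge[OF \<psi> A _ emeasure_space_sphere_measure _ _ gt])
      show "(\<lambda>\<zeta>. ((\<lambda>z. of_real A * peak u z ^ m) \<circ> \<phi>) (r m *\<^sub>R \<zeta>)) \<in> orlicz_space ?\<sigma> \<psi>"
        using X r(1)[of m] unfolding hardy_orlicz_def by blast
      show "S m \<in> sets ?\<sigma>" unfolding S_def by (rule r(2))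
      show "A / 2 \<le> norm (((\<lambda>z. of_real A * peak u z ^ m) \<circ> \<phi>) (r m *\<^sub>R \<zeta>))" if "\<zeta> \<in> S m" for \<zeta>
        using norm_peak_power_on_peak_set[of "r m *\<^sub>R \<zeta>" m A] that A by (simp add: S_def)
    qed
    also have "\<dots> \<le> hardy_orlicz_norm \<psi> ((\<lambda>z. of_real A * peak u z ^ m) \<circ> \<phi>)"
      by (rule hardy_orlicz_lux_le[OF X r(1)])
    finally show "1 / 4 \<le> hardy_orlicz_norm \<psi> ((\<lambda>z. of_real A * peak u z ^ m) \<circ> \<phi>)" .
  qed
qed

lemma bergman_orlicz_not_compact:
  assumes \<alpha>: "\<alpha> > -1"
  shows "\<exists>\<psi>. orlicz_fun \<psi> \<and> \<not> compact_comp (bergman_orlicz \<psi> \<alpha>) (bergman_orlicz_norm \<psi> \<alpha>) \<phi>"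
proof -
  let ?\<nu> = "bergman_measure \<alpha> :: (complex^'n) measure"
  have pm: "peak_bound u \<in> borel_measurable ?\<nu>"
    by (simp add: measurable_cong_sets[OF sets_bergman_measure refl] measurable_restrict_space1)
  have AE: "AE x in ?\<nu>. x \<noteq> u"
    using u by (intro AE_I2) (auto simp: space_bergman_measure)
  obtain I where I: "I \<longlonglongrightarrow> 0" "\<And>m. (\<integral>\<^sup>+x. ennreal (peak_bound u x ^ m) \<partial>?\<nu>) = ennreal (I m)"
    by (rule peak_bound_power_integrals[OF emeasure_space_bergman_measure[OF \<alpha>] _ pm u AE]) (auto simp: space_bergman_measure)
  note S = emeasure_bergman_measure_open_pos[OF peak_set \<alpha>]
  have pos: "measure ?\<nu> (peak_set m) > 0" for m
  proof -
    have "emeasure ?\<nu> (peak_set m) \<le> 1"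
      using emeasure_space[of ?\<nu> "peak_set m"] emeasure_space_bergman_measure[OF \<alpha>, where 'n = 'n] by simp
    then show ?thesis using S(2)[of m] unfolding measure_def
      by (simp add: enn2real_positive_iff le_less_trans[OF _ ennreal_one_less_top])
  qed
  show ?thesis
  proof (rule exists_orlicz_not_compact_comp[OF ball_space_bergman_orlicz[OF _ \<alpha>] _ u I(1) pos])
    show "\<phi> ` unit_ball \<subseteq> unit_ball" using \<phi> by (simp add: holo_self_map_def)
    fix \<psi> :: "real \<Rightarrow> real" and A :: real and m :: nat
    assume \<psi>: "orlicz_fun \<psi>" and A: "A \<ge> 0"
    show "bergman_orlicz_norm \<psi> \<alpha> (\<lambda>z. of_real A * peak u z ^ m) \<le> 1" if "\<psi> A * I m \<le> 1"
      unfolding bergman_orlicz_norm_def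
    proof (rule lux_norm_peak_power_le_1[OF \<psi> A u _ pm I(2) that])
      fix z assume "z \<in> space ?\<nu>"
      \<comment> \<open>The radial estimate at radius 1, with \<open>z\<close> now ranging over the
        ball instead of the sphere.\<close>
      then have "norm (peak u (1 *\<^sub>R z)) \<le> peak_bound u z"
        by (intro norm_peak_le[OF u]) (auto simp: space_bergman_measure)
      then show "norm (of_real A * peak u z ^ m) \<le> A * peak_bound u z ^ m"
        using A by (simp add: norm_mult norm_power mult_left_mono power_mono)
    qed (auto simp: space_bergman_measure)
    assume gt: "\<psi> (2 * A) * measure ?\<nu> (peak_set m) > 1" and X: "(\<lambda>z. of_real A * peak u z ^ m) \<circ> \<phi> \<in> bergman_orlicz \<psi> \<alpha>"
    show "1 / 4 \<le> bergman_orlicz_norm \<psi> \<alpha> ((\<lambda>z. of_real A * peak u z ^ m) \<circ> \<phi>)"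
      unfolding bergman_orlicz_norm_def
    proof (rule lux_norm_peak_power_ge[OF \<psi> A _ emeasure_space_bergman_measure[OF \<alpha>] S(1) _ gt])
      show "(\<lambda>z. of_real A * peak u z ^ m) \<circ> \<phi> \<in> orlicz_space ?\<nu> \<psi>"
        using X unfolding bergman_orlicz_def by blast
    qed (use norm_peak_power_on_peak_set A in auto)
  qed
qed

text \<open>The supremum norm is sensitive to single points, so the plain powers of the peak
  function, without amplitudes, keep norm at least 1/2 after composition.\<close>

lemma hinf_not_compact: "\<not> compact_comp hinf hinf_norm \<phi>"
proof -
  interpret ball_space hinf "hinf_norm :: (complex^'n \<Rightarrow> complex) \<Rightarrow> real" by (rule ball_space_hinf)
  have less: "norm (peak u z) < 1" if "z \<in> unit_ball" for z
    using norm_peak_less_1[OF u] that by (auto simp: unit_ball_def)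
  show ?thesis
  proof (rule not_compact_comp[of "\<lambda>k z. 1 * peak u z ^ k" _ "1 / 2"])
    fix k :: nat
    have le: "norm (1 * peak u z ^ k) \<le> 1" if "z \<in> unit_ball" for z
      using less[OF that] by (simp add: norm_power power_le_one)
    then show "(\<lambda>z. 1 * peak u z ^ k) \<in> hinf"
      unfolding hinf_def bounded_iff using holo_on_peak_power[of 1 u k unit_ball] by blast
    show "hinf_norm (\<lambda>z. 1 * peak u z ^ k) \<le> 1"
      unfolding hinf_norm_def using le by (intro cSUP_least) (auto simp: unit_ball_def)
    assume X: "(\<lambda>z. 1 * peak u z ^ k) \<circ> \<phi> \<in> hinf"
    obtain z where z: "z \<in> unit_ball" "norm (peak u (\<phi> z) ^ k) > 1 / 2" using peak by blast
    obtain B where "\<And>z. z \<in> unit_ball \<Longrightarrow> norm (((\<lambda>z. 1 * peak u z ^ k) \<circ> \<phi>) z) \<le> B"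
      using X unfolding hinf_def bounded_iff by blast
    then have "bdd_above ((\<lambda>z. norm (((\<lambda>z. 1 * peak u z ^ k) \<circ> \<phi>) z)) ` unit_ball)" by (rule bdd_aboveI2)
    with z(1) have "norm (((\<lambda>z. 1 * peak u z ^ k) \<circ> \<phi>) z) \<le> hinf_norm ((\<lambda>z. 1 * peak u z ^ k) \<circ> \<phi>)"
      unfolding hinf_norm_def by (intro cSUP_upper)
    with z(2) show "1 / 2 \<le> hinf_norm ((\<lambda>z. 1 * peak u z ^ k) \<circ> \<phi>)" by simp
  next
    fix z assume "z \<in> (unit_ball :: (complex^'n) set)"
    then have "\<phi> z \<in> unit_ball" using \<phi> by (auto simp: holo_self_map_def)
    then have "(\<lambda>k. peak u (\<phi> z) ^ k) \<longlonglongrightarrow> 0" by (intro LIMSEQ_power_zero less)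
    then show "(\<lambda>k. 1 * peak u (\<phi> z) ^ k) \<longlonglongrightarrow> 0" by simp
  qed simp
qed

end

theorem theorem3p1:
  fixes \<phi> :: "complex ^ 'n::finite \<Rightarrow> complex ^ 'n"
  assumes "holo_self_map \<phi>"
  shows "((\<forall>\<psi>. orlicz_fun \<psi> \<longrightarrow> compact_comp (hardy_orlicz \<psi>) (hardy_orlicz_norm \<psi>) \<phi>)
          \<longleftrightarrow> (\<exists>\<alpha>>-1. \<forall>\<psi>. orlicz_fun \<psi> \<longrightarrow>
                 compact_comp (bergman_orlicz \<psi> \<alpha>) (bergman_orlicz_norm \<psi> \<alpha>) \<phi>))
       \<and> ((\<exists>\<alpha>>-1. \<forall>\<psi>. orlicz_fun \<psi> \<longrightarrow>
                 compact_comp (bergman_orlicz \<psi> \<alpha>) (bergman_orlicz_norm \<psi> \<alpha>) \<phi>)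
          \<longleftrightarrow> compact_comp hinf hinf_norm \<phi>)
       \<and> (compact_comp hinf hinf_norm \<phi> \<longleftrightarrow> (SUP z\<in>unit_ball. norm (\<phi> z)) < 1)"
proof -
  have self: "\<phi> ` unit_ball \<subseteq> unit_ball" using assms by (simp add: holo_self_map_def)
  show ?thesis
  proof (cases "(SUP z\<in>unit_ball. norm (\<phi> z)) < 1")
    case True
    have "bdd_above ((\<lambda>z. norm (\<phi> z)) ` unit_ball)"
      using self by (intro bdd_aboveI2[of _ _ 1]) (auto simp: unit_ball_def image_subset_iff less_imp_le)
    then have sub: "\<phi> ` unit_ball \<subseteq> cball 0 (SUP z\<in>unit_ball. norm (\<phi> z))"
      by (auto intro: cSUP_upper)
    note compact = ball_space.compact_comp_if_norm_bounded_away[OF _ assms True sub]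
    have "\<forall>\<psi>. orlicz_fun \<psi> \<longrightarrow> compact_comp (hardy_orlicz \<psi>) (hardy_orlicz_norm \<psi>) \<phi>"
      using compact[OF ball_space_hardy_orlicz] by blast
    moreover have "\<exists>\<alpha>>-1. \<forall>\<psi>. orlicz_fun \<psi> \<longrightarrow> compact_comp (bergman_orlicz \<psi> \<alpha>) (bergman_orlicz_norm \<psi> \<alpha>) \<phi>"
      \<comment> \<open>The witness 0 is the unweighted case; the lemma covers every \<alpha> >
        -1.\<close>
      using compact[OF ball_space_bergman_orlicz] by (intro exI[of _ 0]) auto
    moreover have "compact_comp hinf hinf_norm \<phi>" by (rule compact[OF ball_space_hinf])
    ultimately show ?thesis using True by blast
  next
    case False
    obtain u where u: "norm u = 1" "\<And>m. \<exists>z\<in>unit_ball. norm (peak u (\<phi> z) ^ m) > 1 / 2"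
      by (rule boundary_point_of_image[OF self False]) blast
    show ?thesis
      \<comment> \<open>All three compactness statements fail. For the second, every \<alpha> > -1
        is refuted, with a \<psi> that may depend on \<alpha>.\<close>
      using hardy_orlicz_not_compact[OF assms u] bergman_orlicz_not_compact[OF assms u]
        hinf_not_compact[OF assms u] False by blast
  qed
qed

end
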